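(* Let $n\ge 2$, $0<\alpha<1$, $A>0$, and let $\lambda_1$ be the smallest eigenvalue of the Dirichlet Laplacian (i.e. of $-\Delta$ with Dirichlet boundary conditions) in the unit ball of $\mathbb{R}^{n-1}$. Let $z\in\mathcal{P}_\alpha$, where $\mathcal{P}_\alpha=\{(x,Y)\in\mathbb{R}\times\mathbb{R}^{n-1}: x>0,\ |Y|<Ax^\alpha\}$. Then $$\lim_{t\to\infty} t^{\alpha-1}\log\big[P_z\{|B_{\tau_\alpha}|>t\}\big]=-\frac{\sqrt{\lambda_1}}{A(1-\alpha)}.$$ Furthermore, $$E_z\big[\exp\big(b\,|B_{\tau_\alpha}|^{1-\alpha}\big)\big]$$ is finite if $b<\sqrt{\lambda_1}/[A(1-\alpha)]$ and is infinite if $b>\sqrt{\lambda_1}/[A(1-\alpha)]$.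
   Context: $\{B_t:t\ge 0\}$ is $n$-dimensional Brownian motion; $P_z$ and $E_z$ are the probability and expectation associated with this motion started at $z$. $\tau_\alpha=\inf\{t>0: B_t\notin\mathcal{P}_\alpha\}$ is the exit time from $\mathcal{P}_\alpha$ and $B_{\tau_\alpha}$ is the exit position. *)

theory Defs
  imports "HOL-Probability.Probability"
begin

text \<open>Standard Brownian motion with values in a Euclidean space, started at \<open>z\<close>. All paths are
  continuous, as for the coordinate process on path space; this makes exit times and exit positions
  measurable without completing \<open>M\<close>.\<close>

locale brownian_motion = prob_space M
  for M :: "'w measure" and B :: "real \<Rightarrow> 'w \<Rightarrow> 'a::euclidean_space" and z :: 'a +
  assumes random_variable: "\<And>t. 0 \<le> t \<Longrightarrow> B t \<in> borel_measurable M"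
    and start: "AE \<omega> in M. B 0 \<omega> = z"
    and continuous_paths: "\<And>\<omega>. \<omega> \<in> space M \<Longrightarrow> continuous_on {0..} (\<lambda>t. B t \<omega>)"
    and gaussian_increments: "\<And>s t. 0 \<le> s \<Longrightarrow> s < t \<Longrightarrow>
      distributed M lborel (\<lambda>\<omega>. B t \<omega> - B s \<omega>)
        (\<lambda>x. ennreal (\<Prod>i\<in>Basis. normal_density 0 (sqrt (t - s)) (x \<bullet> i)))"
    and independent_increments: "\<And>(k::nat) t. 0 \<le> t 0 \<Longrightarrow> (\<And>i. i < k \<Longrightarrow> t i < t (Suc i)) \<Longrightarrow>
      indep_vars (\<lambda>_. borel) (\<lambda>i \<omega>. B (t (Suc i)) \<omega> - B (t i) \<omega>) {..<k}"

text \<open>The infimum is taken in the extended reals, so the exit time is \<open>\<infinity>\<close> for a path that never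
  leaves \<open>D\<close>. For such a path the exit position is \<open>B 0 \<omega>\<close>, since \<open>real_of_ereal \<infinity> = 0\<close>; for
  the domains considered here this concerns only a null set of paths.\<close>

definition exit_time :: "(real \<Rightarrow> 'w \<Rightarrow> 'a) \<Rightarrow> 'a set \<Rightarrow> 'w \<Rightarrow> ereal" where
  "exit_time B D \<omega> = (INF t \<in> {t. 0 < t \<and> B t \<omega> \<notin> D}. ereal t)"

definition exit_position :: "(real \<Rightarrow> 'w \<Rightarrow> 'a) \<Rightarrow> 'a set \<Rightarrow> 'w \<Rightarrow> 'a" where
  "exit_position B D \<omega> = B (real_of_ereal (exit_time B D \<omega>)) \<omega>"

definition parabola_region :: "real \<Rightarrow> real \<Rightarrow> (real \<times> 'a::real_normed_vector) set" where
  "parabola_region \<alpha> A = {(x, Y). 0 < x \<and> norm Y < A * x powr \<alpha>}"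

definition dir_deriv :: "'a::euclidean_space \<Rightarrow> ('a \<Rightarrow> real) \<Rightarrow> 'a \<Rightarrow> real" where
  "dir_deriv i u x = frechet_derivative u (at x) i"

text \<open>\<open>C2_on S u\<close> is meant for open \<open>S\<close>.\<close>

definition C2_on :: "'a::euclidean_space set \<Rightarrow> ('a \<Rightarrow> real) \<Rightarrow> bool" where
  "C2_on S u \<longleftrightarrow>
     (\<forall>x\<in>S. u differentiable at x) \<and>
     (\<forall>i\<in>Basis. \<forall>x\<in>S. dir_deriv i u differentiable at x) \<and>
     (\<forall>i\<in>Basis. \<forall>j\<in>Basis. continuous_on S (dir_deriv j (dir_deriv i u)))"

definition laplacian :: "('a::euclidean_space \<Rightarrow> real) \<Rightarrow> 'a \<Rightarrow> real" where
  "laplacian u x = (\<Sum>i\<in>Basis. dir_deriv i (dir_deriv i u) x)"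

text \<open>Eigenvalues of \<open>-\<Delta>\<close> with Dirichlet boundary conditions, in the classical sense. On a domain with
  smooth boundary, such as a ball, this gives the same eigenvalues as the self-adjoint realization
  in \<open>L\<^sup>2\<close>, whose eigenfunctions are then smooth up to the boundary; the eigenvalues are
  real, so real eigenfunctions suffice.\<close>

definition dirichlet_eigenvalue :: "'a::euclidean_space set \<Rightarrow> real \<Rightarrow> bool" where
  "dirichlet_eigenvalue \<Omega> l \<longleftrightarrow>
     (\<exists>u. C2_on \<Omega> u \<and> continuous_on (closure \<Omega>) u \<and>
          (\<exists>x\<in>\<Omega>. u x \<noteq> 0) \<and>
          (\<forall>x\<in>\<Omega>. - laplacian u x = l * u x) \<and>
          (\<forall>x\<in>frontier \<Omega>. u x = 0))"

definition dirichlet_lambda1 :: "'a::euclidean_space set \<Rightarrow> real" where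
  "dirichlet_lambda1 \<Omega> = (LEAST l. dirichlet_eigenvalue \<Omega> l)"

end

(* The exit position has the law of harmonic measure. If h is a nonnegative strict supersolution
   (Delta h < 0) on an open set V, then E_z h(B_tau) <= h z. This is proved without stochastic
   calculus: along a dyadic grid a second-order Taylor bound and Gaussian moments give a
   supermartingale, and Fatou's lemma passes to the limit in the mesh and in a compact exhaustion of V.

   Let phi(|Y|^2) be the radial solution of -Delta u = u in R^(n-1), so that lambda_1 is the first zero
   of phi. On the cross section of radius A x^alpha the rate of decay is sqrt(lambda_1) / (A x^alpha),
   whose integral is sqrt(lambda_1) x^(1-alpha) / (A (1-alpha)). Upper bound: for theta below the critical
   constant, exp (theta x^(1-alpha)) phi(lambda |Y|^2 / (A x^alpha)^2) with lambda < lambda_1, translated in x,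
   is a supersolution bounded below, which bounds the exponential moment and hence the tail. Lower bound:
   at the critical constant, with an additional factor x^N, the same expression with lambda = lambda_1
   is a subsolution that vanishes on the boundary; glued to a quadratic function in the slab
   t < x < (1 + 2 eps) t it bounds from below the probability of leaving the region beyond t. *)

theory Submission
  imports Defs
begin

section \<open>Gaussian moments\<close>

text \<open>Strictness pays for the time grid. One Gaussian step of variance \<open>v\<close>
  changes the mean of a strict supersolution by a trace term of order \<open>v\<close>, negative and
  bounded away from zero on compact sets, and by an error of order \<open>v^2\<close>; on a fine
  grid the first wins. Supersolutions are defined by quadratics touching from above because the
  barrier for the lower bound is a minimum of two smooth functions.

  The two bounds use the constant differently. Below the critical constant the leading term, of
  order \<open>x powr (- 2 * \<alpha>)\<close>, has a sign, and the profile is scaled to stay away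
  from its zero, hence bounded below. At the critical constant that term cancels and the profile
  vanishes on the lateral boundary: the sign has to come from \<open>x powr N\<close> where the
  profile is positive, and from the derivative of the profile where it is not. The power also sends
  the subsolution to zero at the tip, so that cutting the region at a small \<open>x\<close> costs
  less than the value at \<open>z\<close>.

  The eigenvalue of the ball is identified by touching arguments, without spectral theory.\<close>

lemma borel_prod_integral:
  fixes f :: "'a::euclidean_space \<Rightarrow> real \<Rightarrow> real"
  assumes "\<And>i. i \<in> Basis \<Longrightarrow> integrable lborel (f i)"
  shows "integrable lborel (\<lambda>x::'a. \<Prod>i\<in>Basis. f i (x \<bullet> i))"
    and "(\<integral>x. (\<Prod>i\<in>Basis. f i (x \<bullet> i)) \<partial>(lborel::'a measure)) = (\<Prod>i\<in>Basis. integral\<^sup>L lborel (f i))"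
proof -
  interpret product_sigma_finite "\<lambda>_::'a. lborel :: real measure" ..
  have fm: "f i \<in> borel_measurable borel" if "i \<in> Basis" for i
    using borel_measurable_integrable[OF assms[OF that]] by simp
  have m: "(\<lambda>x::'a. \<Prod>i\<in>Basis. f i (x \<bullet> i)) \<in> borel_measurable borel"
    by (intro borel_measurable_prod measurable_compose[OF _ fm]) auto
  have m2: "(\<lambda>g::'a \<Rightarrow> real. \<Sum>b\<in>Basis. g b *\<^sub>R b) \<in> (\<Pi>\<^sub>M b\<in>Basis. lborel) \<rightarrow>\<^sub>M borel"
    by measurable
  have eq: "(\<Prod>i\<in>Basis. f i ((\<Sum>b\<in>Basis. g b *\<^sub>R b) \<bullet> i)) = (\<Prod>i\<in>Basis. f i (g i))" for g :: "'a \<Rightarrow> real"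
    by (intro prod.cong) auto
  show "integrable lborel (\<lambda>x::'a. \<Prod>i\<in>Basis. f i (x \<bullet> i))"
    unfolding lborel_eq[where 'a='a]
    by (subst integrable_distr_eq[OF m2 m]) (simp add: eq product_integrable_prod assms)
  show "(\<integral>x. (\<Prod>i\<in>Basis. f i (x \<bullet> i)) \<partial>(lborel::'a measure)) = (\<Prod>i\<in>Basis. integral\<^sup>L lborel (f i))"
    unfolding lborel_eq[where 'a='a]
    by (subst integral_distr[OF m2 m]) (simp add: eq product_integral_prod assms)
qed

text \<open>\<open>v\<close> is a variance, namely the elapsed time, while
  \<open>normal_density\<close> takes a standard deviation; hence the square root.\<close>

definition gauss_density :: "real \<Rightarrow> 'a::euclidean_space \<Rightarrow> real" where
  "gauss_density v x = (\<Prod>i\<in>Basis. normal_density 0 (sqrt v) (x \<bullet> i))"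

lemma gauss_density_nonneg [simp]: "0 \<le> gauss_density v x"
  unfolding gauss_density_def by (intro prod_nonneg) auto

lemma borel_measurable_gauss_density [measurable]:
  "(gauss_density v :: 'a::euclidean_space \<Rightarrow> real) \<in> borel_measurable borel"
  unfolding gauss_density_def by measurable

lemma gauss_product_moment:
  fixes k :: "'a::euclidean_space \<Rightarrow> nat"
  assumes "0 < v"
  shows "has_bochner_integral lborel (\<lambda>x::'a. gauss_density v x * (\<Prod>i\<in>Basis. (x \<bullet> i) ^ k i))
           (\<Prod>i\<in>Basis. \<integral>x. normal_density 0 (sqrt v) x * x ^ k i \<partial>lborel)"
proof -
  have i: "integrable lborel (\<lambda>x. normal_density 0 (sqrt v) x * x ^ k i)" for i
    using integrable_normal_moment[of "sqrt v" 0 "k i"] assms by simp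
  have "gauss_density v x * (\<Prod>i\<in>Basis. (x \<bullet> i) ^ k i)
      = (\<Prod>i\<in>Basis. normal_density 0 (sqrt v) (x \<bullet> i) * (x \<bullet> i) ^ k i)" for x :: 'a
    by (simp add: gauss_density_def prod.distrib)
  then show ?thesis
    using borel_prod_integral[of "\<lambda>i x. normal_density 0 (sqrt v) x * x ^ k i", OF i]
    by (simp add: has_bochner_integral_iff)
qed

lemma normal_low_moments:
  assumes "0 < v"
  shows "(\<integral>x. normal_density 0 (sqrt v) x * x ^ 0 \<partial>lborel) = 1"
    and "(\<integral>x. normal_density 0 (sqrt v) x * x ^ 1 \<partial>lborel) = 0"
    and "(\<integral>x. normal_density 0 (sqrt v) x * x ^ 2 \<partial>lborel) = v"
    and "(\<integral>x. normal_density 0 (sqrt v) x * x ^ 4 \<partial>lborel) = 3 * v\<^sup>2"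
proof -
  have s: "0 < sqrt v" using assms by simp
  show "(\<integral>x. normal_density 0 (sqrt v) x * x ^ 0 \<partial>lborel) = 1"
    using s by simp
  show "(\<integral>x. normal_density 0 (sqrt v) x * x ^ 1 \<partial>lborel) = 0"
    using integral_normal_moment_odd[OF s, of 0 0] by simp
  show "(\<integral>x. normal_density 0 (sqrt v) x * x ^ 2 \<partial>lborel) = v"
    using integral_normal_moment_even[OF s, of 0 1] assms by (simp add: power2_eq_square field_simps)
  have "(\<integral>x. normal_density 0 (sqrt v) x * x ^ 4 \<partial>lborel) = fact 4 / ((2 / (sqrt v)\<^sup>2) ^ 2 * fact 2)"
    using integral_normal_moment_even[OF s, of 0 2] by simp
  also have "\<dots> = 3 * v\<^sup>2"
    using assms by (simp add: fact_numeral power2_eq_square field_simps)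
  finally show "(\<integral>x. normal_density 0 (sqrt v) x * x ^ 4 \<partial>lborel) = 3 * v\<^sup>2" .
qed

lemma prod_Basis_unit_power:
  fixes i :: "'a::euclidean_space" and f :: "'a \<Rightarrow> nat \<Rightarrow> real"
  assumes "i \<in> Basis" "\<And>b. f b 0 = 1"
  shows "(\<Prod>b\<in>Basis. f b (if b = i then n else 0)) = f i n"
proof -
  have "(\<Prod>b\<in>Basis. f b (if b = i then n else 0)) = (\<Prod>b\<in>Basis. if b = i then f b n else 1)"
    by (intro prod.cong) (auto simp: assms)
  then show ?thesis using assms by simp
qed

lemma gauss_moments:
  assumes v: "0 < v" and i: "i \<in> (Basis::'a::euclidean_space set)"
  shows gauss_mass: "has_bochner_integral lborel (\<lambda>x::'a. gauss_density v x) 1"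
    and gauss_moment_1: "has_bochner_integral lborel (\<lambda>x::'a. gauss_density v x * (x \<bullet> i)) 0"
    and gauss_moment_2: "j \<in> Basis \<Longrightarrow> has_bochner_integral lborel
          (\<lambda>x::'a. gauss_density v x * ((x \<bullet> i) * (x \<bullet> j))) (if i = j then v else 0)"
    and gauss_moment_4: "has_bochner_integral lborel (\<lambda>x::'a. gauss_density v x * (x \<bullet> i) ^ 4) (3 * v\<^sup>2)"
proof -
  note m = normal_low_moments[OF v]
  show "has_bochner_integral lborel (\<lambda>x::'a. gauss_density v x) 1"
    using gauss_product_moment[OF v, of "\<lambda>_. 0"] m(1) by simp
  have single: "has_bochner_integral lborel (\<lambda>x::'a. gauss_density v x * (x \<bullet> i) ^ n)
      (\<integral>x. normal_density 0 (sqrt v) x * x ^ n \<partial>lborel)" for n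
  proof -
    have a: "(\<Prod>b\<in>Basis. (x \<bullet> b) ^ (if b = i then n else 0)) = (x \<bullet> i) ^ n" for x :: 'a
      using prod_Basis_unit_power[OF i, of "\<lambda>b k. (x \<bullet> b) ^ k"] by simp
    have b: "(\<Prod>b\<in>(Basis::'a set). \<integral>x. normal_density 0 (sqrt v) x * x ^ (if b = i then n else 0) \<partial>lborel)
      = (\<integral>x. normal_density 0 (sqrt v) x * x ^ n \<partial>lborel)"
      using prod_Basis_unit_power[OF i, of "\<lambda>b k. \<integral>x. normal_density 0 (sqrt v) x * x ^ k \<partial>lborel", OF m(1)] .
    show ?thesis
      using gauss_product_moment[OF v, of "\<lambda>b. if b = i then n else 0"] unfolding a b .
  qed
  show "has_bochner_integral lborel (\<lambda>x::'a. gauss_density v x * (x \<bullet> i)) 0"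
    using single[of 1] m(2) by simp
  show "has_bochner_integral lborel (\<lambda>x::'a. gauss_density v x * (x \<bullet> i) ^ 4) (3 * v\<^sup>2)"
    using single[of 4] m(4) by simp
  assume j: "j \<in> Basis"
  show "has_bochner_integral lborel
          (\<lambda>x::'a. gauss_density v x * ((x \<bullet> i) * (x \<bullet> j))) (if i = j then v else 0)"
  proof (cases "i = j")
    case True
    then show ?thesis using single[of 2] m(3) by (simp add: power2_eq_square)
  next
    case False
    let ?k = "\<lambda>b. if b = i \<or> b = j then 1 else 0 :: nat"
    have a: "(\<Prod>b\<in>Basis. (x \<bullet> b) ^ ?k b) = (x \<bullet> i) * (x \<bullet> j)" for x :: 'a
    proof -
      have "(\<Prod>b\<in>Basis. (x \<bullet> b) ^ ?k b) = (\<Prod>b\<in>Basis. (if b = i then x \<bullet> i else 1) * (if b = j then x \<bullet> j else 1))"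
        using False by (intro prod.cong) auto
      then show ?thesis using i j by (simp add: prod.distrib)
    qed
    have b: "(\<Prod>b\<in>(Basis::'a set). \<integral>x. normal_density 0 (sqrt v) x * x ^ ?k b \<partial>lborel) = 0"
      using i m(2) by (intro prod_zero) (auto intro!: bexI[of _ i])
    show ?thesis using gauss_product_moment[OF v, of ?k] False unfolding a b by simp
  qed
qed

lemma linear_Basis_expansion:
  assumes "linear L"
  shows "L y = (\<Sum>j\<in>Basis. (y \<bullet> j) *\<^sub>R L j)"
proof -
  have "L y = L (\<Sum>j\<in>Basis. (y \<bullet> j) *\<^sub>R j)" by (simp add: euclidean_representation)
  also have "\<dots> = (\<Sum>j\<in>Basis. (y \<bullet> j) *\<^sub>R L j)"
    by (simp add: linear_sum[OF assms] linear_cmul[OF assms])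
  finally show ?thesis .
qed

text \<open>The linear term has mean zero, the covariance \<open>v\<close> times the identity turns
  the quadratic term into the trace of \<open>L\<close>, and Cauchy-Schwarz against the constant
  vector bounds \<open>norm y ^ 4\<close> by \<open>DIM('a)\<close> times the sum of the fourth
  powers, each of mean \<open>3 * v\<^sup>2\<close>. The trace carries a factor \<open>v\<close>,
  the error a factor \<open>v\<^sup>2\<close>.\<close>

lemma gauss_quadratic_upper:
  fixes p :: "'a::euclidean_space" and L :: "'a \<Rightarrow> 'a"
  assumes v: "0 < v" and L: "linear L" and C: "0 \<le> C"
  shows "\<exists>I. has_bochner_integral lborel
     (\<lambda>y. gauss_density v y * (a + p \<bullet> y + y \<bullet> L y + C * norm y ^ 4)) I
     \<and> I \<le> a + v * (\<Sum>i\<in>Basis. i \<bullet> L i) + 3 * C * (real DIM('a))\<^sup>2 * v\<^sup>2"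
proof -
  have lin: "has_bochner_integral lborel (\<lambda>y::'a. \<Sum>i\<in>Basis. (p \<bullet> i) * (gauss_density v y * (y \<bullet> i))) (\<Sum>i\<in>(Basis::'a set). (p \<bullet> i) * 0)"
    by (intro has_bochner_integral_sum has_bochner_integral_mult_right gauss_moment_1[OF v])
  have lin': "(\<Sum>i\<in>Basis. (p \<bullet> i) * (gauss_density v y * (y \<bullet> i))) = gauss_density v y * (p \<bullet> y)" for y
    by (subst (2) euclidean_inner) (simp add: sum_distrib_left algebra_simps)
  have quad: "has_bochner_integral lborel (\<lambda>y::'a. \<Sum>i\<in>Basis. \<Sum>j\<in>Basis. (i \<bullet> L j) * (gauss_density v y * ((y \<bullet> i) * (y \<bullet> j))))
     (\<Sum>i\<in>(Basis::'a set). \<Sum>j\<in>Basis. (i \<bullet> L j) * (if i = j then v else 0))"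
    by (intro has_bochner_integral_sum has_bochner_integral_mult_right gauss_moment_2[OF v])
  have quad': "(\<Sum>i\<in>Basis. \<Sum>j\<in>Basis. (i \<bullet> L j) * (gauss_density v y * ((y \<bullet> i) * (y \<bullet> j)))) = gauss_density v y * (y \<bullet> L y)" for y
  proof -
    have Ly: "L y = (\<Sum>j\<in>Basis. (y \<bullet> j) *\<^sub>R L j)" by (rule linear_Basis_expansion[OF L])
    have "L y \<bullet> i = (\<Sum>j\<in>Basis. (y \<bullet> j) * (i \<bullet> L j))" for i
      by (subst Ly) (simp add: inner_sum_left inner_commute[of "L _" i])
    then have "y \<bullet> L y = (\<Sum>i\<in>Basis. (y \<bullet> i) * (\<Sum>j\<in>Basis. (y \<bullet> j) * (i \<bullet> L j)))"
      by (subst euclidean_inner) simp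
    then show ?thesis by (simp add: sum_distrib_left mult_ac)
  qed
  have tr: "(\<Sum>i\<in>(Basis::'a set). \<Sum>j\<in>Basis. (i \<bullet> L j) * (if i = j then v else 0)) = v * (\<Sum>i\<in>Basis. i \<bullet> L i)"
    by (simp add: sum_distrib_left mult_ac if_distrib cong: if_cong)
  have four: "has_bochner_integral lborel (\<lambda>y::'a. \<Sum>i\<in>Basis. real DIM('a) * (gauss_density v y * (y \<bullet> i) ^ 4))
     (\<Sum>i\<in>(Basis::'a set). real DIM('a) * (3 * v\<^sup>2))"
    by (intro has_bochner_integral_sum has_bochner_integral_mult_right gauss_moment_4[OF v])
  have four_le: "gauss_density v y * norm y ^ 4 \<le> (\<Sum>i\<in>Basis. real DIM('a) * (gauss_density v y * (y \<bullet> i) ^ 4))" for y :: 'a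
  proof -
    have "norm y ^ 4 = ((norm y)\<^sup>2)\<^sup>2"
      by (simp flip: power_mult)
    also have "\<dots> = (\<Sum>i\<in>Basis. (y \<bullet> i)\<^sup>2 * 1)\<^sup>2"
      by (subst power2_norm_eq_inner, subst euclidean_inner) (simp add: power2_eq_square)
    also have "\<dots> \<le> (\<Sum>i\<in>Basis. ((y \<bullet> i)\<^sup>2)\<^sup>2) * (\<Sum>i\<in>(Basis::'a set). 1\<^sup>2)"
      by (rule Cauchy_Schwarz_ineq_sum)
    finally have "norm y ^ 4 \<le> real DIM('a) * (\<Sum>i\<in>Basis. (y \<bullet> i) ^ 4)"
      by (simp add: mult.commute flip: power_mult)
    then have "gauss_density v y * norm y ^ 4 \<le> gauss_density v y * (real DIM('a) * (\<Sum>i\<in>Basis. (y \<bullet> i) ^ 4))"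
      by (intro mult_left_mono) auto
    then show ?thesis by (simp add: sum_distrib_left mult_ac)
  qed
  have four_i: "integrable lborel (\<lambda>y::'a. gauss_density v y * norm y ^ 4)"
    by (rule Bochner_Integration.integrable_bound[OF integrable.intros[OF four]])
       (use four_le in \<open>auto intro!: AE_I2 order_trans[OF _ abs_ge_self]\<close>)
  have "(\<integral>y. gauss_density v y * norm y ^ 4 \<partial>(lborel::'a measure)) \<le> (\<Sum>i\<in>(Basis::'a set). real DIM('a) * (3 * v\<^sup>2))"
    using integral_mono[OF four_i integrable.intros[OF four] four_le] has_bochner_integral_integral_eq[OF four] by simp
  then have four_b: "(\<integral>y. gauss_density v y * norm y ^ 4 \<partial>(lborel::'a measure)) \<le> 3 * (real DIM('a))\<^sup>2 * v\<^sup>2"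
    by (simp add: power2_eq_square mult_ac)
  obtain b0 :: 'a where b0: "b0 \<in> Basis" using nonempty_Basis by blast
  have "has_bochner_integral lborel (\<lambda>y::'a. a * gauss_density v y + gauss_density v y * (p \<bullet> y)
      + gauss_density v y * (y \<bullet> L y) + C * (gauss_density v y * norm y ^ 4))
     (a * 1 + 0 + v * (\<Sum>i\<in>Basis. i \<bullet> L i) + C * (\<integral>y. gauss_density v y * norm y ^ 4 \<partial>(lborel::'a measure)))"
    using lin quad unfolding lin' quad' tr
    by (intro has_bochner_integral_add has_bochner_integral_mult_right gauss_mass[OF v b0] has_bochner_integral_integrable[OF four_i]) auto
  moreover have "C * (\<integral>y. gauss_density v y * norm y ^ 4 \<partial>(lborel::'a measure)) \<le> 3 * C * (real DIM('a))\<^sup>2 * v\<^sup>2"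
    using mult_left_mono[OF four_b C] by (simp add: mult_ac)
  ultimately show ?thesis
    by (intro exI conjI) (auto simp: algebra_simps)
qed

section \<open>Stopped Gaussian walks\<close>

text \<open>The trace contributes at most \<open>- \<eta> * v\<close> and the quartic term at most
  \<open>\<eta> * v\<close> under the smallness condition on \<open>v\<close>. The expectation of
  \<open>h\<close> is taken as a nonnegative integral, so integrability is a matter for the majorant
  alone.\<close>

lemma gauss_step:
  fixes h :: "'a::euclidean_space \<Rightarrow> real"
  assumes v: "0 < v" "3 * C * (real DIM('a))\<^sup>2 * v \<le> \<eta>" and C: "0 \<le> C" and L: "linear L"
    and trace: "(\<Sum>i\<in>Basis. i \<bullet> L i) \<le> - \<eta>"
    and nonneg: "\<And>y. 0 \<le> h y" and meas[measurable]: "h \<in> borel_measurable borel"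
    and upper: "\<And>y. h (x + y) \<le> h x + p \<bullet> y + y \<bullet> L y + C * norm y ^ 4"
  shows "(\<integral>\<^sup>+y. ennreal (h (x + y)) \<partial>density lborel (\<lambda>y. ennreal (gauss_density v y))) \<le> ennreal (h x)"
proof -
  let ?q = "\<lambda>y. h x + p \<bullet> y + y \<bullet> L y + C * norm y ^ 4"
  obtain I where I: "has_bochner_integral lborel (\<lambda>y. gauss_density v y * ?q y) I"
    and le: "I \<le> h x + v * (\<Sum>i\<in>Basis. i \<bullet> L i) + 3 * C * (real DIM('a))\<^sup>2 * v\<^sup>2"
    using gauss_quadratic_upper[OF v(1) L C, of "h x" p] by blast
  have "v * (\<Sum>i\<in>Basis. i \<bullet> L i) \<le> v * - \<eta>"
    using trace v by (intro mult_left_mono) auto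
  moreover have "3 * C * (real DIM('a))\<^sup>2 * v * v \<le> \<eta> * v"
    using v by (intro mult_right_mono) auto
  ultimately have Ile: "I \<le> h x"
    using le by (simp add: power2_eq_square algebra_simps)
  \<comment> \<open>The majorant inherits nonnegativity from \<open>h\<close>, so its nonnegative
    integral is the Bochner integral \<open>I\<close>.\<close>
  have q0: "0 \<le> ?q y" for y
    using upper[of y] nonneg[of "x + y"] by linarith
  have "(\<integral>\<^sup>+y. ennreal (h (x + y)) \<partial>density lborel (\<lambda>y. ennreal (gauss_density v y)))
      = (\<integral>\<^sup>+y. ennreal (gauss_density v y) * ennreal (h (x + y)) \<partial>lborel)"
    by (rule nn_integral_density) auto
  also have "\<dots> = (\<integral>\<^sup>+y. ennreal (gauss_density v y * h (x + y)) \<partial>lborel)"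
    by (simp add: ennreal_mult' nonneg)
  also have "\<dots> \<le> (\<integral>\<^sup>+y. ennreal (gauss_density v y * ?q y) \<partial>lborel)"
    by (intro nn_integral_mono ennreal_leI mult_left_mono upper) auto
  also have "\<dots> = ennreal I"
    using nn_integral_eq_integral[OF integrable.intros[OF I]] has_bochner_integral_integral_eq[OF I] q0
    by (simp add: mult_nonneg_nonneg)
  finally show ?thesis using Ile by (meson ennreal_leI order_trans)
qed

text \<open>The walk is a deterministic function of the increment sequence because independence is
  available for increments. It freezes at the first position outside \<open>K\<close>, the set on
  which the one-step inequality will hold.\<close>

primrec stopped_walk :: "'a::euclidean_space set \<Rightarrow> 'a \<Rightarrow> (nat \<Rightarrow> 'a) \<Rightarrow> nat \<Rightarrow> 'a" where
  "stopped_walk K z \<xi> 0 = z"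
| "stopped_walk K z \<xi> (Suc k) =
     (let x = stopped_walk K z \<xi> k in if x \<in> K then x + \<xi> k else x)"

lemma stopped_walk_cong:
  fixes K :: "'a::euclidean_space set"
  shows
  "(\<And>i. i < n \<Longrightarrow> \<xi> i = \<zeta> i) \<Longrightarrow> stopped_walk K z \<xi> n = stopped_walk K z \<zeta> n"
  by (induction n) (auto simp: Let_def)

lemma measurable_stopped_walk:
  fixes K :: "'a::euclidean_space set"
  assumes [measurable]: "K \<in> sets borel" and "n \<le> m"
  shows "(\<lambda>\<xi>. stopped_walk K z \<xi> n) \<in> (\<Pi>\<^sub>M i\<in>{..<m}. borel) \<rightarrow>\<^sub>M borel"
  using \<open>n \<le> m\<close>
proof (induction n)
  case (Suc n)
  then have [measurable]: "(\<lambda>\<xi>. stopped_walk K z \<xi> n) \<in> (\<Pi>\<^sub>M i\<in>{..<m}. borel) \<rightarrow>\<^sub>M borel"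
    "(\<lambda>\<xi>. \<xi> n) \<in> (\<Pi>\<^sub>M i\<in>{..<m}. borel) \<rightarrow>\<^sub>M borel" by auto
  show ?case unfolding stopped_walk.simps Let_def by measurable
qed auto

lemma (in prob_space) stopped_walk_expectation:
  fixes h :: "'b::euclidean_space \<Rightarrow> ennreal" and X :: "nat \<Rightarrow> 'a \<Rightarrow> 'b"
  assumes indep: "indep_vars (\<lambda>_. borel) X {..<n}"
    and distr: "\<And>i. i < n \<Longrightarrow> distr M borel (X i) = N"
    and [measurable]: "K \<in> sets borel" "h \<in> borel_measurable borel"
    and step: "\<And>x. x \<in> K \<Longrightarrow> (\<integral>\<^sup>+y. h (x + y) \<partial>N) \<le> h x"
    and "k \<le> n"
  shows "(\<integral>\<^sup>+\<omega>. h (stopped_walk K z (\<lambda>i. X i \<omega>) k) \<partial>M) \<le> h z"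
  using \<open>k \<le> n\<close>
proof (induction k)
  case 0
  show ?case by (simp add: emeasure_space_1)
next
  case (Suc k)
  then have k: "k < n" by simp
  let ?Z = "\<lambda>\<omega>. stopped_walk K z (\<lambda>i. X i \<omega>) k"
  have rv: "random_variable borel (X i)" if "i < n" for i
    using indep that by (auto simp: indep_vars_def)
  have [measurable]: "random_variable borel (X k)" by (rule rv[OF k])
  have N: "sets N = sets borel" "space N = UNIV" "prob_space N"
    using distr[OF k] rv[OF k] by (auto simp: prob_space_distr)
  interpret N: prob_space N by fact
  have "indep_var (PiM {..<k} (\<lambda>_. borel)) (\<lambda>\<omega>. restrict (\<lambda>i. X i \<omega>) {..<k})
                  (PiM {k} (\<lambda>_. borel)) (\<lambda>\<omega>. restrict (\<lambda>i. X i \<omega>) {k})"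
    using k by (intro indep_var_restrict[OF indep]) auto
  then have "indep_var borel ((\<lambda>\<xi>. stopped_walk K z \<xi> k) \<circ> (\<lambda>\<omega>. restrict (\<lambda>i. X i \<omega>) {..<k}))
     borel ((\<lambda>\<xi>. \<xi> k) \<circ> (\<lambda>\<omega>. restrict (\<lambda>i. X i \<omega>) {k}))"
    by (rule indep_var_compose) (auto intro!: measurable_stopped_walk)
  moreover have "(\<lambda>\<xi>. stopped_walk K z \<xi> k) \<circ> (\<lambda>\<omega>. restrict (\<lambda>i. X i \<omega>) {..<k}) = ?Z"
    by (auto simp: fun_eq_iff intro!: stopped_walk_cong)
  moreover have "(\<lambda>\<xi>. \<xi> k) \<circ> (\<lambda>\<omega>. restrict (\<lambda>i. X i \<omega>) {k}) = X k"
    by (auto simp: fun_eq_iff)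
  ultimately have "indep_var borel ?Z borel (X k)" by simp
  then have Z[measurable]: "random_variable borel ?Z"
    and D: "distr M borel ?Z \<Otimes>\<^sub>M N = distr M (borel \<Otimes>\<^sub>M borel) (\<lambda>\<omega>. (?Z \<omega>, X k \<omega>))"
    unfolding indep_var_distribution_eq distr[OF k] by auto
  let ?F = "\<lambda>(x, y). h (if x \<in> K then x + y else x)"
  have F[measurable]: "?F \<in> borel_measurable (borel \<Otimes>\<^sub>M borel)" by measurable
  have F': "?F \<in> borel_measurable (distr M borel ?Z \<Otimes>\<^sub>M N)"
    using F by (simp add: measurable_def sets_pair_measure_cong[OF _ N(1)] space_pair_measure N D cong: measurable_cong_sets)
  have "(\<integral>\<^sup>+\<omega>. h (stopped_walk K z (\<lambda>i. X i \<omega>) (Suc k)) \<partial>M) = (\<integral>\<^sup>+\<omega>. ?F (?Z \<omega>, X k \<omega>) \<partial>M)"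
    by (simp add: Let_def)
  also have "\<dots> = (\<integral>\<^sup>+p. ?F p \<partial>distr M (borel \<Otimes>\<^sub>M borel) (\<lambda>\<omega>. (?Z \<omega>, X k \<omega>)))"
    by (subst nn_integral_distr) auto
  also have "\<dots> = (\<integral>\<^sup>+x. (\<integral>\<^sup>+y. ?F (x, y) \<partial>N) \<partial>distr M borel ?Z)"
    unfolding D[symmetric] by (rule N.nn_integral_fst[OF F', symmetric])
  also have "\<dots> \<le> (\<integral>\<^sup>+x. h x \<partial>distr M borel ?Z)"
  proof (rule nn_integral_mono)
    fix x show "(\<integral>\<^sup>+y. ?F (x, y) \<partial>N) \<le> h x"
      using step by (cases "x \<in> K") (auto simp: N.emeasure_space_1)
  qed
  also have "\<dots> = (\<integral>\<^sup>+\<omega>. h (?Z \<omega>) \<partial>M)"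
    by (subst nn_integral_distr) auto
  also have "\<dots> \<le> h z" using Suc by simp
  finally show ?case .
qed

section \<open>Brownian paths sampled on a grid\<close>

context brownian_motion
begin

lemma increment_law:
  assumes "0 \<le> s" "s < t"
  shows "distr M borel (\<lambda>\<omega>. B t \<omega> - B s \<omega>) = density lborel (\<lambda>x. ennreal (gauss_density (t - s) x))"
proof -
  have "distr M lborel (\<lambda>\<omega>. B t \<omega> - B s \<omega>) = density lborel (\<lambda>x. ennreal (gauss_density (t - s) x))"
    using distributed_distr_eq_density[OF gaussian_increments[OF assms]]
    by (simp add: gauss_density_def)
  then show ?thesis by (simp cong: distr_cong)
qed

lemma stopped_increments_expectation:
  fixes h :: "'a \<Rightarrow> real"
  assumes \<delta>: "0 < \<delta>" "3 * C * (real DIM('a))\<^sup>2 * \<delta> \<le> \<eta>" and C: "0 \<le> C"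
    and nonneg: "\<And>y. 0 \<le> h y" and meas[measurable]: "h \<in> borel_measurable borel"
    and K: "K \<in> sets borel"
    and upper: "\<And>x. x \<in> K \<Longrightarrow> \<exists>p L. linear L \<and> (\<Sum>i\<in>Basis. i \<bullet> L i) \<le> - \<eta> \<and>
        (\<forall>y. h (x + y) \<le> h x + p \<bullet> y + y \<bullet> L y + C * norm y ^ 4)"
  shows "(\<integral>\<^sup>+\<omega>. ennreal (h (stopped_walk K z (\<lambda>i. B (real (Suc i) * \<delta>) \<omega> - B (real i * \<delta>) \<omega>) n)) \<partial>M)
    \<le> ennreal (h z)"
proof (rule stopped_walk_expectation[where N="density lborel (\<lambda>x. ennreal (gauss_density \<delta> x))"])
  show "indep_vars (\<lambda>_. borel) (\<lambda>i \<omega>. B (real (Suc i) * \<delta>) \<omega> - B (real i * \<delta>) \<omega>) {..<n}"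
    using independent_increments[of "\<lambda>i. real i * \<delta>" n] \<delta> by simp
  show "distr M borel (\<lambda>\<omega>. B (real (Suc i) * \<delta>) \<omega> - B (real i * \<delta>) \<omega>)
    = density lborel (\<lambda>x. ennreal (gauss_density \<delta> x))" for i
    using increment_law[of "real i * \<delta>" "real (Suc i) * \<delta>"] \<delta> by (simp add: algebra_simps)
  fix x assume "x \<in> K"
  then obtain p L where "linear L" "(\<Sum>i\<in>Basis. i \<bullet> L i) \<le> - \<eta>"
    "\<And>y. h (x + y) \<le> h x + p \<bullet> y + y \<bullet> L y + C * norm y ^ 4"
    using upper by blast
  from gauss_step[OF \<delta> C this(1,2) nonneg meas this(3)]
  show "(\<integral>\<^sup>+y. ennreal (h (x + y)) \<partial>density lborel (\<lambda>x. ennreal (gauss_density \<delta> x))) \<le> ennreal (h x)" .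
qed (use K in auto)

text \<open>While the sampled path stays in \<open>K\<close>, the increments telescope from
  \<open>B 0 \<omega> = z\<close> to \<open>B\<close> at the grid time. So \<open>m\<close> is the
  first grid index outside \<open>K\<close>, capped at \<open>n\<close>.\<close>

lemma stopped_increments_eq:
  assumes "B 0 \<omega> = z"
  shows "\<exists>m\<le>n. stopped_walk K z (\<lambda>i. B (real (Suc i) * \<delta>) \<omega> - B (real i * \<delta>) \<omega>) n = B (real m * \<delta>) \<omega> \<and>
     (\<forall>i<m. B (real i * \<delta>) \<omega> \<in> K) \<and> (m < n \<longrightarrow> B (real m * \<delta>) \<omega> \<notin> K)"
proof (induction n)
  case 0
  then show ?case using assms by auto
next
  case (Suc n)
  then obtain m where m: "m \<le> n"
    "stopped_walk K z (\<lambda>i. B (real (Suc i) * \<delta>) \<omega> - B (real i * \<delta>) \<omega>) n = B (real m * \<delta>) \<omega>"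
     "\<forall>i<m. B (real i * \<delta>) \<omega> \<in> K" "m < n \<longrightarrow> B (real m * \<delta>) \<omega> \<notin> K" by blast
  show ?case
  proof (cases "B (real m * \<delta>) \<omega> \<in> K")
    case True
    then have "m = n" using m by auto
    with True m show ?thesis
      by (intro exI[of _ "Suc n"]) (auto simp: Let_def less_Suc_eq)
  next
    case False
    with m show ?thesis by (intro exI[of _ m]) (auto simp: Let_def)
  qed
qed

end

section \<open>Strict superharmonicity and exit times\<close>

text \<open>Only a quadratic touching from above is required, with constants uniform near the point, so that
  the minimum of two such functions is again one.\<close>

definition quadratic_majorant :: "real \<Rightarrow> ('a::euclidean_space \<Rightarrow> real) \<Rightarrow> 'a \<Rightarrow> 'a \<Rightarrow> ('a \<Rightarrow> 'a) \<Rightarrow> bool" where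
  "quadratic_majorant e h x p L \<longleftrightarrow>
     linear L \<and> (\<Sum>i\<in>Basis. i \<bullet> L i) \<le> - e \<and> norm p \<le> 1 / e \<and>
     (\<forall>y. \<bar>y \<bullet> L y\<bar> \<le> (norm y)\<^sup>2 / e) \<and>
     (\<forall>y. norm y < e \<longrightarrow> h (x + y) \<le> h x + p \<bullet> y + y \<bullet> L y)"

definition superharmonic_near :: "('a::euclidean_space \<Rightarrow> real) \<Rightarrow> 'a \<Rightarrow> bool" where
  "superharmonic_near h x0 \<longleftrightarrow> (\<exists>e>0. \<forall>x\<in>ball x0 e. \<exists>p L. quadratic_majorant e h x p L)"

text \<open>The single parameter \<open>e\<close> enters the bounds on trace, gradient, form and
  radius in such a way that shrinking it relaxes all of them at once.\<close>

lemma quadratic_majorant_mono: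
  assumes "quadratic_majorant e h x p L" "0 < d" "d \<le> e"
  shows "quadratic_majorant d h x p L"
proof -
  have "1 / e \<le> 1 / d" "(norm y)\<^sup>2 / e \<le> (norm y)\<^sup>2 / d" for y :: 'a
    using assms by (auto intro: frac_le)
  with assms(1) show ?thesis
    unfolding quadratic_majorant_def using assms(3)
    by (meson le_less_trans less_le_trans minus_le_iff neg_le_iff_le order_trans)
qed

lemma superharmonic_near_compact:
  assumes K: "compact K" "\<And>x. x \<in> K \<Longrightarrow> superharmonic_near h x"
  obtains e where "0 < e" "\<And>x. x \<in> K \<Longrightarrow> \<exists>p L. quadratic_majorant e h x p L"
proof -
  obtain r where r: "\<And>x. x \<in> K \<Longrightarrow> 0 < r x"
    "\<And>x y. x \<in> K \<Longrightarrow> y \<in> ball x (r x) \<Longrightarrow> \<exists>p L. quadratic_majorant (r x) h y p L"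
    using K(2) unfolding superharmonic_near_def by metis
  have "K \<subseteq> (\<Union>x\<in>K. ball x (r x))" using r(1) by force
  then obtain F where F: "F \<subseteq> K" "finite F" "K \<subseteq> (\<Union>x\<in>F. ball x (r x))"
    using compactE_image[OF K(1), of K "\<lambda>x. ball x (r x)"] by auto
  \<comment> \<open>\<open>insert 1\<close> keeps the minimum defined when the subcover is
    empty.\<close>
  let ?e = "Min (insert 1 (r ` F))"
  have e: "0 < ?e" using F r(1) by (auto simp: Min_gr_iff)
  have "\<exists>p L. quadratic_majorant ?e h x p L" if "x \<in> K" for x
  proof -
    obtain c where c: "c \<in> F" "x \<in> ball c (r c)" using F(3) \<open>x \<in> K\<close> by blast
    then obtain p L where "quadratic_majorant (r c) h x p L" using r(2)[of c x] F by auto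
    moreover have "?e \<le> r c" using c F by (intro Min_le) auto
    ultimately show ?thesis using e quadratic_majorant_mono by blast
  qed
  with e that show ?thesis by blast
qed

text \<open>Beyond the radius \<open>r\<close> the fourth power absorbs everything, so that a local majorant becomes a
  global one with a Gaussian-integrable error.\<close>

lemma quadratic_majorant_global:
  assumes maj: "quadratic_majorant r h x p L" and r: "0 < r"
    and h: "0 \<le> h x" "\<And>y. h y \<le> m" and m: "0 \<le> m"
  shows "h (x + y) \<le> h x + p \<bullet> y + y \<bullet> L y + (m / r ^ 4 + 1 / r ^ 4 + 1 / r ^ 3) * norm y ^ 4"
proof (cases "norm y < r")
  case True
  have "0 \<le> (m / r ^ 4 + 1 / r ^ 4 + 1 / r ^ 3) * norm y ^ 4"
    using r m by simp
  moreover have "h (x + y) \<le> h x + p \<bullet> y + y \<bullet> L y"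
    using maj True unfolding quadratic_majorant_def by blast
  ultimately show ?thesis by linarith
next
  case False
  \<comment> \<open>In units of \<open>r\<close> the length is at least 1, so \<open>s\<close> and
    \<open>s^2\<close> are at most \<open>s^4\<close>. The three summands of the constant absorb, in
    this order, the bound \<open>m\<close> of \<open>h\<close>, the linear term and the quadratic
    term.\<close>
  define s where "s = norm y / r"
  have s: "1 \<le> s" "norm y = s * r" using False r by (auto simp: s_def)
  have s4: "1 \<le> s ^ 4" "s \<le> s ^ 4" "s ^ 2 \<le> s ^ 4"
    using power_increasing[of 0 4 s] power_increasing[of 1 4 s] power_increasing[of 2 4 s] s by auto
  have "\<bar>p \<bullet> y\<bar> \<le> norm p * norm y" by (rule Cauchy_Schwarz_ineq2)
  also have "\<dots> \<le> 1 / r * norm y"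
    using maj unfolding quadratic_majorant_def by (intro mult_right_mono) auto
  also have "\<dots> = s" using s r by simp
  finally have 1: "- s \<le> p \<bullet> y" by linarith
  have "\<bar>y \<bullet> L y\<bar> \<le> (norm y)\<^sup>2 / r" using maj unfolding quadratic_majorant_def by auto
  also have "\<dots> = s\<^sup>2 * r" using s r by (simp add: power2_eq_square)
  finally have 2: "- (s\<^sup>2 * r) \<le> y \<bullet> L y" by linarith
  have "(m / r ^ 4 + 1 / r ^ 4 + 1 / r ^ 3) * norm y ^ 4 = m * s ^ 4 + s ^ 4 + s ^ 4 * r"
    using r unfolding s(2) by (simp add: field_simps power4_eq_xxxx power3_eq_cube)
  moreover have "s\<^sup>2 * r \<le> s ^ 4 * r" "m * 1 \<le> m * s ^ 4"
    using s4 r m by (auto intro!: mult_right_mono mult_left_mono simp del: mult_1_right)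
  ultimately show ?thesis using 1 2 h(1) h(2)[of "x + y"] s4 by linarith
qed

text \<open>\<open>m j\<close> is the first grid index outside \<open>K\<close>, capped at the
  horizon \<open>j\<close>. An uncapped grid exit cannot precede the infimum. Conversely the exit
  set is relatively open, since \<open>K\<close> is closed, so just after an exit time close to the
  infimum there is a whole interval of exits, which a fine grid must hit.\<close>

lemma dyadic_first_exit_limit:
  fixes b :: "real \<Rightarrow> 'a::topological_space"
  assumes b: "continuous_on {0..} b" and K: "closed K" and s: "0 \<le> s" "b s \<notin> K"
    and m: "\<And>j. m j \<le> j * 2 ^ j" "\<And>j i. i < m j \<Longrightarrow> b (real i / 2 ^ j) \<in> K"
      "\<And>j. m j < j * 2 ^ j \<Longrightarrow> b (real (m j) / 2 ^ j) \<notin> K"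
  shows "(\<lambda>j. real (m j) / 2 ^ j) \<longlonglongrightarrow> Inf {t. 0 \<le> t \<and> b t \<notin> K}" (is "_ \<longlonglongrightarrow> ?T")
proof (rule LIMSEQ_I)
  let ?E = "{t. 0 \<le> t \<and> b t \<notin> K}"
  have bdd: "bdd_below ?E" by (rule bdd_belowI[of _ 0]) auto
  have ne: "?E \<noteq> {}" using s by auto
  fix r :: real assume r: "0 < r"
  obtain t where t: "t \<in> ?E" "t < ?T + r"
    using cInf_lessD[OF ne, of "?T + r"] r by auto
  have "openin (top_of_set {0..}) ({0..} \<inter> b -` (- K))"
    using b K by (intro continuous_openin_preimage_gen) auto
  moreover have "{0..} \<inter> b -` (- K) = ?E" by auto
  ultimately obtain d where d: "0 < d" "ball t d \<inter> {0..} \<subseteq> ?E"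
    using t(1) by (auto simp: openin_contains_ball)
  define d' where "d' = min d (?T + r - t)"
  have d': "0 < d'" using d t by (auto simp: d'_def)
  obtain N where N: "1 / d' < 2 ^ N" using real_arch_pow[of 2 "1 / d'"] by auto
  obtain N' where N': "?T + r < real N'" using reals_Archimedean2 by blast
  show "\<exists>no. \<forall>n\<ge>no. norm (real (m n) / 2 ^ n - ?T) < r"
  proof (intro exI allI impI)
    fix j assume j: "max N N' \<le> j"
    \<comment> \<open>The first grid point at or after \<open>t\<close>; it lies within
      \<open>d'\<close> of \<open>t\<close>, hence still among the exits.\<close>
    define i where "i = nat \<lceil>t * 2 ^ j\<rceil>"
    have "(2::real) ^ N \<le> 2 ^ j" using j by simp
    then have "1 / 2 ^ j < d'" using N d' less_le_trans[OF _ mult_left_mono[of "2 ^ N" "2 ^ j" d'], of 1]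
      by (simp add: divide_simps mult.commute)
    moreover have t0: "0 \<le> t * 2 ^ j" using t by simp
    then have "t * 2 ^ j \<le> real i" "real i < t * 2 ^ j + 1"
      unfolding i_def by (auto simp: le_of_int_ceiling) linarith
    then have "t \<le> real i / 2 ^ j" "real i / 2 ^ j < t + 1 / 2 ^ j"
      by (auto simp: field_simps)
    ultimately have i: "t \<le> real i / 2 ^ j" "real i / 2 ^ j < t + d'" by auto
    then have "real i / 2 ^ j \<in> ball t d \<inter> {0..}"
      using t by (auto simp: dist_real_def d'_def)
    then have "b (real i / 2 ^ j) \<notin> K" using d by blast
    then have "m j \<le> i" using m(2) by (meson not_le)
    then have "real (m j) / 2 ^ j \<le> real i / 2 ^ j" by (simp add: divide_right_mono)
    then have up: "real (m j) / 2 ^ j < ?T + r" using i unfolding d'_def by linarith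
    \<comment> \<open>The cap corresponds to the time \<open>j\<close>, which already exceeds the
      infimum plus \<open>r\<close>.\<close>
    have "m j < j * 2 ^ j"
    proof (rule ccontr)
      assume "\<not> m j < j * 2 ^ j"
      then have "real (m j) / 2 ^ j = real j" using m(1)[of j] by simp
      then show False using up N' j by linarith
    qed
    from m(3)[OF this] have "?T \<le> real (m j) / 2 ^ j"
      using bdd by (intro cInf_lower) auto
    then show "norm (real (m j) / 2 ^ j - ?T) < r" using up by simp
  qed
qed

text \<open>Before \<open>T\<close> the path lies in the closed set \<open>K\<close>, so by
  continuity it lies there at \<open>T\<close> too; for \<open>T = 0\<close> this is the assumption
  on the start.\<close>

lemma before_Inf_exit:
  fixes b :: "real \<Rightarrow> 'a::topological_space"
  assumes b: "continuous_on {0..} b" and K: "closed K" and s: "0 \<le> s" "b s \<notin> K" and "b 0 \<in> K"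
  defines "T \<equiv> Inf {t. 0 \<le> t \<and> b t \<notin> K}"
  shows "0 \<le> T" "T \<le> s" "b T \<in> K"
proof -
  let ?E = "{t. 0 \<le> t \<and> b t \<notin> K}"
  have bdd: "bdd_below ?E" by (rule bdd_belowI[of _ 0]) auto
  show T0: "0 \<le> T" unfolding T_def using s by (intro cInf_greatest) auto
  show "T \<le> s" unfolding T_def using s bdd by (intro cInf_lower) auto
  have in_K: "b t \<in> K" if "0 \<le> t" "t < T" for t
    using cInf_lower[OF _ bdd, of t] that unfolding T_def by force
  show "b T \<in> K"
  proof (cases "T = 0")
    case False
    with T0 have T: "0 < T" by simp
    have "closed ({0..} \<inter> b -` K)"
      using b closed_atLeast K by (rule continuous_closed_preimage)
    moreover have "{0<..<T} \<subseteq> {0..} \<inter> b -` K" using in_K by auto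
    ultimately have "closure {0<..<T} \<subseteq> {0..} \<inter> b -` K" by (intro closure_minimal)
    moreover have "T \<in> closure {0<..<T}" using T by simp
    ultimately show ?thesis by blast
  qed (use \<open>b 0 \<in> K\<close> in simp)
qed

text \<open>For an open set the times outside form a closed set, so the infimum is attained, in
  contrast to \<open>before_Inf_exit\<close>. Since the path starts in \<open>V\<close>, admitting
  time 0 does not enlarge the set of times in the definition.\<close>

lemma exit_time_finite:
  fixes B :: "real \<Rightarrow> 'w \<Rightarrow> 'a::topological_space"
  assumes b: "continuous_on {0..} (\<lambda>t. B t \<omega>)" and V: "open V" "B 0 \<omega> \<in> V" and fin: "exit_time B V \<omega> < \<infinity>"
  defines "T \<equiv> real_of_ereal (exit_time B V \<omega>)"
  shows "exit_time B V \<omega> = ereal T" "0 < T" "B T \<omega> \<notin> V" "\<And>t. 0 \<le> t \<Longrightarrow> t < T \<Longrightarrow> B t \<omega> \<in> V"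
proof -
  let ?E = "{t. 0 \<le> t \<and> B t \<omega> \<notin> V}"
  have E: "{t. 0 < t \<and> B t \<omega> \<notin> V} = ?E" using V by (auto simp: le_less)
  then have exit: "exit_time B V \<omega> = (INF t\<in>?E. ereal t)" unfolding exit_time_def by simp
  have "0 \<le> exit_time B V \<omega>" unfolding exit by (auto intro!: INF_greatest)
  with fin show T: "exit_time B V \<omega> = ereal T"
    unfolding T_def by (cases "exit_time B V \<omega>") auto
  have lower: "T \<le> t" if "t \<in> ?E" for t
    using INF_lower[OF that, of ereal] T unfolding exit by simp
  have "closed ({0..} \<inter> (\<lambda>t. B t \<omega>) -` (- V))"
    using b V by (intro continuous_closed_preimage) auto
  moreover have "{0..} \<inter> (\<lambda>t. B t \<omega>) -` (- V) = ?E" by auto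
  ultimately have cl: "closed ?E" by simp
  have "?E \<noteq> {}" 
  proof
    assume "?E = {}"
    then show False using fin unfolding exit by (simp only: image_empty Inf_empty) (simp add: top_ereal_def)
  qed
  have bdd: "bdd_below ?E" by (auto intro: bdd_belowI[of _ 0])
  have "T = Inf ?E"
  proof (rule antisym)
    show "T \<le> Inf ?E" using \<open>?E \<noteq> {}\<close> lower by (rule cInf_greatest)
    have "ereal (Inf ?E) \<le> exit_time B V \<omega>"
      unfolding exit by (rule INF_greatest) (auto intro!: cInf_lower bdd)
    then show "Inf ?E \<le> T" using T by simp
  qed
  then have "T \<in> ?E" using closed_contains_Inf[OF \<open>?E \<noteq> {}\<close> bdd cl] by simp
  then show "B T \<omega> \<notin> V" "0 < T" using V by (auto simp: le_less)
  show "B t \<omega> \<in> V" if "0 \<le> t" "t < T" for t using lower[of t] that by auto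
qed

text \<open>Gaussian steps reach the whole space, so \<open>h\<close> is cut to zero off a closed
  neighbourhood of \<open>K\<close>. The discontinuity at its edge is harmless: it lies at distance
  at least \<open>e\<close> from \<open>K\<close>, where the quartic term takes over. The open set
  \<open>U\<close> leaves room for grid positions that overshoot \<open>K\<close>.\<close>

lemma superharmonic_near_global_extension:
  fixes h :: "'a::euclidean_space \<Rightarrow> real"
  assumes V: "open V" and K: "compact K" "K \<subseteq> V" "K \<noteq> {}"
    and h: "continuous_on V h" "\<And>x. x \<in> V \<Longrightarrow> 0 \<le> h x" "\<And>x. x \<in> V \<Longrightarrow> superharmonic_near h x"
  obtains g U C e where "g \<in> borel_measurable borel" "\<And>x. 0 \<le> g x" "open U" "K \<subseteq> U" "U \<subseteq> V"
    "\<And>x. x \<in> U \<Longrightarrow> g x = h x" "0 < e" "0 \<le> C"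
    "\<And>x. x \<in> K \<Longrightarrow> \<exists>p L. linear L \<and> (\<Sum>i\<in>Basis. i \<bullet> L i) \<le> - e \<and>
        (\<forall>y. g (x + y) \<le> g x + p \<bullet> y + y \<bullet> L y + C * norm y ^ 4)"
proof -
  obtain r where r: "0 < r" "{x. infdist x K \<le> r} \<subseteq> V"
    using compact_in_open_separated[OF K(3,1) V K(2)] by blast
  let ?N = "{x. infdist x K \<le> r}" and ?U = "{x. infdist x K < r}"
  have N: "compact ?N" using K r by (intro compact_infdist_le) auto
  have KU: "K \<subseteq> ?U" using r by auto
  define g where "g x = (if x \<in> ?N then h x else 0)" for x
  have hN: "continuous_on ?N h" by (rule continuous_on_subset[OF h(1) r(2)])
  have gm: "g \<in> borel_measurable borel"
    unfolding g_def using N hN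
    by (intro borel_measurable_continuous_on_if) (auto simp: compact_imp_closed)
  have "bounded (h ` ?N)" using N hN compact_continuous_image compact_imp_bounded by blast
  then obtain m where m: "0 < m" "\<And>x. x \<in> ?N \<Longrightarrow> \<bar>h x\<bar> \<le> m"
    by (auto simp: bounded_pos)
  have g0: "0 \<le> g x" and gm': "g x \<le> m" for x
    using m h(2) r(2) by (auto simp: g_def abs_le_iff)
  obtain e0 where e0: "0 < e0" "\<And>x. x \<in> K \<Longrightarrow> \<exists>p L. quadratic_majorant e0 h x p L"
    using superharmonic_near_compact[OF K(1)] h(3) K(2) by blast
  define e where "e = min e0 r"
  have e: "0 < e" using e0 r by (simp add: e_def)
  have local: "\<exists>p L. quadratic_majorant e g x p L" if x: "x \<in> K" for x
  proof -
    obtain p L where pL: "quadratic_majorant e h x p L"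
      using e0(2)[OF x] quadratic_majorant_mono[OF _ e, of e0] unfolding e_def by (meson min.cobounded1)
    have "g (x + y) = h (x + y)" if "norm y < e" for y
    proof -
      have "infdist (x + y) K \<le> dist (x + y) x" using x by (rule infdist_le)
      also have "\<dots> \<le> r" using that by (simp add: dist_norm e_def)
      finally show ?thesis by (simp add: g_def)
    qed
    moreover have "g x = h x" using x r by (simp add: g_def)
    ultimately have "quadratic_majorant e g x p L" using pL by (simp add: quadratic_majorant_def)
    then show ?thesis by blast
  qed
  show ?thesis
  proof (rule that[of g ?U e "m / e ^ 4 + 1 / e ^ 4 + 1 / e ^ 3"])
    show "open ?U" by (intro open_Collect_less continuous_intros)
    fix x assume "x \<in> K"
    then obtain p L where pL: "quadratic_majorant e g x p L" using local by blast
    show "\<exists>p L. linear L \<and> (\<Sum>i\<in>Basis. i \<bullet> L i) \<le> - e \<and>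
        (\<forall>y. g (x + y) \<le> g x + p \<bullet> y + y \<bullet> L y + (m / e ^ 4 + 1 / e ^ 4 + 1 / e ^ 3) * norm y ^ 4)"
      using pL quadratic_majorant_global[OF pL e g0 gm'] m
      unfolding quadratic_majorant_def by (intro exI[of _ p] exI[of _ L]) auto
  next
    show "0 \<le> m / e ^ 4 + 1 / e ^ 4 + 1 / e ^ 3" using m e by simp
    show "?U \<subseteq> V" using r(2) by (auto simp: subset_iff)
    show "g x = h x" if "x \<in> ?U" for x using that by (simp add: g_def)
    show "g \<in> borel_measurable borel" by (rule gm)
    show "0 \<le> g x" for x by (rule g0)
    show "K \<subseteq> ?U" by (rule KU)
    show "0 < e" by (rule e)
  qed
qed

context brownian_motion
begin

lemma measurable_stopped_increments:
  assumes [measurable]: "K \<in> sets borel" and "0 \<le> \<delta>"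
  shows "(\<lambda>\<omega>. stopped_walk K z (\<lambda>i. B (real (Suc i) * \<delta>) \<omega> - B (real i * \<delta>) \<omega>) n) \<in> borel_measurable M"
proof (induction n)
  case (Suc n)
  note [measurable] = Suc
  have [measurable]: "B (real i * \<delta>) \<in> borel_measurable M" for i
    using assms by (intro random_variable) auto
  show ?case unfolding stopped_walk.simps Let_def by measurable
qed auto

lemma compact_exit_supermartingale:
  fixes h :: "'a \<Rightarrow> real"
  assumes V: "open V" and K: "compact K" "K \<subseteq> V" "z \<in> K"
    and h: "continuous_on V h" "\<And>x. x \<in> V \<Longrightarrow> 0 \<le> h x" "\<And>x. x \<in> V \<Longrightarrow> superharmonic_near h x"
  shows "\<exists>F \<in> borel_measurable M. (\<integral>\<^sup>+\<omega>. F \<omega> \<partial>M) \<le> ennreal (h z) \<and>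
     (\<forall>\<omega>\<in>space M. \<forall>s\<ge>0. B 0 \<omega> = z \<longrightarrow> B s \<omega> \<notin> K \<longrightarrow> F \<omega> = ennreal (h (B (Inf {t. 0 \<le> t \<and> B t \<omega> \<notin> K}) \<omega>)))"
proof -
  have Kc: "closed K" "K \<in> sets borel"
    using compact_imp_closed[OF K(1)] borel_closed by blast+
  obtain g U C e where g[measurable]: "g \<in> borel_measurable borel" and g0: "\<And>x. 0 \<le> g x"
    and U: "open U" "K \<subseteq> U" "U \<subseteq> V" "\<And>x. x \<in> U \<Longrightarrow> g x = h x" and e: "0 < e" "0 \<le> C"
    and maj: "\<And>x. x \<in> K \<Longrightarrow> \<exists>p L. linear L \<and> (\<Sum>i\<in>Basis. i \<bullet> L i) \<le> - e \<and>
        (\<forall>y. g (x + y) \<le> g x + p \<bullet> y + y \<bullet> L y + C * norm y ^ 4)"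
    by (rule superharmonic_near_global_extension[OF V K(1,2) _ h]) (use K(3) in blast)+
  define Z where "Z j \<omega> = stopped_walk K z (\<lambda>i. B (real (Suc i) * (1 / 2 ^ j)) \<omega> - B (real i * (1 / 2 ^ j)) \<omega>) (j * 2 ^ j)" for j \<omega>
  have Zm[measurable]: "Z j \<in> borel_measurable M" for j
    unfolding Z_def by (intro measurable_stopped_increments Kc) auto
  define F where "F \<omega> = liminf (\<lambda>j. ennreal (g (Z j \<omega>)))" for \<omega>
  have Fm: "F \<in> borel_measurable M" unfolding F_def by measurable
  have "(\<lambda>j. 3 * C * (real DIM('a))\<^sup>2 * (1 / 2 ^ j)) \<longlonglongrightarrow> 0"
    by (intro tendsto_mult_right_zero LIMSEQ_divide_realpow_zero) auto
  then have "\<forall>\<^sub>F j in sequentially. 3 * C * (real DIM('a))\<^sup>2 * (1 / 2 ^ j) < e"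
    by (rule order_tendstoD) (rule e)
  then have ev: "\<forall>\<^sub>F j in sequentially. (\<integral>\<^sup>+\<omega>. ennreal (g (Z j \<omega>)) \<partial>M) \<le> ennreal (g z)"
  proof eventually_elim
    case (elim j)
    show ?case unfolding Z_def
      by (rule stopped_increments_expectation[OF _ less_imp_le[OF elim] e(2) g0 g Kc(2) maj]) auto
  qed
  have "(\<integral>\<^sup>+\<omega>. F \<omega> \<partial>M) \<le> liminf (\<lambda>j. \<integral>\<^sup>+\<omega>. ennreal (g (Z j \<omega>)) \<partial>M)"
    unfolding F_def by (intro nn_integral_liminf) measurable
  also have "\<dots> \<le> ennreal (g z)"
    using ev by (intro Liminf_le) auto
  also have "g z = h z" using U K by auto
  finally have int: "(\<integral>\<^sup>+\<omega>. F \<omega> \<partial>M) \<le> ennreal (h z)" .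
  have "F \<omega> = ennreal (h (B (Inf {t. 0 \<le> t \<and> B t \<omega> \<notin> K}) \<omega>))" (is "_ = ennreal (h (B ?T \<omega>))")
    if \<omega>: "\<omega> \<in> space M" and s: "0 \<le> s" "B s \<omega> \<notin> K" and B0: "B 0 \<omega> = z" for \<omega> s
  proof -
    have "\<exists>m. \<forall>j. m j \<le> j * 2 ^ j \<and> Z j \<omega> = B (real (m j) * (1 / 2 ^ j)) \<omega> \<and>
     (\<forall>i<m j. B (real i * (1 / 2 ^ j)) \<omega> \<in> K) \<and> (m j < j * 2 ^ j \<longrightarrow> B (real (m j) * (1 / 2 ^ j)) \<omega> \<notin> K)"
      unfolding Z_def by (rule choice, rule allI, rule stopped_increments_eq[OF B0])
    then obtain m where m: "\<And>j. m j \<le> j * 2 ^ j" "\<And>j. Z j \<omega> = B (real (m j) / 2 ^ j) \<omega>"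
     "\<And>j i. i < m j \<Longrightarrow> B (real i / 2 ^ j) \<omega> \<in> K" "\<And>j. m j < j * 2 ^ j \<Longrightarrow> B (real (m j) / 2 ^ j) \<omega> \<notin> K"
      by auto
    have b: "continuous_on {0..} (\<lambda>t. B t \<omega>)" using continuous_paths \<omega> by auto
    have lim: "(\<lambda>j. real (m j) / 2 ^ j) \<longlonglongrightarrow> ?T"
      using dyadic_first_exit_limit[OF b Kc(1) s m(1,3,4)] by simp
    have T: "0 \<le> ?T" "B ?T \<omega> \<in> K"
      using before_Inf_exit[OF b Kc(1) s] B0 K by auto
    have "(\<lambda>j. B (real (m j) / 2 ^ j) \<omega>) \<longlonglongrightarrow> B ?T \<omega>"
      by (rule continuous_on_tendsto_compose[OF b lim]) (use T in auto)
    then have Zl: "(\<lambda>j. Z j \<omega>) \<longlonglongrightarrow> B ?T \<omega>" by (simp add: m(2))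
    have "isCont h (B ?T \<omega>)"
      using h(1) V T K by (meson continuous_on_eq_continuous_at subsetD)
    then have "(\<lambda>j. h (Z j \<omega>)) \<longlonglongrightarrow> h (B ?T \<omega>)" using Zl by (rule isCont_tendsto_compose)
    moreover have "\<forall>\<^sub>F j in sequentially. Z j \<omega> \<in> U"
      using topological_tendstoD[OF Zl U(1)] T U by auto
    then have "\<forall>\<^sub>F j in sequentially. h (Z j \<omega>) = g (Z j \<omega>)"
      by eventually_elim (simp add: U)
    ultimately have "(\<lambda>j. g (Z j \<omega>)) \<longlonglongrightarrow> h (B ?T \<omega>)"
      by (rule Lim_transform_eventually)
    then have "(\<lambda>j. ennreal (g (Z j \<omega>))) \<longlonglongrightarrow> ennreal (h (B ?T \<omega>))" by (rule tendsto_ennrealI)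
    then show ?thesis unfolding F_def by (intro lim_imp_Liminf) auto
  qed
  with Fm int show ?thesis by blast
qed

text \<open>For \<open>s\<close> before the exit the path on \<open>{0..s}\<close> is a compact
  subset of \<open>V\<close> and so lies in all late members of a compact exhaustion; therefore
  their exit times converge to that of \<open>V\<close>. Continuity of \<open>h\<close> up to the
  boundary carries the values along. Whether all paths leave \<open>V\<close> is kept as a separate
  question.\<close>

theorem superharmonic_exit_expectation:
  fixes h :: "'a \<Rightarrow> real"
  assumes V: "open V" "z \<in> V"
    and h: "continuous_on (closure V) h" "\<And>x. x \<in> V \<Longrightarrow> 0 \<le> h x" "\<And>x. x \<in> V \<Longrightarrow> superharmonic_near h x"
  shows "\<exists>F \<in> borel_measurable M. (\<integral>\<^sup>+\<omega>. F \<omega> \<partial>M) \<le> ennreal (h z) \<and>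
    (AE \<omega> in M. exit_time B V \<omega> < \<infinity> \<longrightarrow> ennreal (h (exit_position B V \<omega>)) \<le> F \<omega>)"
proof -
  have hV: "continuous_on V h" by (rule continuous_on_subset[OF h(1) closure_subset])
  obtain C :: "nat \<Rightarrow> 'a set" where C: "\<And>n. compact (C n)" "\<And>n. C n \<subseteq> V" "\<And>S. compact S \<Longrightarrow> S \<subseteq> V \<Longrightarrow> \<exists>N. \<forall>n\<ge>N. S \<subseteq> C n"
    using open_Union_compact_subsets[OF V(1)] by metis
  obtain N0 where N0: "\<And>n. N0 \<le> n \<Longrightarrow> z \<in> C n" using C(3)[of "{z}"] V by auto
  define K where "K n = C (N0 + n)" for n
  have K: "compact (K n)" "K n \<subseteq> V" "z \<in> K n" for n using C N0 by (auto simp: K_def)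
  have K': "\<exists>N. \<forall>n\<ge>N. S \<subseteq> K n" if "compact S" "S \<subseteq> V" for S
    using C(3)[OF that] unfolding K_def by (meson trans_le_add2)
  have "\<exists>F. \<forall>n. F n \<in> borel_measurable M \<and> (\<integral>\<^sup>+\<omega>. F n \<omega> \<partial>M) \<le> ennreal (h z) \<and>
     (\<forall>\<omega>\<in>space M. \<forall>s\<ge>0. B 0 \<omega> = z \<longrightarrow> B s \<omega> \<notin> K n \<longrightarrow>
       F n \<omega> = ennreal (h (B (Inf {t. 0 \<le> t \<and> B t \<omega> \<notin> K n}) \<omega>)))"
    using compact_exit_supermartingale[OF V(1) K hV h(2,3)]
    by (intro choice allI) (simp only: Bex_def conj_assoc)
  then obtain F where F[measurable]: "\<And>n. F n \<in> borel_measurable M"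
    and Fi: "\<And>n. (\<integral>\<^sup>+\<omega>. F n \<omega> \<partial>M) \<le> ennreal (h z)"
    and Fv: "\<And>n \<omega> s. \<omega> \<in> space M \<Longrightarrow> 0 \<le> s \<Longrightarrow> B 0 \<omega> = z \<Longrightarrow> B s \<omega> \<notin> K n \<Longrightarrow>
       F n \<omega> = ennreal (h (B (Inf {t. 0 \<le> t \<and> B t \<omega> \<notin> K n}) \<omega>))"
    by blast
  have le: "ennreal (h (exit_position B V \<omega>)) \<le> liminf (\<lambda>n. F n \<omega>)"
    if \<omega>: "\<omega> \<in> space M" and B0: "B 0 \<omega> = z" and fin: "exit_time B V \<omega> < \<infinity>" for \<omega>
  proof -
    have b: "continuous_on {0..} (\<lambda>t. B t \<omega>)" using continuous_paths \<omega> by auto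
    define T where "T = real_of_ereal (exit_time B V \<omega>)"
    have T: "0 < T" "B T \<omega> \<notin> V" "\<And>t. 0 \<le> t \<Longrightarrow> t < T \<Longrightarrow> B t \<omega> \<in> V"
      using exit_time_finite[OF b V(1) _ fin] B0 V(2) unfolding T_def by auto
    define S where "S n = Inf {t. 0 \<le> t \<and> B t \<omega> \<notin> K n}" for n
    have S: "0 \<le> S n" "S n \<le> T" "B (S n) \<omega> \<in> K n" for n
      using before_Inf_exit[OF b compact_imp_closed[OF K(1)], of T n] T K B0 unfolding S_def by auto
    have Slim: "S \<longlonglongrightarrow> T"
    proof (rule order_tendstoI)
      fix a assume "a < T"
      define s where "s = (max a 0 + T) / 2"
      have s: "a < s" "0 \<le> s" "s < T" using \<open>a < T\<close> T(1) by (auto simp: s_def)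
      have "compact ((\<lambda>t. B t \<omega>) ` {0..s})"
        using b by (intro compact_continuous_image continuous_on_subset[OF b]) auto
      moreover have "(\<lambda>t. B t \<omega>) ` {0..s} \<subseteq> V" using T(3) s by auto
      ultimately obtain N where N: "\<And>n. N \<le> n \<Longrightarrow> (\<lambda>t. B t \<omega>) ` {0..s} \<subseteq> K n" using K' by blast
      have "a < S n" if "N \<le> n" for n
      proof -
        have "s \<le> S n" unfolding S_def
        proof (rule cInf_greatest)
          show "{t. 0 \<le> t \<and> B t \<omega> \<notin> K n} \<noteq> {}" using T K(2) by (auto intro!: exI[of _ T])
          fix t assume "t \<in> {t. 0 \<le> t \<and> B t \<omega> \<notin> K n}"
          then show "s \<le> t" using N[OF that] by force
        qed
        then show ?thesis using s by simp
      qed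
      then show "\<forall>\<^sub>F n in sequentially. a < S n" by (auto simp: eventually_sequentially)
    next
      fix a assume "T < a"
      then show "\<forall>\<^sub>F n in sequentially. S n < a" using le_less_trans[OF S(2)] by (intro always_eventually allI) blast
    qed
    have Blim: "(\<lambda>n. B (S n) \<omega>) \<longlonglongrightarrow> B T \<omega>"
      by (rule continuous_on_tendsto_compose[OF b Slim]) (use S T in auto)
    have inV: "B (S n) \<omega> \<in> closure V" for n using S(3) K(2) closure_subset by blast
    have "B T \<omega> \<in> closure V"
      by (rule closed_sequentially[OF closed_closure inV Blim])
    then have "(\<lambda>n. h (B (S n) \<omega>)) \<longlonglongrightarrow> h (B T \<omega>)"
      using inV by (intro continuous_on_tendsto_compose[OF h(1) Blim]) auto
    then have "(\<lambda>n. ennreal (h (B (S n) \<omega>))) \<longlonglongrightarrow> ennreal (h (B T \<omega>))" by (rule tendsto_ennrealI)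
    moreover have "F n \<omega> = ennreal (h (B (S n) \<omega>))" for n
      unfolding S_def using Fv[OF \<omega> _ B0, of T n] T K(2) by auto
    ultimately have "liminf (\<lambda>n. F n \<omega>) = ennreal (h (B T \<omega>))" by (intro lim_imp_Liminf) auto
    then show ?thesis by (simp add: exit_position_def T_def)
  qed
  have ae: "AE \<omega> in M. exit_time B V \<omega> < \<infinity> \<longrightarrow> ennreal (h (exit_position B V \<omega>)) \<le> liminf (\<lambda>n. F n \<omega>)"
    using start AE_space by eventually_elim (use le in simp)
  have "(\<integral>\<^sup>+\<omega>. liminf (\<lambda>n. F n \<omega>) \<partial>M) \<le> liminf (\<lambda>n. \<integral>\<^sup>+\<omega>. F n \<omega> \<partial>M)"
    by (intro nn_integral_liminf) measurable
  also have "\<dots> \<le> ennreal (h z)"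
    using Fi by (intro Liminf_le) auto
  finally have int: "(\<integral>\<^sup>+\<omega>. liminf (\<lambda>n. F n \<omega>) \<partial>M) \<le> ennreal (h z)" .
  show ?thesis by (intro bexI[of _ "\<lambda>\<omega>. liminf (\<lambda>n. F n \<omega>)"] conjI int ae) measurable
qed

end

section \<open>Twice differentiable supersolutions\<close>

lemma quadratic_form_bound:
  fixes M :: "'a::euclidean_space \<Rightarrow> 'a"
  assumes M: "linear M" and c: "\<And>i j. i \<in> Basis \<Longrightarrow> j \<in> Basis \<Longrightarrow> \<bar>i \<bullet> M j\<bar> \<le> c"
  shows "\<bar>y \<bullet> M y\<bar> \<le> c * (real DIM('a))\<^sup>2 * (norm y)\<^sup>2"
proof -
  have My: "M y = (\<Sum>j\<in>Basis. (y \<bullet> j) *\<^sub>R M j)" by (rule linear_Basis_expansion[OF M])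
  have "y \<bullet> M y = (\<Sum>j\<in>Basis. (y \<bullet> j) * (y \<bullet> M j))"
    by (subst My) (simp add: inner_sum_right)
  also have "\<bar>\<dots>\<bar> \<le> (\<Sum>j\<in>(Basis::'a set). norm y * (norm y * (real DIM('a) * c)))"
  proof (rule order_trans[OF sum_abs], rule sum_mono)
    fix j :: 'a assume j: "j \<in> Basis"
    have "norm (M j) \<le> (\<Sum>i\<in>Basis. \<bar>M j \<bullet> i\<bar>)" by (rule norm_le_l1)
    also have "\<dots> \<le> (\<Sum>i\<in>(Basis::'a set). c)"
      using c[OF _ j] by (intro sum_mono) (simp add: inner_commute)
    finally have "norm (M j) \<le> real DIM('a) * c" by simp
    then have "\<bar>y \<bullet> M j\<bar> \<le> norm y * (real DIM('a) * c)"
      using Cauchy_Schwarz_ineq2[of y "M j"] by (meson mult_left_mono norm_ge_zero order_trans)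
    moreover have "\<bar>y \<bullet> j\<bar> \<le> norm y" using j by (rule Basis_le_norm)
    ultimately show "\<bar>(y \<bullet> j) * (y \<bullet> M j)\<bar> \<le> norm y * (norm y * (real DIM('a) * c))"
      unfolding abs_mult by (intro mult_mono) auto
  qed
  finally show ?thesis by (simp add: power2_eq_square mult_ac)
qed

lemma second_order_taylor:
  fixes h :: "'a::euclidean_space \<Rightarrow> real"
  assumes S: "convex S" "x \<in> S" "x + y \<in> S"
    and h: "\<And>x. x \<in> S \<Longrightarrow> (h has_derivative (\<lambda>v. g x \<bullet> v)) (at x)"
    and g: "\<And>x. x \<in> S \<Longrightarrow> (g has_derivative H x) (at x)"
  shows "\<exists>x'\<in>S. h (x + y) = h x + g x \<bullet> y + (y \<bullet> H x' y) / 2"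
proof -
  have seg: "x + t *\<^sub>R y \<in> S" if "0 \<le> t" "t \<le> 1" for t
    using convexD[OF S(1,2,3), of "1 - t" t] that by (simp add: algebra_simps)
  \<comment> \<open>The successive derivatives of \<open>h\<close> along the segment, indexed as the
    Maclaurin formula expects.\<close>
  define k :: "nat \<Rightarrow> real \<Rightarrow> real" where "k = (\<lambda>n t. if n = 0 then h (x + t *\<^sub>R y) else if n = 1 then g (x + t *\<^sub>R y) \<bullet> y
     else H (x + t *\<^sub>R y) y \<bullet> y)"
  have d0: "DERIV (k 0) t :> k (Suc 0) t" if "0 \<le> t" "t \<le> 1" for t
  proof -
    have "((\<lambda>t. x + t *\<^sub>R y) has_derivative (\<lambda>s. s *\<^sub>R y)) (at t)" by (auto intro!: derivative_eq_intros)
    from has_derivative_compose[OF this h[OF seg[OF that]]]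
    show ?thesis unfolding k_def has_field_derivative_def by (simp add: mult_commute_abs)
  qed
  have d1: "DERIV (k 1) t :> k (Suc 1) t" if "0 \<le> t" "t \<le> 1" for t
  proof -
    have "((\<lambda>t. x + t *\<^sub>R y) has_derivative (\<lambda>s. s *\<^sub>R y)) (at t)" by (auto intro!: derivative_eq_intros)
    from has_derivative_inner_left[OF has_derivative_compose[OF this g[OF seg[OF that]]], of y]
    show ?thesis using linear_cmul[OF has_derivative_linear[OF g[OF seg[OF that]]]]
      unfolding k_def has_field_derivative_def by (simp add: mult_commute_abs)
  qed
  have "\<forall>m t. m < 2 \<and> 0 \<le> t \<and> t \<le> 1 \<longrightarrow> DERIV (k m) t :> k (Suc m) t"
    using d0 d1 by (auto simp: numeral_2_eq_2 less_Suc_eq)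
  then obtain t where t: "0 < t" "t < 1"
    "k 0 1 = (\<Sum>m<2. k m 0 / fact m * 1 ^ m) + k 2 t / fact 2 * 1 ^ 2"
    using Maclaurin[of 1 2 k "k 0"] by auto
  then have "h (x + y) = h x + g x \<bullet> y + (y \<bullet> H (x + t *\<^sub>R y) y) / 2"
    by (simp add: k_def numeral_2_eq_2 inner_commute)
  then show ?thesis using seg[of t] t by auto
qed

text \<open>The majorant at \<open>x\<close> takes half the Hessian plus \<open>\<kappa>\<close>
  times the identity. The surplus covers the oscillation of the Hessian between \<open>x\<close> and
  the Taylor point, and it is too small to spoil the negative trace.\<close>

lemma C2_superharmonic_near:
  fixes h :: "'a::euclidean_space \<Rightarrow> real"
  assumes S: "open S" "x0 \<in> S"
    and h: "\<And>x. x \<in> S \<Longrightarrow> (h has_derivative (\<lambda>v. g x \<bullet> v)) (at x)"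
    and g: "\<And>x. x \<in> S \<Longrightarrow> (g has_derivative H x) (at x)"
    and H: "\<And>i j. i \<in> Basis \<Longrightarrow> j \<in> Basis \<Longrightarrow> continuous_on S (\<lambda>x. i \<bullet> H x j)"
    and trace: "(\<Sum>i\<in>Basis. i \<bullet> H x0 i) < 0"
  shows "superharmonic_near h x0"
proof -
  let ?n = "real DIM('a)"
  have n: "1 \<le> ?n" using DIM_positive[where 'a='a] by linarith
  define \<tau> where "\<tau> = - (\<Sum>i\<in>Basis. i \<bullet> H x0 i)"
  have \<tau>: "0 < \<tau>" using trace by (simp add: \<tau>_def)
  \<comment> \<open>The surplus adds \<open>\<tau> / 8\<close> to the trace. If the entries of the
    Hessian move by at most \<open>c\<close>, two Hessians near \<open>x0\<close> differ as
    quadratic forms by at most \<open>2 * \<kappa>\<close>, which after halving is the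
    surplus.\<close>
  define \<kappa> where "\<kappa> = \<tau> / (8 * ?n)"
  have \<kappa>: "0 < \<kappa>" using \<tau> n by (simp add: \<kappa>_def)
  define c where "c = \<kappa> / ?n\<^sup>2"
  have c: "0 < c" using \<kappa> n by (simp add: c_def)
  have "\<forall>\<^sub>F x in at x0. \<forall>(i, j)\<in>Basis \<times> Basis. dist (i \<bullet> H x j) (i \<bullet> H x0 j) < c"
  proof (rule eventually_ball_finite)
    show "\<forall>ij\<in>Basis \<times> Basis. \<forall>\<^sub>F x in at x0. case ij of (i, j) \<Rightarrow> dist (i \<bullet> H x j) (i \<bullet> H x0 j) < c"
    proof safe
      fix i j :: 'a assume "i \<in> Basis" "j \<in> Basis"
      then have "isCont (\<lambda>x. i \<bullet> H x j) x0"
        using H S by (simp add: continuous_on_eq_continuous_at)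
      then show "\<forall>\<^sub>F x in at x0. dist (i \<bullet> H x j) (i \<bullet> H x0 j) < c"
        using c by (simp add: isCont_def tendstoD)
    qed
  qed auto
  moreover have "isCont g x0" using g[OF S(2)] by (rule has_derivative_continuous)
  then have "\<forall>\<^sub>F x in at x0. dist (g x) (g x0) < 1" by (simp add: isCont_def tendstoD)
  moreover have "\<forall>\<^sub>F x in at x0. x \<in> S" using S by (rule eventually_at_in_open')
  ultimately have "\<forall>\<^sub>F x in at x0. (\<forall>(i, j)\<in>Basis \<times> Basis. dist (i \<bullet> H x j) (i \<bullet> H x0 j) < c) \<and> dist (g x) (g x0) < 1 \<and> x \<in> S"
    by eventually_elim auto
  then obtain d where d: "0 < d" "\<And>x. x \<noteq> x0 \<Longrightarrow> dist x x0 < d \<Longrightarrow>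
      (\<forall>(i, j)\<in>Basis \<times> Basis. dist (i \<bullet> H x j) (i \<bullet> H x0 j) < c) \<and> dist (g x) (g x0) < 1 \<and> x \<in> S"
    unfolding eventually_at by auto
  have dH: "\<bar>i \<bullet> H x j - i \<bullet> H x0 j\<bar> \<le> c" if "x \<in> ball x0 d" "i \<in> Basis" "j \<in> Basis" for x i j
  proof (cases "x = x0")
    case False
    then have "\<forall>(i, j)\<in>Basis \<times> Basis. dist (i \<bullet> H x j) (i \<bullet> H x0 j) < c"
      using d(2)[of x] that by (simp add: dist_commute)
    then have "dist (i \<bullet> H x j) (i \<bullet> H x0 j) < c" using that by blast
    then show ?thesis by (simp add: dist_real_def)
  qed (use c in simp)
  have dg: "norm (g x) \<le> norm (g x0) + 1" if "x \<in> ball x0 d" for x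
    using d(2)[of x] that norm_triangle_sub[of "g x" "g x0"]
    by (cases "x = x0") (auto simp: dist_commute dist_norm norm_minus_commute[of "g x"])
  have dS: "x \<in> S" if "x \<in> ball x0 d" for x
    using d(2)[of x] that S by (cases "x = x0") (auto simp: dist_commute)
  define b where "b = (\<Sum>i\<in>Basis. \<Sum>j\<in>Basis. \<bar>i \<bullet> H x0 j\<bar>)"
  have b: "\<bar>i \<bullet> H x0 j\<bar> \<le> b" if "i \<in> Basis" "j \<in> Basis" for i j
  proof -
    have "\<bar>i \<bullet> H x0 j\<bar> \<le> (\<Sum>j\<in>Basis. \<bar>i \<bullet> H x0 j\<bar>)" using that by (intro member_le_sum) auto
    also have "\<dots> \<le> b" unfolding b_def using that by (intro member_le_sum[of _ _ "\<lambda>i. \<Sum>j\<in>Basis. \<bar>i \<bullet> H x0 j\<bar>"]) (auto intro: sum_nonneg)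
    finally show ?thesis .
  qed
  have b0: "0 \<le> b" unfolding b_def by (intro sum_nonneg) auto
  define C where "C = norm (g x0) + 1 + (b + c) * ?n\<^sup>2 + \<kappa>"
  have "0 \<le> (b + c) * ?n\<^sup>2" using b0 c by simp
  then have C: "0 < C" using \<kappa> by (auto simp: C_def intro: add_nonneg_pos add_pos_nonneg)
  \<comment> \<open>\<open>d / 2\<close> keeps \<open>x + y\<close> in the ball of radius
    \<open>d\<close>, \<open>\<tau> / 8\<close> is below what remains of the negative trace, and
    \<open>1 / C\<close> serves the bounds on gradient and form.\<close>
  define e where "e = min (d / 2) (min (\<tau> / 8) (1 / C))"
  have e1: "0 < e" "e \<le> d / 2" "e \<le> \<tau> / 8" "e \<le> 1 / C"
    using d(1) C \<tau> by (auto simp: e_def)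
  have "C \<le> 1 / e" using e1(1,4) C by (simp add: field_simps)
  note e = e1(1-3) this
  have "\<exists>p L. quadratic_majorant e h x p L" if x: "x \<in> ball x0 e" for x
  proof (intro exI)
    have xd: "x \<in> ball x0 d" using x e d by auto
    define L where "L y = (1 / 2) *\<^sub>R H x y + \<kappa> *\<^sub>R y" for y
    have Hx: "linear (H x)" using has_derivative_linear[OF g[OF dS[OF xd]]] .
    have L: "linear L" unfolding L_def
      by (intro linear_compose_add linear_compose_scale_right Hx linear_id[unfolded id_def])
    have yLy: "y \<bullet> L y = (y \<bullet> H x y) / 2 + \<kappa> * (norm y)\<^sup>2" for y
      by (simp add: L_def inner_add_right power2_norm_eq_inner)
    have tr: "(\<Sum>i\<in>Basis. i \<bullet> L i) \<le> - e"
    proof -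
      have 1: "(\<Sum>i\<in>Basis. i \<bullet> L i) = (\<Sum>i\<in>Basis. i \<bullet> H x i) / 2 + \<kappa> * ?n"
        by (simp add: yLy sum.distrib sum_divide_distrib)
      have "(\<Sum>i\<in>Basis. i \<bullet> H x i) \<le> (\<Sum>i\<in>Basis. i \<bullet> H x0 i + c)"
        using dH[OF xd] by (intro sum_mono) (smt (verit, best))
      then have 2: "(\<Sum>i\<in>Basis. i \<bullet> H x i) \<le> - \<tau> + ?n * c" by (simp add: sum.distrib \<tau>_def)
      have 3: "?n * c \<le> \<kappa>"
        using n \<kappa> by (simp add: c_def field_simps power2_eq_square)
      have 4: "\<kappa> \<le> \<tau> / 8" using n \<tau> by (simp add: \<kappa>_def field_simps)
      have "\<kappa> * ?n = \<tau> / 8" using n by (simp add: \<kappa>_def)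
      then show ?thesis using 1 2 3 4 e \<tau> by linarith
    qed
    have np: "norm (g x) \<le> 1 / e"
    proof -
      have "norm (g x) \<le> C" using dg[OF xd] \<open>0 \<le> (b + c) * ?n\<^sup>2\<close> \<kappa> unfolding C_def by linarith
      then show ?thesis using e by linarith
    qed
    have nL: "\<bar>y \<bullet> L y\<bar> \<le> (norm y)\<^sup>2 / e" for y
    proof -
      have "\<bar>i \<bullet> H x j\<bar> \<le> b + c" if "i \<in> Basis" "j \<in> Basis" for i j
        using b[OF that] dH[OF xd that] by linarith
      then have "\<bar>y \<bullet> H x y\<bar> \<le> (b + c) * ?n\<^sup>2 * (norm y)\<^sup>2" by (rule quadratic_form_bound[OF Hx])
      moreover have "0 \<le> \<kappa> * (norm y)\<^sup>2" using \<kappa> by simp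
      moreover have "0 \<le> (norm (g x0) + 1) * (norm y)\<^sup>2" by simp
      moreover have "0 \<le> (b + c) * ?n\<^sup>2 * (norm y)\<^sup>2" using b0 c by simp
      ultimately have "\<bar>y \<bullet> L y\<bar> \<le> C * (norm y)\<^sup>2"
        unfolding yLy C_def ring_distribs(2) by linarith
      also have "\<dots> \<le> 1 / e * (norm y)\<^sup>2" using e by (intro mult_right_mono) auto
      finally show ?thesis by simp
    qed
    have up: "h (x + y) \<le> h x + g x \<bullet> y + y \<bullet> L y" if y: "norm y < e" for y
    proof -
      have "dist x0 (x + y) \<le> dist x0 x + norm y"
        by (metis add_diff_cancel_left' dist_norm dist_triangle norm_minus_commute)
      then have "x + y \<in> ball x0 d" using x y e by auto
      then obtain x' where x': "x' \<in> ball x0 d" "h (x + y) = h x + g x \<bullet> y + (y \<bullet> H x' y) / 2"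
        using second_order_taylor[OF convex_ball xd _ h[OF dS] g[OF dS]] by blast
      have "linear (\<lambda>v. H x' v - H x v)"
        by (intro linear_compose_sub Hx has_derivative_linear[OF g[OF dS[OF x'(1)]]])
      moreover have "\<bar>i \<bullet> (H x' j - H x j)\<bar> \<le> 2 * c" if "i \<in> Basis" "j \<in> Basis" for i j
        using dH[OF xd that] dH[OF x'(1) that] unfolding inner_diff_right by linarith
      ultimately have "\<bar>y \<bullet> (H x' y - H x y)\<bar> \<le> 2 * c * ?n\<^sup>2 * (norm y)\<^sup>2" by (rule quadratic_form_bound)
      also have "\<dots> = 2 * \<kappa> * (norm y)\<^sup>2" using n by (simp add: c_def)
      finally show ?thesis unfolding x'(2) yLy by (simp add: inner_diff_right)
    qed
    show "quadratic_majorant e h x (g x) L"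
      unfolding quadratic_majorant_def using L tr np nL up by blast
  qed
  then show ?thesis unfolding superharmonic_near_def using e by blast
qed

lemma sum_Basis_prod:
  fixes f :: "'a::euclidean_space \<times> 'b::euclidean_space \<Rightarrow> real"
  shows "sum f Basis = (\<Sum>i\<in>Basis. f (i, 0)) + (\<Sum>i\<in>Basis. f (0, i))"
proof -
  have "inj_on (\<lambda>u. (u::'a, 0::'b)) Basis" "inj_on (\<lambda>u. (0::'a, u::'b)) Basis"
    by (auto intro!: inj_onI Pair_inject)
  then show ?thesis
    unfolding Basis_prod_def
    by (subst sum.union_disjoint) (auto simp: sum.reindex)
qed

text \<open>The Hessian of \<open>\<Phi> (x, |Y|\<^sup>2)\<close> has the trace displayed in the last assumption.\<close>

lemma axial_superharmonic_near:
  fixes p0 :: "real \<times> 'a::euclidean_space" and \<Phi> \<Phi>x \<Phi>s \<Phi>xx \<Phi>xs \<Phi>ss :: "real \<times> real \<Rightarrow> real"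
  assumes U: "open U" "(fst p0, snd p0 \<bullet> snd p0) \<in> U"
    and \<Phi>: "\<And>q. q \<in> U \<Longrightarrow> (\<Phi> has_derivative (\<lambda>v. \<Phi>x q * fst v + \<Phi>s q * snd v)) (at q)"
    and \<Phi>x: "\<And>q. q \<in> U \<Longrightarrow> (\<Phi>x has_derivative (\<lambda>v. \<Phi>xx q * fst v + \<Phi>xs q * snd v)) (at q)"
    and \<Phi>s: "\<And>q. q \<in> U \<Longrightarrow> (\<Phi>s has_derivative (\<lambda>v. \<Phi>xs q * fst v + \<Phi>ss q * snd v)) (at q)"
    and cont: "continuous_on U \<Phi>xx" "continuous_on U \<Phi>xs" "continuous_on U \<Phi>ss"
    and lap: "let q = (fst p0, snd p0 \<bullet> snd p0) in \<Phi>xx q + 4 * snd q * \<Phi>ss q + 2 * DIM('a) * \<Phi>s q < 0"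
  shows "superharmonic_near (\<lambda>p. \<Phi> (fst p, snd p \<bullet> snd p)) p0"
proof -
  define Q where "Q p = (fst p, snd p \<bullet> snd p)" for p :: "real \<times> 'a"
  have Qc: "continuous_on S Q" for S unfolding Q_def by (intro continuous_intros)
  have Qd: "(Q has_derivative (\<lambda>v. (fst v, 2 * (snd p \<bullet> snd v)))) (at p)" for p
    unfolding Q_def by (auto intro!: derivative_eq_intros simp: inner_commute)
  define S where "S = Q -` U"
  have S: "open S" unfolding S_def using Qc[of UNIV] U(1) by (simp add: open_vimage)
  have QS: "Q p \<in> U" if "p \<in> S" for p using that by (simp add: S_def)
  define g where "g p = (\<Phi>x (Q p), (2 * \<Phi>s (Q p)) *\<^sub>R snd p)" for p
  define H where "H p v = (\<Phi>xx (Q p) * fst v + \<Phi>xs (Q p) * (2 * (snd p \<bullet> snd v)),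
      (2 * \<Phi>s (Q p)) *\<^sub>R snd v + (2 * (\<Phi>xs (Q p) * fst v + \<Phi>ss (Q p) * (2 * (snd p \<bullet> snd v)))) *\<^sub>R snd p)" for p v
  have "superharmonic_near (\<lambda>p. \<Phi> (Q p)) p0"
  proof (rule C2_superharmonic_near[OF S, where g=g and H=H])
    show "p0 \<in> S" using U(2) by (simp add: S_def Q_def)
    fix p assume p: "p \<in> S"
    show "((\<lambda>p. \<Phi> (Q p)) has_derivative (\<lambda>v. g p \<bullet> v)) (at p)"
      using has_derivative_compose[OF Qd \<Phi>[OF QS[OF p]]]
      by (simp add: g_def inner_prod_def mult_ac)
    have 1: "((\<lambda>p. \<Phi>x (Q p)) has_derivative (\<lambda>v. \<Phi>xx (Q p) * fst v + \<Phi>xs (Q p) * (2 * (snd p \<bullet> snd v)))) (at p)"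
      using has_derivative_compose[OF Qd \<Phi>x[OF QS[OF p]]] by simp
    have 2: "((\<lambda>p. \<Phi>s (Q p)) has_derivative (\<lambda>v. \<Phi>xs (Q p) * fst v + \<Phi>ss (Q p) * (2 * (snd p \<bullet> snd v)))) (at p)"
      using has_derivative_compose[OF Qd \<Phi>s[OF QS[OF p]]] by simp
    show "(g has_derivative H p) (at p)"
      unfolding g_def H_def
      by (rule has_derivative_Pair[OF 1], rule has_derivative_eq_rhs,
          rule has_derivative_scaleR[OF has_derivative_mult_right[OF 2] has_derivative_snd[OF has_derivative_ident]])
        (simp add: fun_eq_iff)
  next
    fix i j :: "real \<times> 'a"
    have "\<Phi>xx \<circ> Q = (\<lambda>p. \<Phi>xx (Q p))" by auto
    have c: "continuous_on S (\<lambda>p. \<Phi>xx (Q p))" "continuous_on S (\<lambda>p. \<Phi>xs (Q p))" "continuous_on S (\<lambda>p. \<Phi>ss (Q p))"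
      using QS by (auto intro!: continuous_on_compose2[OF cont(1) Qc] continuous_on_compose2[OF cont(2) Qc] continuous_on_compose2[OF cont(3) Qc])
    have "continuous_on U \<Phi>s"
      using \<Phi>s has_derivative_continuous continuous_at_imp_continuous_on by blast
    then have cs: "continuous_on S (\<lambda>p. \<Phi>s (Q p))"
      using QS by (auto intro!: continuous_on_compose2[OF _ Qc])
    show "continuous_on S (\<lambda>p. i \<bullet> H p j)"
      unfolding H_def inner_prod_def by (intro continuous_intros c cs)
  next
    have ss: "(\<Sum>i\<in>Basis. (snd p0 \<bullet> i) * (snd p0 \<bullet> i)) = snd p0 \<bullet> snd p0"
      by (rule euclidean_inner[symmetric])
    have "(\<Sum>i\<in>Basis. i \<bullet> H p0 i) = \<Phi>xx (Q p0) + (\<Sum>i\<in>(Basis::'a set).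
        2 * \<Phi>s (Q p0) + 4 * \<Phi>ss (Q p0) * ((snd p0 \<bullet> i) * (snd p0 \<bullet> i)))"
      by (subst sum_Basis_prod) (auto simp: H_def inner_add_right inner_commute intro!: sum.cong)
    also have "\<dots> = \<Phi>xx (Q p0) + 2 * DIM('a) * \<Phi>s (Q p0) + 4 * \<Phi>ss (Q p0) * (snd p0 \<bullet> snd p0)"
      by (simp add: sum.distrib ss flip: sum_distrib_left)
    also have "\<dots> < 0" using lap by (simp add: Q_def Let_def algebra_simps)
    finally show "(\<Sum>i\<in>Basis. i \<bullet> H p0 i) < 0" .
  qed
  then show ?thesis by (simp add: Q_def)
qed

section \<open>Locality and minima of supersolutions\<close>

lemma superharmonic_near_cong:
  assumes "superharmonic_near h x0" "\<forall>\<^sub>F x in nhds x0. h x = k x"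
  shows "superharmonic_near k x0"
proof -
  obtain e where e: "0 < e" "\<forall>x\<in>ball x0 e. \<exists>p L. quadratic_majorant e h x p L"
    using assms(1) unfolding superharmonic_near_def by blast
  obtain d where d: "0 < d" "\<And>x. dist x x0 < d \<Longrightarrow> h x = k x"
    using assms(2) unfolding eventually_nhds_metric by blast
  \<comment> \<open>Half of \<open>d\<close>, since both the base point and the increment move away
    from \<open>x0\<close>.\<close>
  let ?r = "min e (d / 2)"
  have r: "0 < ?r" using e d by simp
  have "\<exists>p L. quadratic_majorant ?r k x p L" if x: "x \<in> ball x0 ?r" for x
  proof -
    have "x \<in> ball x0 e" using x by auto
    then obtain p L where "quadratic_majorant e h x p L" using e(2) by blast
    then have q: "quadratic_majorant ?r h x p L" by (rule quadratic_majorant_mono[OF _ r]) simp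
    have "h (x + y) = k (x + y)" if "norm y < ?r" for y
    proof (rule d(2))
      have "dist (x + y) x0 \<le> norm y + dist x x0" by (metis add_diff_cancel_left' dist_norm dist_triangle)
      then show "dist (x + y) x0 < d" using that x by (auto simp: dist_commute)
    qed
    moreover have "h x = k x" using x r by (intro d(2)) (auto simp: dist_commute)
    ultimately have "quadratic_majorant ?r k x p L"
      using q unfolding quadratic_majorant_def by simp
    then show ?thesis by blast
  qed
  then show ?thesis unfolding superharmonic_near_def using r by blast
qed

text \<open>At each point the majorant of the smaller function also touches the minimum from
  above.\<close>

lemma superharmonic_near_min:
  assumes "superharmonic_near h x0" "superharmonic_near k x0"
  shows "superharmonic_near (\<lambda>x. min (h x) (k x)) x0"
proof -
  obtain e where e: "0 < e" "\<forall>x\<in>ball x0 e. \<exists>p L. quadratic_majorant e h x p L"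
    using assms(1) unfolding superharmonic_near_def by blast
  obtain d where d: "0 < d" "\<forall>x\<in>ball x0 d. \<exists>p L. quadratic_majorant d k x p L"
    using assms(2) unfolding superharmonic_near_def by blast
  let ?r = "min e d"
  have r: "0 < ?r" using e d by simp
  have "\<exists>p L. quadratic_majorant ?r (\<lambda>x. min (h x) (k x)) x p L" if x: "x \<in> ball x0 ?r" for x
  proof (cases "h x \<le> k x")
    case True
    have "x \<in> ball x0 e" using x by auto
    then obtain p L where "quadratic_majorant e h x p L" using e(2) by blast
    then have "quadratic_majorant ?r h x p L" by (rule quadratic_majorant_mono[OF _ r]) simp
    then have "quadratic_majorant ?r (\<lambda>x. min (h x) (k x)) x p L"
      using True unfolding quadratic_majorant_def by (auto intro: min.coboundedI1)
    then show ?thesis by blast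
  next
    case False
    have "x \<in> ball x0 d" using x by auto
    then obtain p L where "quadratic_majorant d k x p L" using d(2) by blast
    then have "quadratic_majorant ?r k x p L" by (rule quadratic_majorant_mono[OF _ r]) simp
    then have "quadratic_majorant ?r (\<lambda>x. min (h x) (k x)) x p L"
      using False unfolding quadratic_majorant_def by (auto intro: min.coboundedI2)
    then show ?thesis by blast
  qed
  then show ?thesis unfolding superharmonic_near_def using r by blast
qed

section \<open>The radial Dirichlet problem in the unit ball\<close>

text \<open>\<open>s \<mapsto> radial_profile d s\<close> with \<open>s = |x|\<^sup>2\<close> is the radial solution of \<open>- \<Delta>u = u\<close> on \<open>\<real>\<^sup>d\<close>
  with \<open>u 0 = 1\<close>.\<close>

fun radial_coeff :: "nat \<Rightarrow> nat \<Rightarrow> real" where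
  "radial_coeff d 0 = 1"
| "radial_coeff d (Suc k) = - radial_coeff d k / (2 * (real k + 1) * (2 * real k + real d))"

definition radial_profile :: "nat \<Rightarrow> real \<Rightarrow> real" where
  "radial_profile d s = (\<Sum>k. radial_coeff d k * s ^ k)"

definition radial_profile' :: "nat \<Rightarrow> real \<Rightarrow> real" where
  "radial_profile' d s = (\<Sum>k. diffs (radial_coeff d) k * s ^ k)"

definition radial_profile'' :: "nat \<Rightarrow> real \<Rightarrow> real" where
  "radial_profile'' d s = (\<Sum>k. diffs (diffs (radial_coeff d)) k * s ^ k)"

lemma summable_radial:
  assumes "0 < d"
  shows "summable (\<lambda>k. radial_coeff d k * s ^ k)"
proof (rule summable_ratio_test)
  show "1 / 2 < (1::real)" by simp
  fix k assume "nat \<lceil>\<bar>s\<bar>\<rceil> \<le> k"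
  then have "\<bar>s\<bar> \<le> real k" by linarith
  define q where "q = 2 * (real k + 1) * (2 * real k + real d)"
  have "2 * (real k + 1) * 1 \<le> q" unfolding q_def using assms by (intro mult_left_mono) auto
  then have q: "0 < q" "2 * \<bar>s\<bar> \<le> q" using \<open>\<bar>s\<bar> \<le> real k\<close> by auto
  have c: "radial_coeff d (Suc k) = - radial_coeff d k / q" by (simp add: q_def)
  have "norm (radial_coeff d (Suc k) * s ^ Suc k) = (\<bar>s\<bar> / q) * norm (radial_coeff d k * s ^ k)"
    using q by (simp only: c) (simp add: abs_mult)
  also have "\<dots> \<le> (1 / 2) * norm (radial_coeff d k * s ^ k)"
    using q by (intro mult_right_mono) (auto simp: field_simps)
  finally show "norm (radial_coeff d (Suc k) * s ^ Suc k) \<le> 1 / 2 * norm (radial_coeff d k * s ^ k)" .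
qed

lemma radial_profile_derivs:
  assumes "0 < d"
  shows DERIV_radial_profile: "DERIV (radial_profile d) s :> radial_profile' d s"
    and DERIV_radial_profile': "DERIV (radial_profile' d) s :> radial_profile'' d s"
    and isCont_radial_profile'': "isCont (radial_profile'' d) s"
proof -
  note 0 = summable_radial[OF assms]
  note 1 = termdiff_converges_all[OF 0]
  note 2 = termdiff_converges_all[OF 1]
  show "DERIV (radial_profile d) s :> radial_profile' d s"
    unfolding radial_profile_def[abs_def] radial_profile'_def
    by (rule termdiffs_strong_converges_everywhere[OF 0])
  show "DERIV (radial_profile' d) s :> radial_profile'' d s"
    unfolding radial_profile'_def[abs_def] radial_profile''_def
    by (rule termdiffs_strong_converges_everywhere[OF 1])
  show "isCont (radial_profile'' d) s"
    unfolding radial_profile''_def[abs_def]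
    by (rule DERIV_isCont[OF termdiffs_strong_converges_everywhere[OF 2]])
qed

lemma radial_profile_0 [simp]: "radial_profile d 0 = 1"
  unfolding radial_profile_def by (subst powser_zero) simp

text \<open>Comparing coefficients gives
  \<open>(4 * k + 2 * d) * (k + 1) * c (k + 1) = - c k\<close>, which is the recursion of
  \<open>radial_coeff\<close>. The left side is the Laplacian of a function of
  \<open>s = |x|^2\<close> in dimension \<open>d\<close>.\<close>

lemma radial_profile_ode:
  assumes "0 < d"
  shows "4 * s * radial_profile'' d s + 2 * real d * radial_profile' d s = - radial_profile d s"
proof -
  note 0 = summable_radial[OF assms]
  note 1 = termdiff_converges_all[OF 0]
  note 2 = termdiff_converges_all[OF 1]
  let ?c = "radial_coeff d"
  have "(\<lambda>k. diffs (diffs ?c) k * s ^ k * s) sums (radial_profile'' d s * s)"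
    unfolding radial_profile''_def by (intro sums_mult2 summable_sums 2)
  then have "(\<lambda>k. real (Suc k) * diffs ?c (Suc k) * s ^ Suc k) sums (radial_profile'' d s * s)"
    by (simp add: diffs_def mult_ac)
  then have A: "(\<lambda>k. real k * diffs ?c k * s ^ k) sums (radial_profile'' d s * s)"
    by (subst (asm) sums_Suc_iff) simp
  have B: "(\<lambda>k. diffs ?c k * s ^ k) sums radial_profile' d s"
    unfolding radial_profile'_def by (intro summable_sums 1)
  have "(\<lambda>k. 4 * (real k * diffs ?c k * s ^ k) + 2 * real d * (diffs ?c k * s ^ k))
      sums (4 * (radial_profile'' d s * s) + 2 * real d * radial_profile' d s)"
    by (intro sums_add sums_mult A B)
  moreover have "4 * (real k * diffs ?c k * s ^ k) + 2 * real d * (diffs ?c k * s ^ k) = - (?c k * s ^ k)" for k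
  proof -
    have "2 * (real k + 1) * (2 * real k + real d) \<noteq> 0" using assms by (simp add: add_nonneg_eq_0_iff)
    then have "2 * (real k + 1) * (2 * real k + real d) * ?c (Suc k) = - ?c k" by simp
    then have "(4 * real k + 2 * real d) * diffs ?c k = - ?c k"
      by (simp add: diffs_def algebra_simps)
    then show ?thesis by (metis (no_types, lifting) distrib_right mult.assoc mult_minus_left)
  qed
  ultimately have "(\<lambda>k. - (?c k * s ^ k)) sums (4 * (radial_profile'' d s * s) + 2 * real d * radial_profile' d s)"
    by simp
  moreover have "(\<lambda>k. - (?c k * s ^ k)) sums (- radial_profile d s)"
    unfolding radial_profile_def by (intro sums_minus summable_sums 0)
  ultimately show ?thesis using sums_unique2 by (fastforce simp: mult_ac)
qed

text \<open>\<open>F\<close> is general because both the profile and a polynomial test function are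
  inserted; the factor \<open>c\<close> rescales the profile into a solution of
  \<open>- laplacian u = c * u\<close>.\<close>

lemma radial_function_calculus:
  fixes F F' F'' :: "real \<Rightarrow> real" and c :: real
  assumes F: "\<And>s. DERIV F s :> F' s" "\<And>s. DERIV F' s :> F'' s" "\<And>s. isCont F'' s"
  defines "u \<equiv> \<lambda>x::'a::euclidean_space. F (c * (x \<bullet> x))"
  shows radial_C2_on: "C2_on S u"
    and radial_laplacian: "laplacian u x = c * (4 * (c * (x \<bullet> x)) * F'' (c * (x \<bullet> x)) + 2 * real DIM('a) * F' (c * (x \<bullet> x)))"
proof -
  have dc: "((\<lambda>x. G (c * (x \<bullet> x))) has_derivative (\<lambda>v. G' (c * (x \<bullet> x)) * (2 * c * (x \<bullet> v)))) (at x)"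
    if "\<And>s. DERIV G s :> G' s" for G G' and x :: 'a
  proof -
    have "((\<lambda>x. c * (x \<bullet> x)) has_derivative (\<lambda>v. 2 * c * (x \<bullet> v))) (at x)"
      by (auto intro!: derivative_eq_intros simp: inner_commute)
    from has_derivative_compose[OF this that[unfolded has_field_derivative_def]]
    show ?thesis .
  qed
  have ud: "(u has_derivative (\<lambda>v. F' (c * (x \<bullet> x)) * (2 * c * (x \<bullet> v)))) (at x)" for x
    unfolding u_def by (rule dc[OF F(1)])
  have d1: "dir_deriv i u = (\<lambda>x. F' (c * (x \<bullet> x)) * (2 * c * (x \<bullet> i)))" for i
    unfolding dir_deriv_def using frechet_derivative_at[OF ud] by (auto simp: fun_eq_iff)
  have d1d: "(dir_deriv i u has_derivative (\<lambda>v. F' (c * (x \<bullet> x)) * (2 * c * (v \<bullet> i))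
      + F'' (c * (x \<bullet> x)) * (2 * c * (x \<bullet> v)) * (2 * c * (x \<bullet> i)))) (at x)" for i x
    unfolding d1 by (intro has_derivative_mult dc[OF F(2)]) (auto intro!: derivative_eq_intros)
  have d2: "dir_deriv j (dir_deriv i u) = (\<lambda>x. F' (c * (x \<bullet> x)) * (2 * c * (j \<bullet> i))
      + F'' (c * (x \<bullet> x)) * (2 * c * (x \<bullet> j)) * (2 * c * (x \<bullet> i)))" for i j
    unfolding dir_deriv_def[of j] using frechet_derivative_at[OF d1d] by (auto simp: fun_eq_iff)
  have cF: "continuous_on UNIV F'" "continuous_on UNIV F''"
    using F by (auto simp: continuous_on_eq_continuous_at intro: DERIV_isCont)
  show "C2_on S u"
    unfolding C2_on_def
  proof (intro conjI ballI)
    show "u differentiable at x" for x using ud unfolding differentiable_def by blast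
    show "dir_deriv i u differentiable at x" for i x using d1d unfolding differentiable_def by blast
    show "continuous_on S (dir_deriv j (dir_deriv i u))" for i j
      unfolding d2 by (intro continuous_intros continuous_on_compose2[OF cF(1)] continuous_on_compose2[OF cF(2)]) auto
  qed
  let ?s = "c * (x \<bullet> x)"
  have "laplacian u x = (\<Sum>i\<in>Basis. 2 * c * F' ?s + 4 * c * c * F'' ?s * ((x \<bullet> i) * (x \<bullet> i)))"
    unfolding laplacian_def d2 by (intro sum.cong) (auto simp: mult_ac)
  also have "\<dots> = real DIM('a) * (2 * c * F' ?s) + 4 * c * c * F'' ?s * (x \<bullet> x)"
    by (subst (4) euclidean_inner) (simp add: sum.distrib sum_distrib_left)
  finally show "laplacian u x = c * (4 * ?s * F'' ?s + 2 * real DIM('a) * F' ?s)"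
    by (simp add: algebra_simps)
qed

section \<open>Comparison at a touching point and the first eigenvalue of the ball\<close>

lemma second_derivative_at_max:
  fixes k :: "real \<Rightarrow> real"
  assumes e: "0 < e" and k: "\<And>t. \<bar>t\<bar> < e \<Longrightarrow> DERIV k t :> k' t" "DERIV k' 0 :> k2"
    and max: "\<And>t. \<bar>t\<bar> < e \<Longrightarrow> k t \<le> k 0"
  shows "k2 \<le> 0"
proof (rule ccontr)
  assume "\<not> k2 \<le> 0"
  then have "0 < k2" by simp
  \<comment> \<open>The first derivative vanishes at the maximum; were the second one positive, the
    first would be positive just to the right and the function would rise.\<close>
  from DERIV_pos_inc_right[OF k(2) this]
  obtain d where d: "0 < d" "\<And>h. 0 < h \<Longrightarrow> h < d \<Longrightarrow> k' 0 < k' h" by auto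
  have "k' 0 = 0"
    using DERIV_local_max[OF k(1)[of 0] e] max e by auto
  define h where "h = min d e / 2"
  have h: "0 < h" "h < d" "h < e" using d e by (auto simp: h_def)
  obtain t where t: "0 < t" "t < h" "k h - k 0 = (h - 0) * k' t"
    using MVT2[of 0 h k k'] k(1) h by (auto simp: abs_if)
  have "0 < k' t" using d(2)[of t] t h \<open>k' 0 = 0\<close> by auto
  then have "k 0 < k h" using t h by (metis diff_gt_0_iff_gt mult_pos_pos diff_zero)
  then show False using max[of h] h by auto
qed

lemma dir_deriv_line:
  assumes "u differentiable at (x + t *\<^sub>R i)"
  shows "((\<lambda>t. u (x + t *\<^sub>R i)) has_real_derivative dir_deriv i u (x + t *\<^sub>R i)) (at t)"
proof -
  have "((\<lambda>t. x + t *\<^sub>R i) has_derivative (\<lambda>s. s *\<^sub>R i)) (at t)" by (auto intro!: derivative_eq_intros)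
  note d = has_derivative_compose[OF this assms[unfolded frechet_derivative_works]]
  show ?thesis using d linear_cmul[OF has_derivative_linear[OF assms[unfolded frechet_derivative_works]]]
    unfolding has_field_derivative_def dir_deriv_def by (simp add: mult_commute_abs)
qed

text \<open>Compares \<open>a u\<close> with the smallest multiple of \<open>v\<close> lying above it.\<close>

lemma touching_comparison:
  fixes u v :: "'a::euclidean_space \<Rightarrow> real" and a :: real
  assumes C2: "C2_on (ball 0 R) u" "C2_on (ball 0 R) v"
    and cont: "continuous_on (cball 0 R) u" "continuous_on (cball 0 R) v"
    and bdry: "\<And>x. norm x = R \<Longrightarrow> a * u x \<le> 0" and v: "\<And>x. norm x \<le> R \<Longrightarrow> 0 < v x"
    and x0: "norm x0 < R" "0 < a * u x0"
  shows "\<exists>x\<in>ball 0 R. 0 < a * u x \<and> v x * (a * laplacian u x) \<le> a * u x * laplacian v x"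
proof -
  have "continuous_on (cball 0 R) (\<lambda>x. a * u x / v x)"
    using v by (intro continuous_intros cont) force
  moreover have "x0 \<in> cball 0 R" using x0 by simp
  ultimately have "\<exists>x\<in>cball 0 R. \<forall>y\<in>cball 0 R. a * u y / v y \<le> a * u x / v x"
    by (intro continuous_attains_sup[OF compact_cball]) blast+
  then obtain x where x: "x \<in> cball 0 R" "\<And>y. y \<in> cball 0 R \<Longrightarrow> a * u y / v y \<le> a * u x / v x"
    by blast
  \<comment> \<open>With this multiple \<open>a * u - m * v\<close> is at most 0 and vanishes at
    \<open>x\<close>, so its pure second derivatives are at most 0 there. The boundary condition
    forces \<open>x\<close> into the interior.\<close>
  define m where "m = a * u x / v x"
  have "0 < a * u x0 / v x0" using x0 v by simp
  also have "\<dots> \<le> m" unfolding m_def using x(2)[of x0] x0 by simp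
  finally have m: "0 < m" .
  have vx: "0 < v x" using x(1) v by simp
  have ux: "a * u x = m * v x" using vx by (simp add: m_def)
  then have ux0: "0 < a * u x" using m vx by simp
  have xb: "x \<in> ball 0 R" using bdry[of x] ux0 x(1) by force
  have le: "a * u y - m * v y \<le> 0" if "y \<in> cball 0 R" for y
    using x(2)[OF that] v[of y] that by (simp add: m_def[symmetric] divide_le_eq)
  obtain e where e: "0 < e" "ball x e \<subseteq> ball 0 R" using xb open_ball by (metis openE)
  have "a * dir_deriv i (dir_deriv i u) x - m * dir_deriv i (dir_deriv i v) x \<le> 0" if i: "i \<in> Basis" for i
  proof (rule second_derivative_at_max[OF e(1)])
    have inb: "x + t *\<^sub>R i \<in> ball 0 R" if "\<bar>t\<bar> < e" for t
    proof -
      have "x + t *\<^sub>R i \<in> ball x e" using that i by (simp add: dist_norm)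
      then show ?thesis using e(2) by blast
    qed
    show "DERIV (\<lambda>t. a * u (x + t *\<^sub>R i) - m * v (x + t *\<^sub>R i)) t 
      :> a * dir_deriv i u (x + t *\<^sub>R i) - m * dir_deriv i v (x + t *\<^sub>R i)"
      if "\<bar>t\<bar> < e" for t
      using C2 inb[OF that] unfolding C2_on_def
      by (intro DERIV_diff DERIV_cmult dir_deriv_line) auto
    show "DERIV (\<lambda>t. a * dir_deriv i u (x + t *\<^sub>R i) - m * dir_deriv i v (x + t *\<^sub>R i)) 0 :>
       a * dir_deriv i (dir_deriv i u) x - m * dir_deriv i (dir_deriv i v) x"
      using C2 xb i unfolding C2_on_def
      using dir_deriv_line[of "dir_deriv i u" x 0 i] dir_deriv_line[of "dir_deriv i v" x 0 i]
      by (intro DERIV_diff DERIV_cmult) auto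
    show "a * u (x + t *\<^sub>R i) - m * v (x + t *\<^sub>R i) \<le> a * u (x + 0 *\<^sub>R i) - m * v (x + 0 *\<^sub>R i)" if "\<bar>t\<bar> < e" for t
      using le[of "x + t *\<^sub>R i"] inb[OF that] ux by (simp add: less_imp_le)
  qed
  then have "(\<Sum>i\<in>Basis. a * dir_deriv i (dir_deriv i u) x - m * dir_deriv i (dir_deriv i v) x) \<le> 0"
    by (rule sum_nonpos)
  then have "a * laplacian u x \<le> m * laplacian v x"
    unfolding laplacian_def by (simp add: sum_subtractf sum_distrib_left)
  then have "v x * (a * laplacian u x) \<le> v x * (m * laplacian v x)" using vx by simp
  also have "\<dots> = a * u x * laplacian v x" unfolding ux by simp
  finally show ?thesis using xb ux0 by blast
qed

text \<open>Without a zero the profile would be a positive solution of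
  \<open>- laplacian v = v\<close> on the whole space. Touching the bump
  \<open>(R^2 - |x|^2)^2\<close> with it would yield a point where \<open>laplacian u + u\<close> is
  at most 0, and for a suitable \<open>R\<close> there is none. The first zero is then the infimum
  of a closed set.\<close>

lemma radial_profile_first_zero:
  obtains l where "0 < l" "radial_profile DIM('a::euclidean_space) l = 0"
    "\<And>s. 0 \<le> s \<Longrightarrow> s < l \<Longrightarrow> 0 < radial_profile DIM('a) s"
proof -
  let ?\<phi> = "radial_profile DIM('a)"
  have d: "0 < DIM('a)" by simp
  have cont: "continuous_on S ?\<phi>" for S
    by (intro continuous_at_imp_continuous_on ballI DERIV_isCont[OF DERIV_radial_profile[OF d]])
  have ivt: "\<exists>r>0. r \<le> s \<and> ?\<phi> r = 0" if "0 \<le> s" "?\<phi> s \<le> 0" for s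
  proof -
    have "\<exists>r\<ge>0. r \<le> s \<and> ?\<phi> r = 0"
      using that cont by (intro IVT2') auto
    then show ?thesis by (metis less_le radial_profile_0 zero_neq_one)
  qed
  have "\<exists>s\<ge>0. ?\<phi> s \<le> 0"
  proof (rule ccontr)
    assume "\<not> ?thesis"
    then have pos: "0 < ?\<phi> s" if "0 \<le> s" for s using that by force
    \<comment> \<open>With \<open>q = R^2 - |x|^2\<close>, \<open>laplacian u + u\<close> equals
      \<open>q^2 - (4 * DIM('a) + 8) * q + 8 * R^2\<close>. This \<open>R\<close> turns the middle
      coefficient into \<open>R\<close>, and the discriminant is negative.\<close>
    define R where "R = 4 * real DIM('a) + 8"
    define u where "u x = (R\<^sup>2 - 1 * (x \<bullet> x))\<^sup>2" for x :: 'a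
    define v where "v x = ?\<phi> (1 * (x \<bullet> x))" for x :: 'a
    have du: "DERIV (\<lambda>s. (R\<^sup>2 - s)\<^sup>2) s :> - 2 * (R\<^sup>2 - s)" "DERIV (\<lambda>s. - 2 * (R\<^sup>2 - s)) s :> 2" for s
      by (auto intro!: derivative_eq_intros)
    note u = radial_C2_on[OF du continuous_const] radial_laplacian[OF du continuous_const, where 'a='a and c=1]
    note v = radial_C2_on[OF radial_profile_derivs[OF d]] radial_laplacian[OF radial_profile_derivs[OF d], where 'a='a and c=1]
    have "\<exists>x\<in>ball 0 R. 0 < 1 * u x \<and> v x * (1 * laplacian u x) \<le> 1 * u x * laplacian v x"
    proof (rule touching_comparison)
      show "C2_on (ball 0 R) u" unfolding u_def by (rule u)
      show "C2_on (ball 0 R) v" unfolding v_def by (rule v)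
      show "continuous_on (cball 0 R) u" unfolding u_def by (intro continuous_intros)
      show "continuous_on (cball 0 R) v" unfolding v_def by (intro continuous_on_compose2[OF cont] continuous_intros) auto
      show "1 * u x \<le> 0" if "norm x = R" for x using that by (simp add: u_def flip: power2_norm_eq_inner)
      show "0 < v x" for x unfolding v_def by (intro pos) simp
      show "norm (0::'a) < R" "0 < 1 * u 0" by (auto simp: R_def u_def)
    qed
    then obtain x where x: "norm x < R" "v x * laplacian u x \<le> u x * laplacian v x" by auto
    have "laplacian v x = - v x"
      unfolding v_def v(2) using radial_profile_ode[OF d] by simp
    moreover have "0 < v x" unfolding v_def by (intro pos) simp
    ultimately have "v x * (laplacian u x + u x) \<le> 0" using x(2) by (simp add: algebra_simps)
    then have le: "laplacian u x + u x \<le> 0" using \<open>0 < v x\<close> by (simp add: mult_le_0_iff)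
    define q where "q = R\<^sup>2 - x \<bullet> x"
    have "laplacian u x = 8 * (R\<^sup>2 - q) - 4 * real DIM('a) * q" "u x = q\<^sup>2"
      unfolding u_def u(2) by (auto simp: q_def algebra_simps)
    then have "q\<^sup>2 - R * q + 8 * R\<^sup>2 \<le> 0" using le by (simp add: R_def algebra_simps)
    moreover have "q\<^sup>2 - R * q + 8 * R\<^sup>2 = (q - R / 2)\<^sup>2 + (31 / 4) * R\<^sup>2" by (simp add: power2_eq_square algebra_simps)
    moreover have "0 < (31 / 4) * R\<^sup>2" by (simp add: R_def add_pos_pos)
    ultimately show False using zero_le_power2[of "q - R / 2"] by linarith
  qed
  then obtain s0 where s0: "0 < s0" "?\<phi> s0 = 0" using ivt by blast
  let ?Z = "{0..} \<inter> ?\<phi> -` {0}"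
  have Z: "closed ?Z" by (intro continuous_closed_preimage cont) auto
  have "s0 \<in> ?Z" using s0 by simp
  then have ne: "?Z \<noteq> {}" by blast
  have bdd: "bdd_below ?Z" by (auto intro: bdd_belowI[of _ 0])
  have in_Z: "Inf ?Z \<in> ?Z" by (rule closed_contains_Inf[OF ne bdd Z])
  show ?thesis
  proof (rule that)
    show "?\<phi> (Inf ?Z) = 0" using in_Z by auto
    then show "0 < Inf ?Z" using in_Z by (metis IntD1 atLeast_iff less_le radial_profile_0 zero_neq_one)
    fix s assume s: "0 \<le> s" "s < Inf ?Z"
    show "0 < ?\<phi> s"
    proof (rule ccontr)
      assume "\<not> 0 < ?\<phi> s"
      then obtain r where "0 < r" "r \<le> s" "?\<phi> r = 0" using ivt[of s] s by auto
      then have "Inf ?Z \<le> r" using bdd by (intro cInf_lower) auto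
      then show False using \<open>r \<le> s\<close> s by simp
    qed
  qed
qed

text \<open>In divergence form the radial equation says that
  \<open>s powr (d / 2) * radial_profile' d s\<close> has derivative
  \<open>- s powr (d / 2 - 1) * radial_profile d s / 4\<close>. This product is 0 at 0 and strictly
  decreases while the profile is positive.\<close>

lemma radial_profile'_neg:
  assumes d: "0 < d" and pos: "\<And>r. 0 < r \<Longrightarrow> r < s \<Longrightarrow> 0 < radial_profile d r" and s: "0 < s"
  shows "radial_profile' d s < 0"
proof -
  let ?k = "\<lambda>r. r powr (real d / 2) * radial_profile' d r"
  have "?k s < ?k 0"
  proof (rule DERIV_neg_imp_decreasing_open[OF s])
    fix r assume r: "0 < r" "r < s"
    have "DERIV ?k r :> (real d / 2) * r powr (real d / 2 - 1) * radial_profile' d r + r powr (real d / 2) * radial_profile'' d r"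
      using r by (auto intro!: derivative_eq_intros DERIV_radial_profile'[OF d])
    moreover have "r powr (real d / 2) = r powr (real d / 2 - 1) * r"
      using r by (simp add: powr_diff)
    then have "(real d / 2) * r powr (real d / 2 - 1) * radial_profile' d r + r powr (real d / 2) * radial_profile'' d r
      = r powr (real d / 2 - 1) / 4 * (4 * r * radial_profile'' d r + 2 * real d * radial_profile' d r)"
      by (simp add: algebra_simps)
    then have "(real d / 2) * r powr (real d / 2 - 1) * radial_profile' d r + r powr (real d / 2) * radial_profile'' d r < 0"
      unfolding radial_profile_ode[OF d] using pos[OF r] r by simp
    ultimately show "\<exists>y. DERIV ?k r :> y \<and> y < 0" by blast
  next
    have "continuous_on {0..s} (radial_profile' d)"
      by (intro continuous_at_imp_continuous_on ballI DERIV_isCont[OF DERIV_radial_profile'[OF d]])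
    then show "continuous_on {0..s} ?k"
      using d by (intro continuous_on_mult continuous_on_powr') (auto intro!: continuous_intros)
  qed
  then show ?thesis using s by (simp add: mult_less_0_iff)
qed

text \<open>For \<open>y < l'< l\<close> the profile scaled by \<open>l'\<close> is positive on the
  closed ball, so an eigenfunction for \<open>y\<close> can be touched by it, and at that point
  \<open>l'\<close> would have to be at most \<open>y\<close>. The argument covers eigenfunctions
  without any symmetry, as minimality requires.\<close>

lemma dirichlet_lambda1_ball:
  fixes l :: real
  assumes l: "0 < l" "radial_profile DIM('a) l = 0" "\<And>s. 0 \<le> s \<Longrightarrow> s < l \<Longrightarrow> 0 < radial_profile DIM('a) s"
  shows "dirichlet_lambda1 (ball 0 1 :: 'a::euclidean_space set) = l"
  unfolding dirichlet_lambda1_def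
proof (rule Least_equality)
  let ?\<phi> = "radial_profile DIM('a)"
  have d: "0 < DIM('a)" by simp
  note C2 = radial_C2_on[OF radial_profile_derivs[OF d], where 'a='a]
  have lap: "laplacian (\<lambda>x::'a. ?\<phi> (c * (x \<bullet> x))) x = - c * ?\<phi> (c * (x \<bullet> x))" for c x
    unfolding radial_laplacian[OF radial_profile_derivs[OF d]] radial_profile_ode[OF d] by simp
  have cont: "continuous_on S (\<lambda>x::'a. ?\<phi> (c * (x \<bullet> x)))" for S c
    by (rule continuous_on_compose2[of UNIV ?\<phi>])
      (auto intro!: continuous_intros continuous_at_imp_continuous_on DERIV_isCont[OF DERIV_radial_profile[OF d]])
  show "dirichlet_eigenvalue (ball 0 1 :: 'a set) l"
    unfolding dirichlet_eigenvalue_def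
  proof (intro exI conjI ballI)
    show "C2_on (ball 0 1) (\<lambda>x::'a. ?\<phi> (l * (x \<bullet> x)))" by (rule C2)
    show "continuous_on (closure (ball 0 1)) (\<lambda>x::'a. ?\<phi> (l * (x \<bullet> x)))" by (rule cont)
    show "\<exists>x\<in>ball 0 1. ?\<phi> (l * ((x::'a) \<bullet> x)) \<noteq> 0" by (intro bexI[of _ 0]) auto
    show "- laplacian (\<lambda>x::'a. ?\<phi> (l * (x \<bullet> x))) x = l * ?\<phi> (l * (x \<bullet> x))" for x by (simp add: lap)
    show "?\<phi> (l * (x \<bullet> x)) = 0" if "x \<in> frontier (ball 0 1)" for x :: 'a
      using that l by (simp flip: power2_norm_eq_inner)
  qed
  fix y assume "dirichlet_eigenvalue (ball 0 1 :: 'a set) y"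
  then obtain u :: "'a \<Rightarrow> real" and x0 where u: "C2_on (ball 0 1) u" "continuous_on (cball 0 1) u"
    "x0 \<in> ball 0 1" "u x0 \<noteq> 0" "\<And>x. x \<in> ball 0 1 \<Longrightarrow> - laplacian u x = y * u x" "\<And>x. norm x = 1 \<Longrightarrow> u x = 0"
    unfolding dirichlet_eigenvalue_def by auto
  show "l \<le> y"
  proof (rule ccontr)
    assume "\<not> l \<le> y"
    \<comment> \<open>The maximum with 0 keeps \<open>l'\<close> positive when \<open>y\<close> is
      negative.\<close>
    define l' where "l' = (max y 0 + l) / 2"
    have l': "0 < l'" "y < l'" "l' < l" using \<open>\<not> l \<le> y\<close> l by (auto simp: l'_def)
    define v where "v x = ?\<phi> (l' * (x \<bullet> x))" for x :: 'a
    have v: "0 < v x" if "norm x \<le> 1" for x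
    proof -
      have "x \<bullet> x \<le> 1" using that by (simp add: power_le_one flip: power2_norm_eq_inner)
      then have "l' * (x \<bullet> x) \<le> l' * 1" using l' by (intro mult_left_mono) auto
      then have "l' * (x \<bullet> x) < l" using l' by linarith
      then show ?thesis unfolding v_def using l' by (intro l(3)) auto
    qed
    \<comment> \<open>The eigenfunction may be negative everywhere; the sign of \<open>u x0\<close>
      makes it positive at \<open>x0\<close>.\<close>
    have "\<exists>x\<in>ball 0 1. 0 < sgn (u x0) * u x \<and> v x * (sgn (u x0) * laplacian u x) \<le> sgn (u x0) * u x * laplacian v x"
    proof (rule touching_comparison[OF u(1) _ u(2)])
      show "C2_on (ball 0 1) v" unfolding v_def by (rule C2)
      show "continuous_on (cball 0 1) v" unfolding v_def by (rule cont)
      show "norm x0 < 1" "0 < sgn (u x0) * u x0" using u(3,4) by (auto simp: sgn_mult_self_eq linorder_neq_iff)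
    qed (use u v in auto)
    then obtain x where x: "x \<in> ball 0 1" "0 < sgn (u x0) * u x"
      "v x * (sgn (u x0) * laplacian u x) \<le> sgn (u x0) * u x * laplacian v x" by blast
    have "laplacian u x = - (y * u x)" using u(5)[OF x(1)] by simp
    moreover have "laplacian v x = - l' * v x" unfolding v_def by (rule lap)
    ultimately have "(l' - y) * (v x * (sgn (u x0) * u x)) \<le> 0" using x(3) by (simp add: algebra_simps)
    moreover have "0 < (l' - y) * (v x * (sgn (u x0) * u x))" using l' v[of x] x by simp
    ultimately show False by simp
  qed
qed

section \<open>Barriers in parabola-shaped regions\<close>

text \<open>\<open>exp (- G x) * \<Delta>(exp (G x) * \<phi> (\<mu> x * |Y|\<^sup>2))\<close> at \<open>x = X\<close>, where \<open>\<mu>\<close> is a multiple of \<open>X powr (- 2 * \<alpha>)\<close>,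
  \<open>\<sigma> = \<mu> * |Y|\<^sup>2\<close>, \<open>g = G' X\<close> and \<open>k = G'' X\<close>; the equation for \<open>\<phi>\<close> has eliminated \<open>\<Delta>\<close> in \<open>Y\<close>.\<close>

definition barrier_laplacian :: "nat \<Rightarrow> real \<Rightarrow> real \<Rightarrow> real \<Rightarrow> real \<Rightarrow> real \<Rightarrow> real \<Rightarrow> real" where
  "barrier_laplacian d \<alpha> X \<mu> \<sigma> g k =
     (k + g\<^sup>2 - \<mu>) * radial_profile d \<sigma> - 4 * \<alpha> * g * (\<sigma> * radial_profile' d \<sigma>) / X
     + 2 * \<alpha> * (2 * \<alpha> + 1) * (\<sigma> * radial_profile' d \<sigma>) / X\<^sup>2
     + 4 * \<alpha>\<^sup>2 * (\<sigma>\<^sup>2 * radial_profile'' d \<sigma>) / X\<^sup>2"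

text \<open>One computation serves both barriers: \<open>a = 1\<close> with a positive shift
  \<open>L\<close> for the supersolution, and \<open>a = - 1\<close> with \<open>L = 0\<close> for a
  constant minus the subsolution. It takes place in the coordinates \<open>(x, |Y|^2)\<close>, where
  the Laplacian involves only second derivatives of a function of two variables and one first
  derivative.\<close>

lemma barrier_superharmonic_near:
  fixes p0 :: "real \<times> 'a::euclidean_space" and G G1 G2 :: "real \<Rightarrow> real"
    and a b m L \<alpha> :: real
  assumes X: "- L < fst p0"
    and G: "\<And>x. - L < x \<Longrightarrow> DERIV G x :> G1 x" "\<And>x. - L < x \<Longrightarrow> DERIV G1 x :> G2 x"
      "\<And>x. - L < x \<Longrightarrow> isCont G2 x"
    and neg: "let X = fst p0 + L; \<mu> = m * X powr (- 2 * \<alpha>) in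
        a * barrier_laplacian DIM('a) \<alpha> X \<mu> (\<mu> * (snd p0 \<bullet> snd p0)) (G1 (fst p0)) (G2 (fst p0)) < 0"
  shows "superharmonic_near (\<lambda>p. a * (exp (G (fst p)) *
      radial_profile DIM('a) (m * (fst p + L) powr (- 2 * \<alpha>) * (snd p \<bullet> snd p))) + b) p0"
proof -
  define U where "U = {q :: real \<times> real. - L < fst q}"
  have d: "0 < DIM('a)" by simp
  let ?\<phi> = "radial_profile DIM('a)" and ?\<phi>' = "radial_profile' DIM('a)" and ?\<phi>'' = "radial_profile'' DIM('a)"
  define \<mu> where "\<mu> q = m * (fst q + L) powr (- 2 * \<alpha>)" for q :: "real \<times> real"
  define \<sigma> where "\<sigma> q = \<mu> q * snd q" for q
  define E where "E q = a * exp (G (fst q))" for q :: "real \<times> real"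
  \<comment> \<open>Minus the logarithmic derivative in \<open>x\<close> of \<open>\<mu>\<close>,
    hence also of \<open>\<sigma>\<close>.\<close>
  define r where "r q = 2 * \<alpha> / (fst q + L)" for q :: "real \<times> real"
  define \<Phi> where "\<Phi> q = E q * ?\<phi> (\<sigma> q) + b" for q
  define \<Phi>x where "\<Phi>x q = E q * (G1 (fst q) * ?\<phi> (\<sigma> q) - r q * \<sigma> q * ?\<phi>' (\<sigma> q))" for q
  define \<Phi>s where "\<Phi>s q = E q * (\<mu> q * ?\<phi>' (\<sigma> q))" for q
  define \<Phi>xx where "\<Phi>xx q = E q * ((G2 (fst q) + (G1 (fst q))\<^sup>2) * ?\<phi> (\<sigma> q) - 2 * G1 (fst q) * r q * \<sigma> q * ?\<phi>' (\<sigma> q)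
    + r q * (2 * \<alpha> + 1) / (fst q + L) * \<sigma> q * ?\<phi>' (\<sigma> q) + (r q * \<sigma> q)\<^sup>2 * ?\<phi>'' (\<sigma> q))" for q
  define \<Phi>xs where "\<Phi>xs q = E q * \<mu> q * (G1 (fst q) * ?\<phi>' (\<sigma> q) - r q * (?\<phi>' (\<sigma> q) + \<sigma> q * ?\<phi>'' (\<sigma> q)))" for q
  define \<Phi>ss where "\<Phi>ss q = E q * (\<mu> q)\<^sup>2 * ?\<phi>'' (\<sigma> q)" for q
  have r_w: "r q = 2 * \<alpha> * inverse (fst q + L)" for q
    by (simp add: r_def divide_inverse)
  have fd: "((\<lambda>q. f (fst q)) has_derivative (\<lambda>v. D * fst v)) (at q)" if "DERIV f (fst q) :> D" for f D and q :: "real \<times> real"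
    using has_derivative_compose[OF has_derivative_fst[OF has_derivative_ident] that[unfolded has_field_derivative_def]] .
  have d\<mu>: "(\<mu> has_derivative (\<lambda>v. - r q * \<mu> q * fst v)) (at q)" if "q \<in> U" for q
  proof -
    have "DERIV (\<lambda>x. m * (x + L) powr (- 2 * \<alpha>)) (fst q) :> - r q * \<mu> q"
      using that by (auto intro!: derivative_eq_intros simp: U_def r_def \<mu>_def powr_diff)
    from fd[OF this] show ?thesis unfolding \<mu>_def[abs_def] .
  qed
  have d\<sigma>: "(\<sigma> has_derivative (\<lambda>v. - r q * \<sigma> q * fst v + \<mu> q * snd v)) (at q)" if "q \<in> U" for q
    unfolding \<sigma>_def[abs_def]
    by (rule has_derivative_eq_rhs[OF has_derivative_mult[OF d\<mu>[OF that] has_derivative_snd[OF has_derivative_ident]]])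
      (simp add: fun_eq_iff algebra_simps)
  have dr: "(r has_derivative (\<lambda>v. - r q / (fst q + L) * fst v)) (at q)" if "q \<in> U" for q
  proof -
    have "DERIV (\<lambda>x. 2 * \<alpha> / (x + L)) (fst q) :> - r q / (fst q + L)"
      using that by (auto intro!: derivative_eq_intros simp: U_def r_def power2_eq_square)
    from fd[OF this] show ?thesis unfolding r_def[abs_def] .
  qed
  have dE: "(E has_derivative (\<lambda>v. E q * G1 (fst q) * fst v)) (at q)" if "q \<in> U" for q
  proof -
    have "DERIV (\<lambda>x. a * exp (G x)) (fst q) :> E q * G1 (fst q)"
      using that by (auto intro!: derivative_eq_intros G simp: U_def E_def)
    from fd[OF this] show ?thesis unfolding E_def[abs_def] .
  qed
  have dG1: "((\<lambda>q. G1 (fst q)) has_derivative (\<lambda>v. G2 (fst q) * fst v)) (at q)" if "q \<in> U" for q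
    using that by (intro fd G) (simp add: U_def)
  have d\<phi>: "((\<lambda>q. ?\<phi> (\<sigma> q)) has_derivative (\<lambda>v. ?\<phi>' (\<sigma> q) * (- r q * \<sigma> q * fst v + \<mu> q * snd v))) (at q)"
    and d\<phi>': "((\<lambda>q. ?\<phi>' (\<sigma> q)) has_derivative (\<lambda>v. ?\<phi>'' (\<sigma> q) * (- r q * \<sigma> q * fst v + \<mu> q * snd v))) (at q)"
    if "q \<in> U" for q
    using has_derivative_compose[OF d\<sigma>[OF that] radial_profile_derivs(1)[OF d, unfolded has_field_derivative_def]]
      has_derivative_compose[OF d\<sigma>[OF that] radial_profile_derivs(2)[OF d, unfolded has_field_derivative_def]] by auto
  have cU: "isCont \<mu> q" "isCont \<sigma> q" "isCont r q" "isCont E q" "isCont (\<lambda>q. G1 (fst q)) q"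
    "isCont (\<lambda>q. ?\<phi> (\<sigma> q)) q" "isCont (\<lambda>q. ?\<phi>' (\<sigma> q)) q" if "q \<in> U" for q
    using d\<mu>[OF that] d\<sigma>[OF that] dr[OF that] dE[OF that] dG1[OF that] d\<phi>[OF that] d\<phi>'[OF that]
    by (blast intro: has_derivative_continuous)+
  have c2: "isCont (\<lambda>q. ?\<phi>'' (\<sigma> q)) q" "isCont (\<lambda>q. G2 (fst q)) q" "fst q + L \<noteq> 0" if "q \<in> U" for q
    using that isCont_o2[OF cU(2)[OF that] isCont_radial_profile''[OF d]]
      isCont_o2[OF isCont_fst[OF continuous_ident] G(3), of q] by (auto simp: U_def)
  let ?q = "(fst p0, snd p0 \<bullet> snd p0)"
  have "superharmonic_near (\<lambda>p. \<Phi> (fst p, snd p \<bullet> snd p)) p0"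
  proof (rule axial_superharmonic_near)
    show "open U" unfolding U_def by (intro open_Collect_less continuous_intros)
    show q0: "?q \<in> U" using X by (simp add: U_def)
    show "(\<Phi> has_derivative (\<lambda>v. \<Phi>x q * fst v + \<Phi>s q * snd v)) (at q)" if "q \<in> U" for q
      unfolding \<Phi>_def[abs_def]
      by (rule has_derivative_eq_rhs[OF has_derivative_add[OF has_derivative_mult[OF dE[OF that] d\<phi>[OF that]] has_derivative_const]])
        (simp add: fun_eq_iff \<Phi>x_def \<Phi>s_def algebra_simps)
    show "(\<Phi>x has_derivative (\<lambda>v. \<Phi>xx q * fst v + \<Phi>xs q * snd v)) (at q)" if "q \<in> U" for q
      unfolding \<Phi>x_def[abs_def]
      by (rule has_derivative_eq_rhs[OF has_derivative_mult[OF dE[OF that]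
            has_derivative_diff[OF has_derivative_mult[OF dG1[OF that] d\<phi>[OF that]]
              has_derivative_mult[OF has_derivative_mult[OF dr[OF that] d\<sigma>[OF that]] d\<phi>'[OF that]]]]])
        (simp add: fun_eq_iff \<Phi>xx_def \<Phi>xs_def r_w divide_inverse algebra_simps power2_eq_square)
    show "(\<Phi>s has_derivative (\<lambda>v. \<Phi>xs q * fst v + \<Phi>ss q * snd v)) (at q)" if "q \<in> U" for q
      unfolding \<Phi>s_def[abs_def]
      by (rule has_derivative_eq_rhs[OF has_derivative_mult[OF dE[OF that] has_derivative_mult[OF d\<mu>[OF that] d\<phi>'[OF that]]]])
        (simp add: fun_eq_iff \<Phi>xs_def \<Phi>ss_def power2_eq_square algebra_simps)
    show "continuous_on U \<Phi>xx" "continuous_on U \<Phi>xs" "continuous_on U \<Phi>ss"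
      unfolding \<Phi>xx_def[abs_def] \<Phi>xs_def[abs_def] \<Phi>ss_def[abs_def]
      by (intro continuous_at_imp_continuous_on ballI continuous_intros cU c2; assumption)+
    have X0: "fst p0 + L \<noteq> 0" using X by simp
    \<comment> \<open>The terms with \<open>\<mu>\<close> collect to the left side of the radial
      equation, which replaces them by \<open>- \<mu>\<close> times the profile.\<close>
    have "\<Phi>xx ?q + 4 * snd ?q * \<Phi>ss ?q + 2 * DIM('a) * \<Phi>s ?q
      = E ?q * ((G2 (fst p0) + (G1 (fst p0))\<^sup>2) * ?\<phi> (\<sigma> ?q) - 2 * G1 (fst p0) * r ?q * \<sigma> ?q * ?\<phi>' (\<sigma> ?q)
    + r ?q * (2 * \<alpha> + 1) / (fst p0 + L) * \<sigma> ?q * ?\<phi>' (\<sigma> ?q) + (r ?q * \<sigma> ?q)\<^sup>2 * ?\<phi>'' (\<sigma> ?q)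
    + \<mu> ?q * (4 * \<sigma> ?q * ?\<phi>'' (\<sigma> ?q) + 2 * real DIM('a) * ?\<phi>' (\<sigma> ?q)))"
      by (simp add: \<Phi>xx_def \<Phi>ss_def \<Phi>s_def \<sigma>_def power2_eq_square algebra_simps)
    also have "\<dots> = exp (G (fst p0)) *
        (a * barrier_laplacian DIM('a) \<alpha> (fst p0 + L) (\<mu> ?q) (\<sigma> ?q) (G1 (fst p0)) (G2 (fst p0)))"
      unfolding barrier_laplacian_def radial_profile_ode[OF d] E_def r_def fst_conv
      using X0 by (simp add: power2_eq_square divide_simps) (simp add: algebra_simps)
    also have "\<dots> < 0"
    proof (rule mult_pos_neg)
      show "0 < exp (G (fst p0))" by simp
    qed (use neg in \<open>simp add: Let_def \<sigma>_def \<mu>_def\<close>)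
    finally show "let q = ?q in \<Phi>xx q + 4 * snd q * \<Phi>ss q + 2 * DIM('a) * \<Phi>s q < 0"
      by (simp add: Let_def)
  qed
  then show ?thesis by (simp add: \<Phi>_def E_def \<sigma>_def \<mu>_def mult_ac)
qed

section \<open>Topology of the region and location of the exit position\<close>

lemma open_parabola_region: "open (parabola_region \<alpha> A :: (real \<times> 'a::euclidean_space) set)"
proof -
  let ?S = "{p :: real \<times> 'a. 0 < fst p}"
  have "continuous_on ?S (\<lambda>p. A * fst p powr \<alpha> - norm (snd p))"
    by (intro continuous_intros) auto
  moreover have "open ?S" by (intro open_Collect_less continuous_intros)
  ultimately have "open (?S \<inter> (\<lambda>p. A * fst p powr \<alpha> - norm (snd p)) -` {0<..})"
    by (intro continuous_open_preimage) auto
  also have "?S \<inter> (\<lambda>p. A * fst p powr \<alpha> - norm (snd p)) -` {0<..} = parabola_region \<alpha> A"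
    by (auto simp: parabola_region_def)
  finally show ?thesis .
qed

text \<open>The tip is covered as well: \<open>0 powr \<alpha>\<close> is 0 and the power is
  continuous there, so at \<open>x = 0\<close> the closed conditions leave only the origin.\<close>

lemma closure_parabola_region:
  assumes "0 < \<alpha>"
  shows "closure (parabola_region \<alpha> A :: (real \<times> 'a::euclidean_space) set)
    \<subseteq> {p. 0 \<le> fst p \<and> norm (snd p) \<le> A * fst p powr \<alpha>}"
proof (rule closure_minimal)
  let ?S = "{p :: real \<times> 'a. 0 \<le> fst p}"
  have "continuous_on ?S (\<lambda>p. A * fst p powr \<alpha> - norm (snd p))"
    using assms by (intro continuous_intros continuous_on_powr') auto
  moreover have "closed ?S" by (intro closed_Collect_le continuous_intros)
  ultimately have "closed (?S \<inter> (\<lambda>p. A * fst p powr \<alpha> - norm (snd p)) -` {0..})"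
    by (intro continuous_closed_preimage) auto
  also have "?S \<inter> (\<lambda>p. A * fst p powr \<alpha> - norm (snd p)) -` {0..}
      = {p. 0 \<le> fst p \<and> norm (snd p) \<le> A * fst p powr \<alpha>}"
    by auto
  finally show "closed {p :: real \<times> 'a. 0 \<le> fst p \<and> norm (snd p) \<le> A * fst p powr \<alpha>}" .
qed (auto simp: parabola_region_def)

lemma (in brownian_motion) exit_position_mem_boundary:
  assumes "\<omega> \<in> space M" "B 0 \<omega> = z" "open V" "z \<in> V" "exit_time B V \<omega> < \<infinity>"
  shows "exit_position B V \<omega> \<in> closure V - V"
proof -
  have b: "continuous_on {0..} (\<lambda>t. B t \<omega>)" using continuous_paths assms by auto
  define T where "T = real_of_ereal (exit_time B V \<omega>)"
  have T: "0 < T" "B T \<omega> \<notin> V" "\<And>t. 0 \<le> t \<Longrightarrow> t < T \<Longrightarrow> B t \<omega> \<in> V"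
    using exit_time_finite[OF b assms(3) _ assms(5)] assms unfolding T_def by auto
  have "continuous_on (closure {0<..<T}) (\<lambda>t. B t \<omega>)"
    using T(1) by (intro continuous_on_subset[OF b]) auto
  then have "(\<lambda>t. B t \<omega>) ` closure {0<..<T} \<subseteq> closure V"
  proof (rule image_closure_subset[OF _ closed_closure])
    show "(\<lambda>t. B t \<omega>) ` {0<..<T} \<subseteq> closure V" using T(3) closure_subset[of V] by auto
  qed
  moreover have "T \<in> closure {0<..<T}" using T(1) by simp
  ultimately have "B T \<omega> \<in> closure V" by blast
  with T(2) show ?thesis by (simp add: exit_position_def T_def)
qed

lemma continuous_on_radial_profile:
  assumes "0 < d" "continuous_on S f"
  shows "continuous_on S (\<lambda>x. radial_profile d (f x))"
  by (rule continuous_on_compose2[OF _ assms(2) subset_UNIV])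
    (intro continuous_at_imp_continuous_on ballI DERIV_isCont[OF DERIV_radial_profile[OF assms(1)]])

lemma DERIV_shifted_powr:
  fixes x L :: real
  assumes "- L < x"
  shows "DERIV (\<lambda>x. c * (x + L) powr a) x :> c * a * (x + L) powr (a - 1)"
  using assms by (auto intro!: derivative_eq_intros simp: powr_diff)

lemma powr_square: "(x powr a)\<^sup>2 = x powr (2 * a)" for x a :: real
  unfolding mult_2 powr_add power2_eq_square ..

text \<open>In this form the argument of the profile depends only on \<open>|Y|\<close> relative to
  the radius of the cross section: it is 0 on the axis and \<open>l\<close> on the lateral
  boundary.\<close>

lemma parabola_similarity_variable:
  fixes Y :: "'a::euclidean_space"
  assumes "0 < x" "0 < A"
  shows "l / A\<^sup>2 * x powr (- 2 * \<alpha>) * (Y \<bullet> Y) = l * (norm Y / (A * x powr \<alpha>))\<^sup>2"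
proof -
  have "x powr (- 2 * \<alpha>) = inverse ((x powr \<alpha>)\<^sup>2)"
    by (simp add: powr_square flip: powr_minus)
  then show ?thesis
    by (simp add: power_divide power_mult_distrib divide_inverse power_inverse flip: power2_norm_eq_inner)
qed

lemma parabola_similarity_bounds:
  fixes Y :: "'a::euclidean_space"
  assumes "0 < x" "0 < A" "0 \<le> l" "norm Y \<le> A * x powr \<alpha>"
  shows "0 \<le> l / A\<^sup>2 * x powr (- 2 * \<alpha>) * (Y \<bullet> Y)" "l / A\<^sup>2 * x powr (- 2 * \<alpha>) * (Y \<bullet> Y) \<le> l"
proof -
  have "norm Y / (A * x powr \<alpha>) \<le> 1" using assms by simp
  then have "(norm Y / (A * x powr \<alpha>))\<^sup>2 \<le> 1" using assms by (intro power_le_one) auto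
  then show "0 \<le> l / A\<^sup>2 * x powr (- 2 * \<alpha>) * (Y \<bullet> Y)" "l / A\<^sup>2 * x powr (- 2 * \<alpha>) * (Y \<bullet> Y) \<le> l"
    unfolding parabola_similarity_variable[OF assms(1,2)] using assms(3) by (auto simp: mult_left_le)
qed

lemma radial_bounds:
  assumes d: "0 < d"
  obtains C where "0 < C" "\<And>s. 0 \<le> s \<Longrightarrow> s \<le> l \<Longrightarrow> \<bar>s * radial_profile' d s\<bar> \<le> C"
    "\<And>s. 0 \<le> s \<Longrightarrow> s \<le> l \<Longrightarrow> \<bar>s\<^sup>2 * radial_profile'' d s\<bar> \<le> C"
proof -
  have c: "continuous_on {0..l} (\<lambda>s. s * radial_profile' d s)"
    "continuous_on {0..l} (\<lambda>s. s\<^sup>2 * radial_profile'' d s)"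
    by (intro continuous_at_imp_continuous_on ballI continuous_intros
        isCont_radial_profile''[OF d] DERIV_isCont[OF DERIV_radial_profile'[OF d]])+
  obtain C1 where C1: "0 < C1" "\<And>s. s \<in> {0..l} \<Longrightarrow> \<bar>s * radial_profile' d s\<bar> \<le> C1"
    using compact_imp_bounded[OF compact_continuous_image[OF c(1)]] by (auto simp: bounded_pos)
  obtain C2 where C2: "0 < C2" "\<And>s. s \<in> {0..l} \<Longrightarrow> \<bar>s\<^sup>2 * radial_profile'' d s\<bar> \<le> C2"
    using compact_imp_bounded[OF compact_continuous_image[OF c(2)]] by (auto simp: bounded_pos)
  show ?thesis
    by (rule that[of "max C1 C2"]) (use C1 C2 in \<open>auto intro: max.coboundedI1 max.coboundedI2\<close>)
qed

lemma radial_profile_lower_bound: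
  assumes d: "0 < d" and l: "\<And>s. 0 \<le> s \<Longrightarrow> s \<le> l \<Longrightarrow> 0 < radial_profile d s" "0 \<le> l"
  obtains \<kappa> where "0 < \<kappa>" "\<And>s. 0 \<le> s \<Longrightarrow> s \<le> l \<Longrightarrow> \<kappa> \<le> radial_profile d s"
proof -
  have "continuous_on {0..l} (radial_profile d)"
    by (intro continuous_at_imp_continuous_on ballI DERIV_isCont[OF DERIV_radial_profile[OF d]])
  then obtain s where "s \<in> {0..l}" "\<And>r. r \<in> {0..l} \<Longrightarrow> radial_profile d s \<le> radial_profile d r"
    using continuous_attains_inf[of "{0..l}" "radial_profile d"] l(2) by auto
  then show ?thesis using that[of "radial_profile d s"] l(1) by auto
qed

text \<open>A supersolution growing like \<open>exp (\<theta> * x powr (1 - \<alpha>))\<close>; the translation by a large \<open>L\<close> makes the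
  error terms of order \<open>x powr (- 1 - \<alpha>)\<close> negligible on the whole domain.\<close>

lemma parabola_supersolution:
  fixes \<alpha> A l \<theta> \<epsilon> :: real
  assumes \<alpha>: "0 < \<alpha>" "\<alpha> < 1" and A: "0 < A" and \<epsilon>: "0 < \<epsilon>"
    and l: "0 < l" "\<And>s. 0 \<le> s \<Longrightarrow> s < l \<Longrightarrow> 0 < radial_profile DIM('a::euclidean_space) s"
    and \<theta>: "0 < \<theta>" "\<theta> < sqrt l / (A * (1 - \<alpha>))"
  shows "\<exists>\<kappa> L. \<exists>h :: real \<times> 'a::euclidean_space \<Rightarrow> real. 0 < \<kappa> \<and> 1 \<le> L \<and> A * L powr (\<alpha> - 1) \<le> \<epsilon> \<and>
    continuous_on (closure (parabola_region \<alpha> A)) h \<and>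
    (\<forall>p\<in>parabola_region \<alpha> A. superharmonic_near h p) \<and>
    (\<forall>p\<in>closure (parabola_region \<alpha> A). \<kappa> * exp (\<theta> * (fst p + L) powr (1 - \<alpha>)) \<le> h p)"
proof -
  have d: "0 < DIM('a)" by simp
  define \<theta>' where "\<theta>' = \<theta> * (1 - \<alpha>)"
  have "A * \<theta>' < sqrt l" using \<theta>(2) A \<alpha> by (simp add: \<theta>'_def field_simps)
  moreover have \<theta>': "0 < \<theta>'" using \<theta> \<alpha> by (simp add: \<theta>'_def)
  ultimately have "(A * \<theta>')\<^sup>2 < (sqrt l)\<^sup>2" using A by (intro power_strict_mono) auto
  then have Al: "(A * \<theta>')\<^sup>2 < l" using l by simp
  \<comment> \<open>Above \<open>(A * \<theta>')^2\<close> it makes the leading coefficient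
    \<open>\<theta>'^2 - m\<close> negative; below \<open>l\<close> it keeps the profile bounded
    below up to the lateral boundary.\<close>
  define q where "q = ((A * \<theta>')\<^sup>2 + l) / 2"
  have q: "(A * \<theta>')\<^sup>2 < q" "q < l" "0 < q" using Al l by (auto simp: q_def add_nonneg_pos)
  define m where "m = q / A\<^sup>2"
  have m: "\<theta>'\<^sup>2 < m" "0 < m" using q A by (auto simp: m_def power_mult_distrib field_simps)
  obtain \<kappa> where \<kappa>: "0 < \<kappa>" "\<And>s. 0 \<le> s \<Longrightarrow> s \<le> q \<Longrightarrow> \<kappa> \<le> radial_profile DIM('a) s"
    using radial_profile_lower_bound[OF d, of q] l(2) q by (metis less_imp_le order_le_less_trans)
  obtain C where C: "0 < C" "\<And>s. 0 \<le> s \<Longrightarrow> s \<le> q \<Longrightarrow> \<bar>s * radial_profile' DIM('a) s\<bar> \<le> C"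
    "\<And>s. 0 \<le> s \<Longrightarrow> s \<le> q \<Longrightarrow> \<bar>s\<^sup>2 * radial_profile'' DIM('a) s\<bar> \<le> C"
    using radial_bounds[OF d, of q] by blast
  \<comment> \<open>The sum of the coefficients of the three error terms, with each profile factor
    replaced by its bound \<open>C\<close>.\<close>
  define K where "K = 4 * \<alpha> * \<theta>' * C + 2 * \<alpha> * (2 * \<alpha> + 1) * C + 4 * \<alpha>\<^sup>2 * C"
  have lim: "((\<lambda>x. x powr (\<alpha> - 1)) \<longlongrightarrow> 0) at_top"
    using \<alpha> by (intro tendsto_neg_powr filterlim_ident) auto
  have "\<forall>\<^sub>F x in at_top. K * x powr (\<alpha> - 1) < (m - \<theta>'\<^sup>2) * \<kappa>"
    using \<kappa> m by (intro order_tendstoD(2)[OF tendsto_mult_right_zero[OF lim]]) auto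
  moreover have "\<forall>\<^sub>F x in at_top. A * x powr (\<alpha> - 1) < \<epsilon>"
    using \<epsilon> by (intro order_tendstoD(2)[OF tendsto_mult_right_zero[OF lim]])
  ultimately have "\<forall>\<^sub>F x in at_top. K * x powr (\<alpha> - 1) < (m - \<theta>'\<^sup>2) * \<kappa> \<and> A * x powr (\<alpha> - 1) < \<epsilon> \<and> 1 \<le> x"
    using eventually_ge_at_top[of 1] by eventually_elim auto
  then obtain L where L: "K * L powr (\<alpha> - 1) < (m - \<theta>'\<^sup>2) * \<kappa>" "A * L powr (\<alpha> - 1) < \<epsilon>" "1 \<le> L"
    by (auto simp: eventually_at_top_linorder)
  define G where "G x = \<theta> * (x + L) powr (1 - \<alpha>)" for x
  define G1 where "G1 x = \<theta>' * (x + L) powr (- \<alpha>)" for x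
  define G2 where "G2 x = - \<alpha> * \<theta>' * (x + L) powr (- \<alpha> - 1)" for x
  define h where "h p = 1 * (exp (G (fst p)) * radial_profile DIM('a) (m * (fst p + L) powr (- 2 * \<alpha>) * (snd p \<bullet> snd p))) + 0"
    for p :: "real \<times> 'a"
  have \<sigma>: "0 \<le> m * (x + L) powr (- 2 * \<alpha>) * (Y \<bullet> Y)" "m * (x + L) powr (- 2 * \<alpha>) * (Y \<bullet> Y) \<le> q"
    if "0 \<le> x" "norm Y \<le> A * x powr \<alpha>" for x and Y :: 'a
  proof -
    \<comment> \<open>Shifting to the right widens the cross section, so \<open>\<sigma>\<close> is
      at most \<open>q\<close> on the original region.\<close>
    have "norm Y \<le> A * (x + L) powr \<alpha>"
      using that L \<alpha> A by (meson add_increasing2 mult_left_mono order_trans powr_mono2 less_imp_le order_refl zero_le_one)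
    then show "0 \<le> m * (x + L) powr (- 2 * \<alpha>) * (Y \<bullet> Y)" "m * (x + L) powr (- 2 * \<alpha>) * (Y \<bullet> Y) \<le> q"
      unfolding m_def using parabola_similarity_bounds[of "x + L" A q Y \<alpha>] that L A q by auto
  qed
  show ?thesis
  proof (rule exI[of _ \<kappa>], rule exI[of _ L], rule exI[of _ h], intro conjI ballI)
    show "0 < \<kappa>" "1 \<le> L" "A * L powr (\<alpha> - 1) \<le> \<epsilon>" using \<kappa> L by auto
    have "continuous_on {p. 0 \<le> fst p} h"
      unfolding h_def G_def using L
      by (intro continuous_intros continuous_on_radial_profile[OF d]) auto
    then show "continuous_on (closure (parabola_region \<alpha> A)) h"
      by (rule continuous_on_subset) (use closure_parabola_region[OF \<alpha>(1)] in blast)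
  next
    fix p :: "real \<times> 'a" assume "p \<in> closure (parabola_region \<alpha> A)"
    then have p: "0 \<le> fst p" "norm (snd p) \<le> A * fst p powr \<alpha>"
      using closure_parabola_region[OF \<alpha>(1)] by blast+
    have "exp (G (fst p)) * \<kappa> \<le> h p"
      unfolding h_def using \<kappa>(2)[OF \<sigma>[OF p]] by simp
    then show "\<kappa> * exp (\<theta> * (fst p + L) powr (1 - \<alpha>)) \<le> h p" by (simp add: G_def mult.commute)
  next
    fix p :: "real \<times> 'a" assume "p \<in> parabola_region \<alpha> A"
    then have p: "0 < fst p" "norm (snd p) < A * fst p powr \<alpha>" by (auto simp: parabola_region_def)
    show "superharmonic_near h p"
      unfolding h_def
    proof (rule barrier_superharmonic_near[where ?G1.0=G1 and ?G2.0=G2])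
      show "- L < fst p" using p L by simp
      show "DERIV G x :> G1 x" if "- L < x" for x
        using that unfolding G_def G1_def \<theta>'_def
        by (rule DERIV_cong[OF DERIV_shifted_powr]) (simp_all add: mult_ac)
      show "DERIV G1 x :> G2 x" if "- L < x" for x
        using that unfolding G1_def G2_def
        by (rule DERIV_cong[OF DERIV_shifted_powr]) (simp_all add: mult_ac)
      show "isCont G2 x" if "- L < x" for x
        using that unfolding G2_def by (intro continuous_intros) auto
      define X where "X = fst p + L"
      have X: "1 \<le> X" "L \<le> X" using p L by (auto simp: X_def)
      define \<sigma>p where "\<sigma>p = m * X powr (- 2 * \<alpha>) * (snd p \<bullet> snd p)"
      have s: "0 \<le> \<sigma>p" "\<sigma>p \<le> q" using \<sigma>[of "fst p" "snd p"] p by (auto simp: \<sigma>p_def X_def)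
      define P P1 P2 where "P = radial_profile DIM('a) \<sigma>p" and "P1 = \<sigma>p * radial_profile' DIM('a) \<sigma>p"
        and "P2 = \<sigma>p\<^sup>2 * radial_profile'' DIM('a) \<sigma>p"
      have P: "\<kappa> \<le> P" "\<bar>P1\<bar> \<le> C" "\<bar>P2\<bar> \<le> C" using \<kappa>(2)[OF s] C(2,3)[OF s] by (auto simp: P_def P1_def P2_def)
      \<comment> \<open>The leading term is of size \<open>w\<close> and each error is at most a
        constant times \<open>w * u\<close>; the ratio \<open>u\<close> is small once
        \<open>L \<le> X\<close>. That \<open>1 \<le> X\<close> enters in comparing
        \<open>1 / X^2\<close> with \<open>w * u\<close>.\<close>
      define w where "w = X powr (- 2 * \<alpha>)"
      define u where "u = X powr (\<alpha> - 1)"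
      have w: "0 < w" and u: "0 < u" using X by (auto simp: w_def u_def)
      have wu: "X powr (- \<alpha> - 1) = w * u" using X by (simp add: w_def u_def flip: powr_add)
      have G1: "G1 (fst p) = \<theta>' * X powr (- \<alpha>)" by (simp only: G1_def X_def)
      have g1: "G1 (fst p) / X = \<theta>' * (w * u)"
        using X unfolding wu[symmetric] G1 by (simp add: powr_diff)
      have g1s: "(G1 (fst p))\<^sup>2 = \<theta>'\<^sup>2 * w"
        unfolding G1 w_def by (simp add: power_mult_distrib powr_square)
      have "1 / X\<^sup>2 = X powr (- 2)" 
        using X powr_minus[of X 2] powr_numeral[of X "Num.Bit0 Num.One"] by (simp add: inverse_eq_divide)
      also have "\<dots> \<le> X powr (- \<alpha> - 1)" using X \<alpha> by (intro powr_mono) auto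
      finally have x2: "1 / X\<^sup>2 \<le> w * u" unfolding wu .
      have 1: "(G2 (fst p) + (G1 (fst p))\<^sup>2 - m * w) * P \<le> - ((m - \<theta>'\<^sup>2) * \<kappa>) * w"
      proof -
        \<comment> \<open>Concavity of the exponent has the favourable sign and is
          discarded.\<close>
        have "G2 (fst p) \<le> 0" unfolding G2_def using \<alpha> \<theta>' by simp
        then have "G2 (fst p) + (G1 (fst p))\<^sup>2 - m * w \<le> - ((m - \<theta>'\<^sup>2) * w)"
          unfolding g1s by (simp add: algebra_simps)
        then have "(G2 (fst p) + (G1 (fst p))\<^sup>2 - m * w) * P \<le> - ((m - \<theta>'\<^sup>2) * w) * P"
          using P \<kappa> by (intro mult_right_mono) auto
        also have "(m - \<theta>'\<^sup>2) * w * \<kappa> \<le> (m - \<theta>'\<^sup>2) * w * P" using P m w by (intro mult_left_mono) auto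
        then have "- ((m - \<theta>'\<^sup>2) * w) * P \<le> - ((m - \<theta>'\<^sup>2) * \<kappa>) * w" by (simp add: mult_ac)
        finally show ?thesis .
      qed
      have 2: "- (4 * \<alpha> * G1 (fst p) * P1 / X) \<le> 4 * \<alpha> * \<theta>' * C * (w * u)"
      proof -
        have "- (4 * \<alpha> * G1 (fst p) * P1 / X) = 4 * \<alpha> * (G1 (fst p) / X) * (- P1)" by simp
        also have "\<dots> \<le> 4 * \<alpha> * (G1 (fst p) / X) * C"
          using P \<alpha> \<theta>' w u unfolding g1 by (intro mult_left_mono) auto
        finally show ?thesis unfolding g1 by (simp add: mult_ac)
      qed
      have bound: "c * Q / X\<^sup>2 \<le> c * C * (w * u)" if "0 \<le> c" "\<bar>Q\<bar> \<le> C" for c Q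
      proof -
        have "c * Q / X\<^sup>2 = c * (Q * (1 / X\<^sup>2))" by simp
        also have "\<dots> \<le> c * (C * (w * u))"
        proof (intro mult_left_mono)
          have "Q * (1 / X\<^sup>2) \<le> C * (1 / X\<^sup>2)" using that by (intro mult_right_mono) auto
          also have "\<dots> \<le> C * (w * u)" using x2 C by (intro mult_left_mono) auto
          finally show "Q * (1 / X\<^sup>2) \<le> C * (w * u)" .
        qed (use that in auto)
        finally show ?thesis by (simp add: mult_ac)
      qed
      have 3: "2 * \<alpha> * (2 * \<alpha> + 1) * P1 / X\<^sup>2 \<le> 2 * \<alpha> * (2 * \<alpha> + 1) * C * (w * u)"
        and 4: "4 * \<alpha>\<^sup>2 * P2 / X\<^sup>2 \<le> 4 * \<alpha>\<^sup>2 * C * (w * u)"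
        using P \<alpha> by (auto intro!: bound)
      have "K * u \<le> K * L powr (\<alpha> - 1)"
        unfolding u_def using X L \<alpha> \<theta>' C by (intro mult_left_mono powr_mono2') (auto simp: K_def)
      with L have "K * u < (m - \<theta>'\<^sup>2) * \<kappa>" by simp
      then have "K * u * w < (m - \<theta>'\<^sup>2) * \<kappa> * w" using w by simp
      then have "(G2 (fst p) + (G1 (fst p))\<^sup>2 - m * w) * P - 4 * \<alpha> * G1 (fst p) * P1 / X
          + 2 * \<alpha> * (2 * \<alpha> + 1) * P1 / X\<^sup>2 + 4 * \<alpha>\<^sup>2 * P2 / X\<^sup>2 < 0"
        using 1 2 3 4 unfolding K_def by (simp add: algebra_simps)
      then show "let X = fst p + L; \<mu> = m * X powr (- 2 * \<alpha>) in
        1 * barrier_laplacian DIM('a) \<alpha> X \<mu> (\<mu> * (snd p \<bullet> snd p)) (G1 (fst p)) (G2 (fst p)) < 0"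
        unfolding Let_def barrier_laplacian_def P_def P1_def P2_def X_def \<sigma>p_def w_def by simp
    qed
  qed
qed

text \<open>\<open>|p|\<close> exceeds \<open>X = fst p + L\<close> at most by the factor
  \<open>1 + \<epsilon>\<close>, because the cross section is thin relative to \<open>X\<close>.
  Raising the constant from \<open>b'\<close> to \<open>\<theta>\<close> pays for this factor, so
  the supersolution dominates the exponential of \<open>|p|\<close> on the closure.\<close>

theorem parabola_exp_moment_finite:
  fixes B :: "real \<Rightarrow> 'w \<Rightarrow> real \<times> 'a::euclidean_space"
  assumes \<alpha>: "0 < \<alpha>" "\<alpha> < 1" and A: "0 < A"
    and l: "0 < l" "\<And>s. 0 \<le> s \<Longrightarrow> s < l \<Longrightarrow> 0 < radial_profile DIM('a) s"
    and z: "z \<in> parabola_region \<alpha> A" and B: "brownian_motion M B z"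
    and b: "b < sqrt l / (A * (1 - \<alpha>))"
  shows "(\<integral>\<^sup>+ \<omega>. ennreal (exp (b * norm (exit_position B (parabola_region \<alpha> A) \<omega>) powr (1 - \<alpha>))) \<partial>M) < \<infinity>"
proof -
  interpret brownian_motion M B z by fact
  let ?D = "parabola_region \<alpha> A :: (real \<times> 'a) set"
  let ?R = "\<lambda>\<omega>. norm (exit_position B ?D \<omega>) powr (1 - \<alpha>)"
  define c where "c = sqrt l / (A * (1 - \<alpha>))"
  have c: "0 < c" using l A \<alpha> by (simp add: c_def)
  \<comment> \<open>A small or negative \<open>b\<close> is replaced by a positive constant that is
    still subcritical.\<close>
  define b' where "b' = max b (c / 2)"
  have b': "0 < b'" "b' < c" "b \<le> b'" using b[folded c_def] c unfolding b'_def by linarith+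
  define \<theta> where "\<theta> = (b' + c) / 2"
  have \<theta>: "0 < \<theta>" "b' < \<theta>" "\<theta> < c" using b' by (auto simp: \<theta>_def)
  define \<epsilon> where "\<epsilon> = \<theta> / b' - 1"
  have \<epsilon>: "0 < \<epsilon>" "b' * (1 + \<epsilon>) = \<theta>" using b' \<theta> by (auto simp: \<epsilon>_def)
  have "\<exists>\<kappa> L. \<exists>h :: real \<times> 'a \<Rightarrow> real. 0 < \<kappa> \<and> 1 \<le> L \<and> A * L powr (\<alpha> - 1) \<le> \<epsilon> \<and>
    continuous_on (closure ?D) h \<and> (\<forall>p\<in>?D. superharmonic_near h p) \<and>
    (\<forall>p\<in>closure ?D. \<kappa> * exp (\<theta> * (fst p + L) powr (1 - \<alpha>)) \<le> h p)"
    by (rule parabola_supersolution) (use \<alpha> A \<epsilon> l \<theta> in \<open>auto simp: c_def\<close>)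
  then obtain \<kappa> L and h :: "real \<times> 'a \<Rightarrow> real" where h: "0 < \<kappa>" "1 \<le> L" "A * L powr (\<alpha> - 1) \<le> \<epsilon>"
    "continuous_on (closure ?D) h" "\<forall>p\<in>?D. superharmonic_near h p"
    and h6: "\<forall>p\<in>closure ?D. \<kappa> * exp (\<theta> * (fst p + L) powr (1 - \<alpha>)) \<le> h p"
    by (elim exE conjE) (rule that)
  have h0: "0 \<le> h p" if "p \<in> closure ?D" for p
    using order_trans[OF _ h6[rule_format, OF that], of 0] h(1) by simp
  have le: "exp (b' * norm p powr (1 - \<alpha>)) \<le> h p / \<kappa>" if p: "p \<in> closure ?D" for p
  proof -
    have p': "0 \<le> fst p" "norm (snd p) \<le> A * fst p powr \<alpha>"
      using p closure_parabola_region[OF \<alpha>(1)] by blast+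
    define X where "X = fst p + L"
    have X: "L \<le> X" "0 < X" using p' h(2) by (auto simp: X_def)
    have "norm p \<le> norm (fst p) + norm (snd p)" using norm_Pair_le[of "fst p" "snd p"] by simp
    also have "\<dots> \<le> X + A * X powr \<alpha>"
    proof (intro add_mono)
      show "norm (fst p) \<le> X" using p' h(2) by (simp add: X_def)
      have "A * fst p powr \<alpha> \<le> A * X powr \<alpha>" using p' h(2) \<alpha> A unfolding X_def by (intro mult_left_mono powr_mono2) auto
      then show "norm (snd p) \<le> A * X powr \<alpha>" using p' by simp
    qed
    also have "\<dots> = X * (1 + A * X powr (\<alpha> - 1))" using X by (simp add: powr_diff field_simps)
    also have "\<dots> \<le> X * (1 + \<epsilon>)"
    proof -
      have "A * X powr (\<alpha> - 1) \<le> A * L powr (\<alpha> - 1)" using X h(2) \<alpha> A by (intro mult_left_mono powr_mono2') auto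
      then show ?thesis using h(3) X by (intro mult_left_mono) auto
    qed
    finally have "norm p powr (1 - \<alpha>) \<le> (X * (1 + \<epsilon>)) powr (1 - \<alpha>)" using \<alpha> by (intro powr_mono2) auto
    also have "\<dots> = X powr (1 - \<alpha>) * (1 + \<epsilon>) powr (1 - \<alpha>)" by (rule powr_mult)
    also have "\<dots> \<le> X powr (1 - \<alpha>) * (1 + \<epsilon>)"
      using powr_mono[of "1 - \<alpha>" 1 "1 + \<epsilon>"] \<epsilon> \<alpha> by (intro mult_left_mono) auto
    finally have "b' * norm p powr (1 - \<alpha>) \<le> b' * (X powr (1 - \<alpha>) * (1 + \<epsilon>))" using b' by (intro mult_left_mono) auto
    also have "\<dots> = \<theta> * X powr (1 - \<alpha>)" unfolding \<epsilon>(2)[symmetric] by simp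
    finally have "\<kappa> * exp (b' * norm p powr (1 - \<alpha>)) \<le> \<kappa> * exp (\<theta> * X powr (1 - \<alpha>))" using h(1) by simp
    also have "\<dots> \<le> h p" using h6[rule_format, OF p] by (simp add: X_def)
    finally show ?thesis using h(1) by (simp add: field_simps)
  qed
  \<comment> \<open>Paths that never leave have exit position \<open>B 0 \<omega> = z\<close>, since
    \<open>real_of_ereal \<infinity> = 0\<close>; on them the integrand is at most this
    constant.\<close>
  define k where "k = exp (b' * norm z powr (1 - \<alpha>))"
  obtain F where F[measurable]: "F \<in> borel_measurable M" and Fi: "(\<integral>\<^sup>+\<omega>. F \<omega> \<partial>M) \<le> ennreal (h z)"
    and Fae: "AE \<omega> in M. exit_time B ?D \<omega> < \<infinity> \<longrightarrow> ennreal (h (exit_position B ?D \<omega>)) \<le> F \<omega>"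
    using superharmonic_exit_expectation[OF open_parabola_region z h(4) h0[OF subsetD[OF closure_subset]] h(5)[rule_format]] by blast
  have "AE \<omega> in M. ennreal (exp (b * ?R \<omega>)) \<le> F \<omega> * ennreal (1 / \<kappa>) + ennreal k"
    using Fae start AE_space
  proof eventually_elim
    case (elim \<omega>)
    have "exp (b * ?R \<omega>) \<le> exp (b' * ?R \<omega>)" using b' by (simp add: mult_right_mono)
    then have 1: "ennreal (exp (b * ?R \<omega>)) \<le> ennreal (exp (b' * ?R \<omega>))" by (rule ennreal_leI)
    show ?case
    proof (cases "exit_time B ?D \<omega> < \<infinity>")
      case True
      then have p: "exit_position B ?D \<omega> \<in> closure ?D"
        using exit_position_mem_boundary[OF elim(3,2) open_parabola_region z] by auto
      note 1
      also have "ennreal (exp (b' * ?R \<omega>)) \<le> ennreal (h (exit_position B ?D \<omega>) * (1 / \<kappa>))"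
        using le[OF p] by (intro ennreal_leI) simp
      also have "\<dots> = ennreal (h (exit_position B ?D \<omega>)) * ennreal (1 / \<kappa>)"
        using h(1) by (intro ennreal_mult'') simp
      also have "\<dots> \<le> F \<omega> * ennreal (1 / \<kappa>)"
        using elim(1) True by (intro mult_right_mono) auto
      also have "\<dots> \<le> \<dots> + ennreal k" by simp
      finally show ?thesis .
    next
      case False
      then have "exit_position B ?D \<omega> = z" using elim(2) by (simp add: exit_position_def)
      then have "ennreal (exp (b' * ?R \<omega>)) = ennreal k" by (simp add: k_def)
      with 1 show ?thesis by (auto intro: order_trans)
    qed
  qed
  then have "(\<integral>\<^sup>+ \<omega>. ennreal (exp (b * ?R \<omega>)) \<partial>M) \<le> (\<integral>\<^sup>+ \<omega>. F \<omega> * ennreal (1 / \<kappa>) + ennreal k \<partial>M)"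
    by (rule nn_integral_mono_AE)
  also have "\<dots> = (\<integral>\<^sup>+ \<omega>. F \<omega> \<partial>M) * ennreal (1 / \<kappa>) + ennreal k"
    by (simp add: nn_integral_add nn_integral_multc emeasure_space_1)
  also have "\<dots> \<le> ennreal (h z) * ennreal (1 / \<kappa>) + ennreal k"
    using Fi by (intro add_right_mono mult_right_mono) auto
  also have "\<dots> < \<infinity>" by (simp add: ennreal_mult_less_top)
  finally show ?thesis .
qed

section \<open>Measurability and finiteness of exit times\<close>

context brownian_motion
begin

text \<open>Rational times are dense in the interval, so by continuity they suffice to test a closed
  condition.\<close>

lemma random_closed_on_interval:
  assumes C: "closed C" and ab: "0 \<le> a" "a < b"
  shows "{\<omega>\<in>space M. \<forall>t\<in>{a..b}. B t \<omega> \<in> C} \<in> sets M"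
proof -
  have "{\<omega>\<in>space M. \<forall>t\<in>{a..b}. B t \<omega> \<in> C} = {\<omega>\<in>space M. \<forall>q\<in>\<rat> \<inter> {a<..<b}. B q \<omega> \<in> C}"
  proof safe
    fix \<omega> t assume \<omega>: "\<omega> \<in> space M" and q: "\<forall>q\<in>\<rat> \<inter> {a<..<b}. B q \<omega> \<in> C" and t: "t \<in> {a..b}"
    have "continuous_on {0..} (\<lambda>t. B t \<omega>)" using continuous_paths \<omega> by auto
    then have "continuous_on (closure (\<rat> \<inter> {a<..<b})) (\<lambda>t. B t \<omega>)"
      using ab by (rule_tac continuous_on_subset) (auto dest!: subsetD[OF closure_mono[of "\<rat> \<inter> {a<..<b}" "{a..b}"], rotated])
    then have "(\<lambda>t. B t \<omega>) ` closure (\<rat> \<inter> {a<..<b}) \<subseteq> C"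
      by (rule image_closure_subset[OF _ C]) (use q in auto)
    moreover have "closure (\<rat> \<inter> {a<..<b}) = {a..b}"
      using closure_open_Int_superset[of "{a<..<b}" "\<rat>"] ab by (simp add: Rats_closure_real Int_commute)
    ultimately show "B t \<omega> \<in> C" using t by blast
  qed auto
  also have "\<dots> \<in> sets M"
  proof -
    have Q: "countable (\<rat> \<inter> {a<..<b})" using countable_rat by (rule countable_subset[rotated]) auto
    have m: "{\<omega>\<in>space M. B q \<omega> \<in> C} \<in> sets M" if "q \<in> \<rat> \<inter> {a<..<b}" for q
    proof -
      have [measurable]: "B q \<in> borel_measurable M" using that ab by (intro random_variable) auto
      have [measurable]: "C \<in> sets borel" using C by simp
      show ?thesis by measurable
    qed
    from sets.sets_Collect_countable_All'[OF m Q] show ?thesis by simp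
  qed
  finally show ?thesis .
qed

text \<open>A path segment is compact, so it stays in an open set exactly when it stays in one
  member of a compact exhaustion; this reduces open sets to closed ones.\<close>

lemma random_exit_in_interval:
  assumes V: "open V" and ab: "0 \<le> a" "a < b"
  shows "{\<omega>\<in>space M. \<exists>t\<in>{a..b}. B t \<omega> \<notin> V} \<in> sets M"
proof -
  obtain C :: "nat \<Rightarrow> 'a set" where C: "\<And>n. compact (C n)" "\<And>n. C n \<subseteq> V" "\<And>S. compact S \<Longrightarrow> S \<subseteq> V \<Longrightarrow> \<exists>N. \<forall>n\<ge>N. S \<subseteq> C n"
    using open_Union_compact_subsets[OF V] by metis
  have "{\<omega>\<in>space M. \<exists>t\<in>{a..b}. B t \<omega> \<notin> V} = space M - (\<Union>n. {\<omega>\<in>space M. \<forall>t\<in>{a..b}. B t \<omega> \<in> C n})"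
  proof -
    have "(\<exists>t\<in>{a..b}. B t \<omega> \<notin> V) \<longleftrightarrow> \<not> (\<exists>n. \<forall>t\<in>{a..b}. B t \<omega> \<in> C n)" if \<omega>: "\<omega> \<in> space M" for \<omega>
    proof
      assume "\<exists>t\<in>{a..b}. B t \<omega> \<notin> V"
      then show "\<not> (\<exists>n. \<forall>t\<in>{a..b}. B t \<omega> \<in> C n)" using C(2) by (meson subsetD)
    next
      assume *: "\<not> (\<exists>n. \<forall>t\<in>{a..b}. B t \<omega> \<in> C n)"
      have "continuous_on {a..b} (\<lambda>t. B t \<omega>)"
        using continuous_paths[OF \<omega>] by (rule continuous_on_subset) (use ab in auto)
      then have K: "compact ((\<lambda>t. B t \<omega>) ` {a..b})" by (rule compact_continuous_image) simp
      have "\<not> (\<lambda>t. B t \<omega>) ` {a..b} \<subseteq> V"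
      proof
        assume "(\<lambda>t. B t \<omega>) ` {a..b} \<subseteq> V"
        from C(3)[OF K this] obtain n where n: "(\<lambda>t. B t \<omega>) ` {a..b} \<subseteq> C n" by auto
        have "\<forall>t\<in>{a..b}. B t \<omega> \<in> C n" using subsetD[OF n] by simp
        then show False using * by blast
      qed
      then show "\<exists>t\<in>{a..b}. B t \<omega> \<notin> V" by auto
    qed
    then show ?thesis by auto
  qed
  also have "\<dots> \<in> sets M"
    using random_closed_on_interval[OF compact_imp_closed[OF C(1)] ab] by (intro sets.Diff sets.countable_UN) auto
  finally show ?thesis .
qed

lemma borel_measurable_exit_time:
  assumes V: "open V"
  shows "exit_time B V \<in> borel_measurable M"
proof (rule borel_measurableI_less)
  \<comment> \<open>An exit before \<open>y\<close> is detected on countably many intervals. The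
    left end \<open>1 / (n + 1)\<close> keeps the times positive, as in the definition of the exit
    time, \<open>0 < k\<close> makes the interval nondegenerate, and the right end is strictly below
    \<open>y\<close>.\<close>
  define P where "P y n k \<omega> \<longleftrightarrow> 0 < k \<and> ereal (1 / real (Suc n) + real k / real (Suc n)) < y \<and>
      (\<exists>t\<in>{1 / real (Suc n)..1 / real (Suc n) + real k / real (Suc n)}. B t \<omega> \<notin> V)" for y n \<omega> and k :: nat
  have lt: "exit_time B V \<omega> < y \<longleftrightarrow> (\<exists>n k. P y n k \<omega>)" for \<omega> y
  proof
    assume "exit_time B V \<omega> < y"
    then obtain t where t: "0 < t" "B t \<omega> \<notin> V" "ereal t < y"
      unfolding exit_time_def INF_less_iff by auto
    \<comment> \<open>Room between \<open>t\<close> and \<open>y\<close>, so that the right end of a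
      short interval containing \<open>t\<close> stays below \<open>y\<close>.\<close>
    obtain r where r: "t < r" "ereal r < y"
    proof (cases y)
      case (real s)
      with t that[of "(t + s) / 2"] show ?thesis by auto
    next
      case PInf
      with that[of "t + 1"] show ?thesis by simp
    qed (use t in auto)
    obtain n where n: "1 / real (Suc n) < min t ((r - t) / 2)"
      using nat_approx_posE[of "min t ((r - t) / 2)"] t r by auto
    define k where "k = nat \<lceil>(t - 1 / real (Suc n)) * real (Suc n)\<rceil>"
    have pos: "0 < (t - 1 / real (Suc n)) * real (Suc n)" using n by (intro mult_pos_pos) auto
    have k: "(t - 1 / real (Suc n)) * real (Suc n) \<le> real k" "real k < (t - 1 / real (Suc n)) * real (Suc n) + 1"
      unfolding k_def using pos by linarith+
    have k0: "0 < k" unfolding k_def using pos by simp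
    have "t - 1 / real (Suc n) \<le> real k / real (Suc n)" "real k / real (Suc n) < t - 1 / real (Suc n) + 1 / real (Suc n)"
      using k by (auto simp: field_simps)
    then have "t \<in> {1 / real (Suc n)..1 / real (Suc n) + real k / real (Suc n)}"
      "1 / real (Suc n) + real k / real (Suc n) < r" using n r by auto
    moreover from this have "ereal (1 / real (Suc n) + real k / real (Suc n)) < y" 
      using r(2) by (metis less_ereal.simps(1) less_trans)
    ultimately show "\<exists>n k. P y n k \<omega>" using k0 t(2) unfolding P_def by blast
  next
    assume "\<exists>n k. P y n k \<omega>"
    then obtain n k t where "ereal (1 / real (Suc n) + real k / real (Suc n)) < y"
      and t: "1 / real (Suc n) \<le> t" "t \<le> 1 / real (Suc n) + real k / real (Suc n)" "B t \<omega> \<notin> V" unfolding P_def by auto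
    then have "ereal t < y" by (metis ereal_less_eq(3) le_less_trans)
    moreover have "0 < t" using t(1) by (rule less_le_trans[rotated]) simp
    ultimately show "exit_time B V \<omega> < y"
      unfolding exit_time_def INF_less_iff using t(3) by blast
  qed
  fix y :: ereal
  have "{\<omega>\<in>space M. P y n k \<omega>} \<in> sets M" for n k
  proof (cases "0 < k \<and> ereal (1 / real (Suc n) + real k / real (Suc n)) < y")
    case True
    have "{\<omega>\<in>space M. \<exists>t\<in>{1 / real (Suc n)..1 / real (Suc n) + real k / real (Suc n)}. B t \<omega> \<notin> V} \<in> sets M"
      using True by (intro random_exit_in_interval V) auto
    then show ?thesis using True by (simp add: P_def)
  next
    case False
    then have e: "{\<omega>\<in>space M. P y n k \<omega>} = {}" by (auto simp: P_def)
    show ?thesis unfolding e by simp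
  qed
  then have "{\<omega>\<in>space M. \<exists>n k. P y n k \<omega>} \<in> sets M"
    by (intro sets.sets_Collect_countable_Ex)
  then show "{\<omega>\<in>space M. exit_time B V \<omega> < y} \<in> sets M" by (simp only: lt)
qed

text \<open>The exit time rounded up to a dyadic number takes countably many values, so the path
  evaluated there is measurable; continuity gives the limit.\<close>

lemma borel_measurable_exit_position:
  assumes V: "open V"
  shows "exit_position B V \<in> borel_measurable M"
proof -
  define T where "T \<omega> = real_of_ereal (exit_time B V \<omega>)" for \<omega>
  have [measurable]: "T \<in> borel_measurable M"
    unfolding T_def using borel_measurable_exit_time[OF V] by measurable
  have T0: "0 \<le> T \<omega>" for \<omega>
    unfolding T_def exit_time_def by (intro real_of_ereal_pos INF_greatest) auto
  define k where "k n \<omega> = nat \<lceil>T \<omega> * 2 ^ n\<rceil>" for n \<omega>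
  have k: "k n \<in> M \<rightarrow>\<^sub>M count_space UNIV" for n unfolding k_def by measurable
  show ?thesis
  proof (rule borel_measurable_LIMSEQ_metric)
    show "(\<lambda>\<omega>. B (real (k n \<omega>) / 2 ^ n) \<omega>) \<in> borel_measurable M" for n
      by (rule measurable_compose_countable[OF _ k]) (auto intro!: random_variable)
    fix \<omega> assume \<omega>: "\<omega> \<in> space M"
    have "(\<lambda>n. real (k n \<omega>) / 2 ^ n) \<longlonglongrightarrow> T \<omega>"
    proof (rule tendsto_sandwich[OF always_eventually always_eventually])
      have r: "T \<omega> * 2 ^ n \<le> real (k n \<omega>)" "real (k n \<omega>) \<le> T \<omega> * 2 ^ n + 1" for n
        unfolding k_def using T0[of \<omega>] by (auto simp: of_nat_ceiling intro: order_less_imp_le)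
      show "\<forall>n. T \<omega> \<le> real (k n \<omega>) / 2 ^ n" "\<forall>n. real (k n \<omega>) / 2 ^ n \<le> T \<omega> + 1 / 2 ^ n"
        using r by (auto simp: field_simps)
      have "(\<lambda>n. T \<omega> + 1 / 2 ^ n) \<longlonglongrightarrow> T \<omega> + 0"
        by (intro tendsto_add tendsto_const LIMSEQ_divide_realpow_zero) auto
      then show "(\<lambda>n. T \<omega> + 1 / 2 ^ n) \<longlonglongrightarrow> T \<omega>" by simp
    qed auto
    then have "(\<lambda>n. B (real (k n \<omega>) / 2 ^ n) \<omega>) \<longlonglongrightarrow> B (T \<omega>) \<omega>"
      using continuous_on_tendsto_compose[OF continuous_paths[OF \<omega>], of "\<lambda>n. real (k n \<omega>) / 2 ^ n" "T \<omega>"] T0 by auto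
    then show "(\<lambda>n. B (real (k n \<omega>) / 2 ^ n) \<omega>) \<longlonglongrightarrow> exit_position B V \<omega>"
      by (simp add: exit_position_def T_def)
  qed
qed

text \<open>A path that stays in \<open>V\<close> has a bounded increment from time 0 to every
  positive integer time \<open>n\<close>, while the density of that increment is at most
  \<open>1 / sqrt (2 * pi * n)\<close> to the power \<open>DIM('a)\<close>. So the probability of
  staying tends to 0.\<close>

lemma AE_exit_time_finite:
  assumes V: "bounded V"
  shows "AE \<omega> in M. exit_time B V \<omega> < \<infinity>"
proof -
  obtain R where R: "\<And>x. x \<in> V \<Longrightarrow> norm x \<le> R" using V by (auto simp: bounded_iff)
  define E where "E n = {\<omega>\<in>space M. norm (B (real (Suc n)) \<omega> - B 0 \<omega>) \<le> R + norm z}" for n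
  have [measurable]: "B (real n) \<in> borel_measurable M" for n by (intro random_variable) simp
  have B0[measurable]: "B 0 \<in> borel_measurable M" by (intro random_variable) simp
  have Em: "E n \<in> sets M" for n unfolding E_def by measurable
  let ?C = "cball (0::'a) (R + norm z)"
  have bound: "emeasure M (E n) \<le> ennreal ((1 / sqrt (2 * pi * real (Suc n))) ^ DIM('a) * measure lborel ?C)" for n
  proof -
    have "emeasure M (E n) = emeasure (distr M borel (\<lambda>\<omega>. B (real (Suc n)) \<omega> - B 0 \<omega>)) ?C"
      by (subst emeasure_distr) (auto simp: E_def intro!: arg_cong2[where f=emeasure] simp del: of_nat_Suc)
    also have "\<dots> = (\<integral>\<^sup>+x. ennreal (gauss_density (real (Suc n)) x) * indicator ?C x \<partial>lborel)"
      by (subst increment_law) (auto simp: emeasure_density)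
    also have "\<dots> \<le> (\<integral>\<^sup>+x. ennreal ((1 / sqrt (2 * pi * real (Suc n))) ^ DIM('a)) * indicator ?C x \<partial>lborel)"
    proof (intro nn_integral_mono mult_right_mono ennreal_leI)
      fix x :: 'a
      have "gauss_density (real (Suc n)) x \<le> (\<Prod>i\<in>(Basis::'a set). 1 / sqrt (2 * pi * real (Suc n)))"
        unfolding gauss_density_def normal_density_def
        by (intro prod_mono) (auto intro!: divide_right_mono simp del: of_nat_Suc)
      then show "gauss_density (real (Suc n)) x \<le> (1 / sqrt (2 * pi * real (Suc n))) ^ DIM('a)" by simp
    qed auto
    also have "\<dots> = ennreal ((1 / sqrt (2 * pi * real (Suc n))) ^ DIM('a)) * emeasure lborel ?C"
      by (subst nn_integral_cmult_indicator) auto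
    also have "emeasure lborel ?C = ennreal (measure lborel ?C)"
      using emeasure_bounded_finite[of ?C] by (intro emeasure_eq_ennreal_measure) auto
    finally show ?thesis by (simp add: ennreal_mult'')
  qed
  have "(\<lambda>n. (1 / sqrt (2 * pi * real (Suc n))) ^ DIM('a) * measure lborel ?C) \<longlonglongrightarrow> 0 ^ DIM('a) * measure lborel ?C"
  proof (intro tendsto_mult tendsto_const tendsto_power)
    have "filterlim (\<lambda>n. sqrt (2 * pi * real (Suc n))) at_top sequentially"
      by (intro filterlim_compose[OF sqrt_at_top] filterlim_tendsto_pos_mult_at_top[OF tendsto_const]
          filterlim_compose[OF filterlim_real_sequentially filterlim_Suc]) auto
    then show "(\<lambda>n. 1 / sqrt (2 * pi * real (Suc n))) \<longlonglongrightarrow> 0"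
      by (intro tendsto_divide_0[OF tendsto_const] filterlim_at_top_imp_at_infinity)
  qed
  then have lim: "(\<lambda>n. ennreal ((1 / sqrt (2 * pi * real (Suc n))) ^ DIM('a) * measure lborel ?C)) \<longlonglongrightarrow> ennreal 0"
    unfolding zero_power[OF DIM_positive[where 'a='a]] mult_zero_left by (rule tendsto_ennrealI)
  have "emeasure M (\<Inter>n. E n) \<le> ennreal 0"
  proof (rule tendsto_lowerbound[OF lim])
    show "\<forall>\<^sub>F n in sequentially. emeasure M (\<Inter>n. E n) \<le> ennreal ((1 / sqrt (2 * pi * real (Suc n))) ^ DIM('a) * measure lborel ?C)"
      using Em by (intro always_eventually allI order_trans[OF emeasure_mono bound]) auto
  qed auto
  then have "(\<Inter>n. E n) \<in> null_sets M" using Em by (intro null_setsI) auto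
  then have "AE \<omega> in M. \<omega> \<notin> (\<Inter>n. E n)" by (rule AE_not_in)
  with start AE_space show ?thesis
  proof eventually_elim
    case (elim \<omega>)
    then obtain n where "R + norm z < norm (B (real (Suc n)) \<omega> - z)" by (auto simp: E_def not_le)
    then have "B (real (Suc n)) \<omega> \<notin> V" using R norm_triangle_ineq4[of "B (real (Suc n)) \<omega>" z] by fastforce
    then have "exit_time B V \<omega> \<le> ereal (real (Suc n))"
      unfolding exit_time_def by (intro INF_lower) auto
    then show ?case by (rule le_less_trans) simp
  qed
qed

text \<open>A path that leaves \<open>V\<close> through a point outside \<open>D\<close> leaves
  \<open>D\<close> at the same moment. This transfers estimates for a truncated domain to the whole
  region.\<close>

lemma exit_position_superset:
  assumes \<omega>: "\<omega> \<in> space M" "B 0 \<omega> = z" and V: "open V" "z \<in> V" "V \<subseteq> D"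
    and fin: "exit_time B V \<omega> < \<infinity>" and out: "exit_position B V \<omega> \<notin> D"
  shows "exit_position B D \<omega> = exit_position B V \<omega>"
proof -
  have b: "continuous_on {0..} (\<lambda>t. B t \<omega>)" using continuous_paths \<omega> by auto
  define T where "T = real_of_ereal (exit_time B V \<omega>)"
  have T: "exit_time B V \<omega> = ereal T" "0 < T"
    using exit_time_finite[OF b V(1) _ fin] \<omega> V unfolding T_def by auto
  have "exit_time B D \<omega> \<le> ereal T"
    unfolding exit_time_def using T out by (intro INF_lower) (auto simp: exit_position_def)
  moreover have "exit_time B V \<omega> \<le> exit_time B D \<omega>"
    unfolding exit_time_def using V(3) by (intro INF_superset_mono) auto
  ultimately have "exit_time B D \<omega> = exit_time B V \<omega>" using T by simp
  then show ?thesis by (simp add: exit_position_def)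
qed

end

section \<open>The lower bound for the tail\<close>

lemma radial_profile_le_1:
  assumes d: "0 < d" and pos: "\<And>r. 0 \<le> r \<Longrightarrow> r < l \<Longrightarrow> 0 < radial_profile d r" and s: "0 \<le> s" "s \<le> l"
  shows "radial_profile d s \<le> 1"
proof (cases "s = 0")
  case False
  with s have "0 < s" by simp
  have "radial_profile d s < radial_profile d 0"
  proof (rule DERIV_neg_imp_decreasing_open[OF \<open>0 < s\<close>])
    fix x assume x: "0 < x" "x < s"
    have "radial_profile' d x < 0" using x s by (intro radial_profile'_neg[OF d] pos) auto
    then show "\<exists>y. DERIV (radial_profile d) x :> y \<and> y < 0" using DERIV_radial_profile[OF d] by blast
  qed (intro continuous_on_radial_profile[OF d] continuous_intros)
  then show ?thesis by simp
qed simp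

text \<open>The profile and its derivative do not vanish simultaneously.\<close>

lemma radial_profile_minus_derivative_bound:
  assumes d: "0 < d" and l: "0 < l" "\<And>s. 0 \<le> s \<Longrightarrow> s < l \<Longrightarrow> 0 < radial_profile d s" "radial_profile d l = 0"
  obtains \<kappa> where "0 < \<kappa>" "\<And>s. 0 \<le> s \<Longrightarrow> s \<le> l \<Longrightarrow> \<kappa> \<le> radial_profile d s - s * radial_profile' d s"
proof -
  let ?f = "\<lambda>s. radial_profile d s - s * radial_profile' d s"
  have neg: "radial_profile' d s < 0" if "0 < s" "s \<le> l" for s
    using that by (intro radial_profile'_neg[OF d] l) auto
  have pos: "0 < ?f s" if s: "0 \<le> s" "s \<le> l" for s
  proof (cases "s = 0 \<or> s = l")
    case True
    then show ?thesis using neg[of l] l by (auto simp: mult_less_0_iff)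
  next
    case False
    then have "0 < radial_profile d s" "s * radial_profile' d s < 0"
      using s l neg[of s] by (auto simp: mult_less_0_iff)
    then show ?thesis by linarith
  qed
  have "continuous_on {0..l} ?f"
    by (intro continuous_at_imp_continuous_on ballI continuous_intros
        DERIV_isCont[OF DERIV_radial_profile'[OF d]] DERIV_isCont[OF DERIV_radial_profile[OF d]])
  moreover have "{0..l} \<noteq> {}" using l by simp
  ultimately have "\<exists>s\<in>{0..l}. \<forall>r\<in>{0..l}. ?f s \<le> ?f r"
    by (intro continuous_attains_inf[OF compact_Icc])
  then obtain s where s: "s \<in> {0..l}" "\<forall>r\<in>{0..l}. ?f s \<le> ?f r" by blast
  show ?thesis
    by (rule that[of "?f s"]) (use s pos in auto)
qed

text \<open>The logarithm contributes the factor \<open>x powr N\<close> to the subsolution; for large \<open>N\<close> its curvature beats all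
  error terms uniformly in \<open>x > 0\<close>.\<close>

lemma parabola_subsolution:
  fixes \<alpha> A l :: real
  assumes \<alpha>: "0 < \<alpha>" "\<alpha> < 1" and A: "0 < A"
    and l: "0 < l" "\<And>s. 0 \<le> s \<Longrightarrow> s < l \<Longrightarrow> 0 < radial_profile DIM('a::euclidean_space) s"
      "radial_profile DIM('a) l = 0"
  shows "\<exists>N>0. \<forall>b. \<forall>p\<in>parabola_region \<alpha> A. superharmonic_near
     (\<lambda>p::real \<times> 'a. b - exp (sqrt l / (A * (1 - \<alpha>)) * fst p powr (1 - \<alpha>) + N * ln (fst p)) *
        radial_profile DIM('a) (l / A\<^sup>2 * fst p powr (- 2 * \<alpha>) * (snd p \<bullet> snd p))) p"
proof -
  have d: "0 < DIM('a)" by simp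
  define m where "m = l / A\<^sup>2"
  define c where "c = sqrt l / A"
  have m: "0 < m" and c: "0 < c" and cm: "c\<^sup>2 = m" using l A by (auto simp: m_def c_def power_divide)
  obtain \<kappa> where \<kappa>: "0 < \<kappa>" "\<And>s. 0 \<le> s \<Longrightarrow> s \<le> l \<Longrightarrow> \<kappa> \<le> radial_profile DIM('a) s - s * radial_profile' DIM('a) s"
    using radial_profile_minus_derivative_bound[OF d l] by blast
  obtain C where C: "0 < C" "\<And>s. 0 \<le> s \<Longrightarrow> s \<le> l \<Longrightarrow> \<bar>s * radial_profile' DIM('a) s\<bar> \<le> C"
    "\<And>s. 0 \<le> s \<Longrightarrow> s \<le> l \<Longrightarrow> \<bar>s\<^sup>2 * radial_profile'' DIM('a) s\<bar> \<le> C"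
    using radial_bounds[OF d, of l] by blast
  define K where "K = 2 * \<alpha> * (2 * \<alpha> + 1) * C + 4 * \<alpha>\<^sup>2 * C"
  \<comment> \<open>Bounds the combination \<open>P + 4 * \<alpha> * (- P1)\<close>, which the
    computation produces, below by a multiple of \<open>P - P1\<close>, hence of
    \<open>\<kappa>\<close>.\<close>
  define \<beta> where "\<beta> = min 1 (4 * \<alpha>)"
  have \<beta>: "0 < \<beta>" "\<beta> \<le> 1" "\<beta> \<le> 4 * \<alpha>" using \<alpha> by (auto simp: \<beta>_def)
  \<comment> \<open>At least 2, so that \<open>N^2 - N\<close> is at least \<open>N\<close>, and so
    large that \<open>N * (\<beta> * \<kappa>)\<close> exceeds the error constant
    \<open>K\<close>.\<close>
  define N where "N = max 2 ((K + 1) / (\<beta> * \<kappa>))"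
  have N: "2 \<le> N" "K < N * (\<beta> * \<kappa>)"
  proof -
    show "2 \<le> N" by (simp add: N_def)
    have "(K + 1) / (\<beta> * \<kappa>) \<le> N" by (simp add: N_def)
    then have "K + 1 \<le> N * (\<beta> * \<kappa>)" using \<beta> \<kappa> by (simp add: pos_divide_le_eq)
    then show "K < N * (\<beta> * \<kappa>)" by simp
  qed
  \<comment> \<open>The terms \<open>x + 0\<close> match the shift of the general barrier lemma at
    \<open>L = 0\<close>.\<close>
  define G where "G x = sqrt l / (A * (1 - \<alpha>)) * (x + 0) powr (1 - \<alpha>) + N * ln x" for x
  define G1 where "G1 x = c * (x + 0) powr (- \<alpha>) + N / x" for x
  define G2 where "G2 x = - \<alpha> * c * (x + 0) powr (- \<alpha> - 1) - N / x\<^sup>2" for x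
  have "superharmonic_near (\<lambda>p. (- 1) * (exp (G (fst p)) *
      radial_profile DIM('a) (m * (fst p + 0) powr (- 2 * \<alpha>) * (snd p \<bullet> snd p))) + b) p"
    if "p \<in> parabola_region \<alpha> A" for b and p :: "real \<times> 'a"
  proof (rule barrier_superharmonic_near[where ?G1.0=G1 and ?G2.0=G2])
    have p: "0 < fst p" "norm (snd p) < A * fst p powr \<alpha>" using that by (auto simp: parabola_region_def)
    define X where "X = fst p"
    have X: "0 < X" using p by (simp add: X_def)
    show "- 0 < fst p" using p by simp
    show "DERIV G x :> G1 x" if "- 0 < x" for x
      unfolding G_def G1_def
    proof (rule DERIV_add)
      show "DERIV (\<lambda>x. sqrt l / (A * (1 - \<alpha>)) * (x + 0) powr (1 - \<alpha>)) x :> c * (x + 0) powr (- \<alpha>)"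
        by (rule DERIV_cong[OF DERIV_shifted_powr]) (use that \<alpha> in \<open>simp_all add: c_def\<close>)
      show "DERIV (\<lambda>x. N * ln x) x :> N / x" using that by (auto intro!: derivative_eq_intros)
    qed
    show "DERIV G1 x :> G2 x" if "- 0 < x" for x
      unfolding G1_def G2_def diff_conv_add_uminus
    proof (rule DERIV_add)
      show "DERIV (\<lambda>x. c * (x + 0) powr (- \<alpha>)) x :> - \<alpha> * c * (x + 0) powr (- \<alpha> + - 1)"
        by (rule DERIV_cong[OF DERIV_shifted_powr]) (use that in simp_all)
      show "DERIV (\<lambda>x. N / x) x :> - (N / x\<^sup>2)" using that by (auto intro!: derivative_eq_intros simp: power2_eq_square)
    qed
    show "isCont G2 x" if "- 0 < x" for x
      using that unfolding G2_def by (intro continuous_intros) auto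
    define \<sigma> where "\<sigma> = m * X powr (- 2 * \<alpha>) * (snd p \<bullet> snd p)"
    have s: "0 \<le> \<sigma>" "\<sigma> \<le> l"
      unfolding \<sigma>_def m_def using parabola_similarity_bounds[OF X A, of l "snd p" \<alpha>] l p by (auto simp: X_def)
    define P P1 P2 where "P = radial_profile DIM('a) \<sigma>" and "P1 = \<sigma> * radial_profile' DIM('a) \<sigma>"
        and "P2 = \<sigma>\<^sup>2 * radial_profile'' DIM('a) \<sigma>"
    have P: "\<kappa> \<le> P - P1" "\<bar>P1\<bar> \<le> C" "\<bar>P2\<bar> \<le> C" using \<kappa>(2)[OF s] C(2,3)[OF s] by (auto simp: P_def P1_def P2_def)
    have P0: "0 \<le> P" using l(2)[of \<sigma>] l(3) s unfolding P_def by (cases "\<sigma> = l") (auto simp: less_imp_le)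
    have P10: "P1 \<le> 0"
    proof (cases "\<sigma> = 0")
      case False
      then have "radial_profile' DIM('a) \<sigma> < 0" using s by (intro radial_profile'_neg[OF d] l) auto
      then show ?thesis using s by (simp add: P1_def mult_nonneg_nonpos)
    qed (simp add: P1_def)
    define w where "w = X powr (- \<alpha> - 1)"
    have w: "0 < w" using X by (simp add: w_def)
    have xa: "X powr (- \<alpha>) / X = w" using X by (simp add: w_def powr_diff)
    have G1e: "G1 X = c * X powr (- \<alpha>) + N / X" and G2e: "G2 X = - \<alpha> * c * w - N / X\<^sup>2"
      by (simp_all add: G1_def G2_def w_def)
    have "(G1 X)\<^sup>2 = c\<^sup>2 * (X powr (- \<alpha>))\<^sup>2 + 2 * N * c * (X powr (- \<alpha>) / X) + N\<^sup>2 / X\<^sup>2"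
      unfolding G1e by (simp add: power2_sum power_mult_distrib power_divide)
    also have "\<dots> = m * X powr (- 2 * \<alpha>) + 2 * N * c * w + N\<^sup>2 / X\<^sup>2"
      unfolding xa cm powr_square by simp
    finally have G1s: "(G1 X)\<^sup>2 = m * X powr (- 2 * \<alpha>) + 2 * N * c * w + N\<^sup>2 / X\<^sup>2" .
    \<comment> \<open>Since \<open>c^2 = m\<close> at the critical constant, the terms of order
      \<open>X powr (- 2 * \<alpha>)\<close> cancel. What remains is at least
      \<open>N / X^2\<close>, the scale of the error terms at every \<open>X\<close>, large or
      small.\<close>
    have "G2 X + (G1 X)\<^sup>2 - m * X powr (- 2 * \<alpha>) = (2 * N - \<alpha>) * (c * w) + (N\<^sup>2 - N) / X\<^sup>2"
      unfolding G1s G2e by (simp add: algebra_simps diff_divide_distrib)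
    moreover have "0 \<le> (2 * N - \<alpha>) * (c * w)" using N \<alpha> c w by simp
    moreover have "N / X\<^sup>2 \<le> (N\<^sup>2 - N) / X\<^sup>2"
    proof -
      have "2 * N \<le> N * N" using N by (intro mult_right_mono) auto
      then show ?thesis by (intro divide_right_mono) (auto simp: power2_eq_square)
    qed
    ultimately have "N / X\<^sup>2 \<le> G2 X + (G1 X)\<^sup>2 - m * X powr (- 2 * \<alpha>)" by linarith
    then have "N / X\<^sup>2 * P \<le> (G2 X + (G1 X)\<^sup>2 - m * X powr (- 2 * \<alpha>)) * P" using P0 by (rule mult_right_mono)
    then have 1: "N * P / X\<^sup>2 \<le> (G2 X + (G1 X)\<^sup>2 - m * X powr (- 2 * \<alpha>)) * P" by simp
    \<comment> \<open>Where the profile vanishes, positivity comes from the cross term: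
      \<open>- P1\<close> is nonnegative and \<open>G1 X / X\<close> inherits \<open>N / X^2\<close>
      from the logarithm.\<close>
    have "N / X\<^sup>2 \<le> G1 X / X"
    proof -
      have "0 \<le> c * (X powr (- \<alpha>) / X)" using c X by simp
      then show ?thesis unfolding G1e by (simp add: add_divide_distrib power2_eq_square)
    qed
    then have "4 * \<alpha> * (- P1) * (N / X\<^sup>2) \<le> 4 * \<alpha> * (- P1) * (G1 X / X)"
      using P10 \<alpha> by (intro mult_left_mono mult_nonneg_nonneg) auto
    then have 2: "4 * \<alpha> * N * (- P1) / X\<^sup>2 \<le> - (4 * \<alpha> * G1 X * P1 / X)" by (simp add: mult_ac)
    have bound: "- (k * C / X\<^sup>2) \<le> k * Q / X\<^sup>2" if "0 \<le> k" "\<bar>Q\<bar> \<le> C" for k Q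
    proof -
      have "- (k * C) \<le> k * Q" using mult_left_mono[of "- C" Q k] that by auto
      then have "- (k * C) / X\<^sup>2 \<le> k * Q / X\<^sup>2" by (intro divide_right_mono) auto
      then show ?thesis by simp
    qed
    have 3: "- (2 * \<alpha> * (2 * \<alpha> + 1) * C / X\<^sup>2) \<le> 2 * \<alpha> * (2 * \<alpha> + 1) * P1 / X\<^sup>2"
      and 4: "- (4 * \<alpha>\<^sup>2 * C / X\<^sup>2) \<le> 4 * \<alpha>\<^sup>2 * P2 / X\<^sup>2"
      using P \<alpha> by (auto intro!: bound)
    have "N * (\<beta> * \<kappa>) \<le> N * (P + 4 * \<alpha> * (- P1))"
    proof (intro mult_left_mono)
      have "\<beta> * \<kappa> \<le> \<beta> * (P - P1)" using P \<beta> by (intro mult_left_mono) auto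
      also have "\<dots> = \<beta> * P + \<beta> * (- P1)" by (simp add: algebra_simps)
      also have "\<dots> \<le> 1 * P + 4 * \<alpha> * (- P1)" using \<beta> P0 P10 by (intro add_mono mult_right_mono) auto
      finally show "\<beta> * \<kappa> \<le> P + 4 * \<alpha> * (- P1)" by simp
    qed (use N in simp)
    then have "K < N * P + 4 * \<alpha> * N * (- P1)" using N(2) by (simp add: algebra_simps)
    then have "K / X\<^sup>2 < (N * P + 4 * \<alpha> * N * (- P1)) / X\<^sup>2" using X by (intro divide_strict_right_mono) auto
    then have "K / X\<^sup>2 < N * P / X\<^sup>2 + 4 * \<alpha> * N * (- P1) / X\<^sup>2" by (simp only: add_divide_distrib)
    moreover have "K / X\<^sup>2 = 2 * \<alpha> * (2 * \<alpha> + 1) * C / X\<^sup>2 + 4 * \<alpha>\<^sup>2 * C / X\<^sup>2"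
      by (simp only: K_def add_divide_distrib)
    ultimately have "0 < (G2 X + (G1 X)\<^sup>2 - m * X powr (- 2 * \<alpha>)) * P - 4 * \<alpha> * G1 X * P1 / X
          + 2 * \<alpha> * (2 * \<alpha> + 1) * P1 / X\<^sup>2 + 4 * \<alpha>\<^sup>2 * P2 / X\<^sup>2"
      using 1 2 3 4 by linarith
    then show "let X = fst p + 0; \<mu> = m * X powr (- 2 * \<alpha>) in
        (- 1) * barrier_laplacian DIM('a) \<alpha> X \<mu> (\<mu> * (snd p \<bullet> snd p)) (G1 (fst p)) (G2 (fst p)) < 0"
      unfolding Let_def barrier_laplacian_def P_def P1_def P2_def X_def \<sigma>_def by simp
  qed
  then show ?thesis using N by (intro exI[of _ N]) (simp add: G_def m_def)
qed

text \<open>Since \<open>|Y|^2\<close> is subtracted with weight 2, the Laplacian is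
  \<open>k * (2 - 4 * DIM('a))\<close>, negative in every dimension.\<close>

lemma slab_barrier_superharmonic_near:
  fixes p :: "real \<times> 'a::euclidean_space"
  assumes "0 < k"
  shows "superharmonic_near (\<lambda>p. k * ((fst p - a)\<^sup>2 + 2 * (c - snd p \<bullet> snd p))) p"
proof -
  have "superharmonic_near (\<lambda>p. (\<lambda>q. k * ((fst q - a)\<^sup>2 + 2 * (c - snd q))) (fst p, snd p \<bullet> snd p)) p"
  proof (rule axial_superharmonic_near[OF open_UNIV UNIV_I])
    show "((\<lambda>q. k * ((fst q - a)\<^sup>2 + 2 * (c - snd q))) has_derivative (\<lambda>v. (2 * k * (fst q - a)) * fst v + (- 2 * k) * snd v)) (at q)"
      for q :: "real \<times> real"
      by (auto intro!: derivative_eq_intros simp: fun_eq_iff algebra_simps)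
    show "((\<lambda>q. 2 * k * (fst q - a)) has_derivative (\<lambda>v. 2 * k * fst v + 0 * snd v)) (at q)" for q :: "real \<times> real"
      by (auto intro!: derivative_eq_intros)
    show "((\<lambda>q. - 2 * k) has_derivative (\<lambda>v. 0 * fst v + 0 * snd v)) (at q)" for q :: "real \<times> real"
      by (auto intro!: derivative_eq_intros)
    have "k * 1 < k * (2 * real DIM('a))"
    proof (rule mult_strict_left_mono)
      have "1 \<le> real DIM('a)" using DIM_positive[where 'a='a] by linarith
      then show "1 < 2 * real DIM('a)" by linarith
    qed (rule assms)
    then show "let q = (fst p, snd p \<bullet> snd p) in 2 * k + 4 * snd q * 0 + real (2 * DIM('a)) * (- 2 * k) < 0"
      by (simp add: Let_def)
  qed (auto intro: continuous_intros)
  then show ?thesis by simp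
qed

text \<open>Call an exit from the truncated region \<open>V\<close> good if it is lateral and beyond
  \<open>t\<close>. The barrier \<open>h\<close> is nonnegative, at least \<open>q\<close> at every
  other exit, and \<open>K - w z\<close> at the start, so \<open>q\<close> times the probability of
  a bad exit is at most \<open>K - w z\<close>; the rest has probability at least a constant over
  \<open>exp (G t1)\<close>. The quadratic penalises the artificial cap \<open>fst p = t2\<close>,
  which is no exit from the whole region.\<close>

theorem parabola_exit_tail_lower:
  fixes B :: "real \<Rightarrow> 'w \<Rightarrow> real \<times> 'a::euclidean_space" and \<alpha> A l \<epsilon> :: real
  assumes \<alpha>: "0 < \<alpha>" "\<alpha> < 1" and A: "0 < A"
    and l: "0 < l" "\<And>s. 0 \<le> s \<Longrightarrow> s < l \<Longrightarrow> 0 < radial_profile DIM('a) s" "radial_profile DIM('a) l = 0"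
    and z: "z \<in> parabola_region \<alpha> A" and B: "brownian_motion M B z" and \<epsilon>: "0 < \<epsilon>"
  shows "\<exists>k>0. \<exists>N t0. \<forall>t\<ge>t0.
    k * exp (- (sqrt l / (A * (1 - \<alpha>)) * ((1 + \<epsilon>) * t) powr (1 - \<alpha>) + N * ln ((1 + \<epsilon>) * t)))
      \<le> measure M {\<omega> \<in> space M. t < norm (exit_position B (parabola_region \<alpha> A) \<omega>)}"
proof -
  interpret brownian_motion M B z by fact
  have d: "0 < DIM('a)" by simp
  let ?D = "parabola_region \<alpha> A :: (real \<times> 'a) set"
  define c where "c = sqrt l / (A * (1 - \<alpha>))"
  have c: "0 < c" using l A \<alpha> by (simp add: c_def)
  obtain N where N: "0 < N" "\<forall>b. \<forall>p\<in>?D. superharmonic_near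
     (\<lambda>p::real \<times> 'a. b - exp (c * fst p powr (1 - \<alpha>) + N * ln (fst p)) *
        radial_profile DIM('a) (l / A\<^sup>2 * fst p powr (- 2 * \<alpha>) * (snd p \<bullet> snd p))) p"
    using parabola_subsolution[OF \<alpha> A l] unfolding c_def by blast
  define G where "G x = c * x powr (1 - \<alpha>) + N * ln x" for x
  define \<sigma> where "\<sigma> p = l / A\<^sup>2 * fst p powr (- 2 * \<alpha>) * (snd p \<bullet> snd p)" for p :: "real \<times> 'a"
  define w where "w p = exp (G (fst p)) * radial_profile DIM('a) (\<sigma> p)" for p
  have G_mono: "G x \<le> G y" if "0 < x" "x \<le> y" for x y
    unfolding G_def using that c N \<alpha> by (intro add_mono mult_left_mono powr_mono2) auto
  have \<sigma>: "\<sigma> p = l * (norm (snd p) / (A * fst p powr \<alpha>))\<^sup>2" if "0 < fst p" for p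
    unfolding \<sigma>_def using parabola_similarity_variable[OF that A] .
  have \<sigma>_le: "0 \<le> \<sigma> p" "\<sigma> p \<le> l" if "0 < fst p" "norm (snd p) \<le> A * fst p powr \<alpha>" for p
    unfolding \<sigma>_def using parabola_similarity_bounds[OF that(1) A _ that(2)] l by auto
  have \<sigma>_less: "\<sigma> p < l" if p: "p \<in> ?D" for p
  proof -
    have p': "0 < fst p" "norm (snd p) < A * fst p powr \<alpha>" using p by (auto simp: parabola_region_def)
    have "norm (snd p) / (A * fst p powr \<alpha>) < 1" using p' A by simp
    then have "(norm (snd p) / (A * fst p powr \<alpha>))\<^sup>2 < 1" using A by (intro power_less_one_iff[THEN iffD2]) auto
    then show ?thesis unfolding \<sigma>[OF p'(1)] using l by simp
  qed
  have w_pos: "0 < w p" if "p \<in> ?D" for p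
    unfolding w_def using that \<sigma>_less[OF that] \<sigma>_le(1)[of p]
    by (intro mult_pos_pos l) (auto simp: parabola_region_def)
  have w_bounds: "0 \<le> w p" "w p \<le> exp (G (fst p))" if p: "0 < fst p" "norm (snd p) \<le> A * fst p powr \<alpha>" for p
  proof -
    have "0 \<le> radial_profile DIM('a) (\<sigma> p)"
      using \<sigma>_le[OF p] l(2)[of "\<sigma> p"] l(3) by (cases "\<sigma> p = l") (auto simp: less_imp_le)
    then show "0 \<le> w p" by (simp add: w_def)
    have "radial_profile DIM('a) (\<sigma> p) \<le> 1" using \<sigma>_le[OF p] by (intro radial_profile_le_1[OF d l(2)]) auto
    then show "w p \<le> exp (G (fst p))" by (simp add: w_def)
  qed
  have zx: "0 < fst z" using z by (auto simp: parabola_region_def)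
  \<comment> \<open>The value of \<open>w\<close> on the left cap must stay below
    \<open>w z\<close>. There \<open>w\<close> is at most \<open>exp (G x)\<close>, which tends to 0
    at the tip because of the factor \<open>x powr N\<close>.\<close>
  obtain xb where xb: "0 < xb" "xb < fst z" "exp (G xb) < w z"
  proof -
    define K where "K = exp (c * fst z powr (1 - \<alpha>))"
    \<comment> \<open>The second entry solves \<open>K * x powr N = w z / 2\<close>.\<close>
    define x where "x = min (fst z / 2) ((w z / (2 * K)) powr (1 / N))"
    have K: "0 < K" by (simp add: K_def)
    have q: "0 < w z / (2 * K)" using w_pos[OF z] K by simp
    then have x: "0 < x" "x < fst z" using zx by (auto simp: x_def)
    have "x powr N \<le> ((w z / (2 * K)) powr (1 / N)) powr N" using x N by (intro powr_mono2) (auto simp: x_def)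
    also have "\<dots> = w z / (2 * K)" using w_pos[OF z] K N(1) by (simp add: powr_powr)
    finally have 1: "x powr N \<le> w z / (2 * K)" .
    have "exp (G x) = exp (c * x powr (1 - \<alpha>)) * x powr N" using x by (simp add: G_def exp_add powr_def)
    also have "\<dots> \<le> K * (w z / (2 * K))"
      using x c \<alpha> 1 unfolding K_def by (intro mult_mono) (auto intro!: mult_left_mono powr_mono2)
    also have "\<dots> < w z" using K w_pos[OF z] by simp
    finally show ?thesis using that[of x] x by blast
  qed
  define k where "k = (w z - exp (G xb)) / 3"
  have k: "0 < k" using xb by (simp add: k_def)
  have "((\<lambda>t. t powr (\<alpha> - 1)) \<longlongrightarrow> 0) at_top"
    using \<alpha> by (intro tendsto_neg_powr filterlim_ident) auto
  then have "\<forall>\<^sub>F t in at_top. 2 * A * (1 + 2 * \<epsilon>) powr \<alpha> * t powr (\<alpha> - 1) < \<epsilon>"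
    using \<epsilon> by (intro order_tendstoD(2)[OF tendsto_mult_right_zero])
  then have "\<forall>\<^sub>F t in at_top. 2 * A * (1 + 2 * \<epsilon>) powr \<alpha> * t powr (\<alpha> - 1) < \<epsilon> \<and> fst z < t"
    using eventually_gt_at_top[of "fst z"] by eventually_elim auto
  \<comment> \<open>Beyond \<open>t0\<close> the radius of the cross section at \<open>t2\<close> is
    at most half of \<open>a\<close>, the half-width of the slab, and \<open>z\<close> lies to the
    left of \<open>t\<close>.\<close>
  then obtain t0 where t0: "\<And>t. t0 \<le> t \<Longrightarrow> 2 * A * (1 + 2 * \<epsilon>) powr \<alpha> * t powr (\<alpha> - 1) < \<epsilon> \<and> fst z < t"
    by (auto simp: eventually_at_top_linorder)
  have "k * exp (- G ((1 + \<epsilon>) * t)) \<le> prob {\<omega> \<in> space M. t < norm (exit_position B ?D \<omega>)}" if "t0 \<le> t" for t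
  proof -
    have tz: "fst z < t" and t: "0 < t" using t0[OF that] zx by auto
    define a where "a = \<epsilon> * t"
    define t1 where "t1 = t + a"
    define t2 where "t2 = t + 2 * a"
    define r where "r = A * t2 powr \<alpha>"
    have a: "0 < a" using \<epsilon> t by (simp add: a_def)
    have tt: "t < t1" "t1 < t2" "0 < t1" using a t by (auto simp: t1_def t2_def)
    have r: "0 \<le> r" "2 * r \<le> a"
    proof -
      show "0 \<le> r" using A by (simp add: r_def)
      have "t2 = (1 + 2 * \<epsilon>) * t" by (simp add: t2_def a_def algebra_simps)
      then have "t2 powr \<alpha> = (1 + 2 * \<epsilon>) powr \<alpha> * t powr \<alpha>" by (simp add: powr_mult)
      also have "t powr \<alpha> = t powr (\<alpha> - 1) * t" using t by (simp add: powr_diff)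
      finally have "2 * r = (2 * A * (1 + 2 * \<epsilon>) powr \<alpha> * t powr (\<alpha> - 1)) * t" by (simp add: r_def)
      also have "\<dots> \<le> \<epsilon> * t" using t0[OF that] t by (intro mult_right_mono) auto
      finally show "2 * r \<le> a" by (simp add: a_def)
    qed
    \<comment> \<open>The factor 3 brings the quadratic below \<open>K - w\<close> at the midpoint
      \<open>t1\<close>: there \<open>h2\<close> is at most \<open>K / 2\<close>, while
      \<open>K - w\<close> is at least two thirds of \<open>K\<close>.\<close>
    define K where "K = 3 * exp (G t1)"
    have K: "0 < K" by (simp add: K_def)
    define h1 where "h1 p = K - w p" for p
    define h2 where "h2 p = K / a\<^sup>2 * ((fst p - t1)\<^sup>2 + 2 * (r\<^sup>2 - snd p \<bullet> snd p))" for p :: "real \<times> 'a"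
    \<comment> \<open>At \<open>fst p = t\<close> the quadratic is at least \<open>K\<close>, so the
      minimum is \<open>h1\<close>; at \<open>fst p = t1\<close> it is below \<open>h1\<close>. The
      pieces therefore fit together continuously.\<close>
    define h where "h p = (if fst p \<le> t then h1 p else if fst p \<le> t1 then min (h1 p) (h2 p) else h2 p)" for p
    define V where "V = ?D \<inter> {p. xb < fst p \<and> fst p < t2}"
    define Q where "Q = {p :: real \<times> 'a. xb \<le> fst p \<and> fst p \<le> t2 \<and> norm (snd p) \<le> A * fst p powr \<alpha>}"
    have V: "open V" unfolding V_def
      by (intro open_Int open_parabola_region open_Collect_conj open_Collect_less continuous_intros)
    have zV: "z \<in> V" using z xb tz tt by (simp add: V_def)
    have VQ: "V \<subseteq> Q" by (auto simp: V_def Q_def parabola_region_def)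
    have cVQ: "closure V \<subseteq> Q"
    proof -
      have "closure V \<subseteq> {p. xb \<le> fst p \<and> fst p \<le> t2}"
        by (intro closure_minimal closed_Collect_conj closed_Collect_le continuous_intros) (auto simp: V_def)
      moreover have "closure V \<subseteq> closure ?D" by (intro closure_mono) (auto simp: V_def)
      ultimately show ?thesis using closure_parabola_region[OF \<alpha>(1)] unfolding Q_def by blast
    qed
    have Qx: "0 < fst p" if "p \<in> Q" for p using that xb by (auto simp: Q_def)
    have Qw: "0 \<le> w p" "w p \<le> exp (G (fst p))" if "p \<in> Q" for p
      using w_bounds[OF Qx[OF that]] that by (auto simp: Q_def)
    have Qr: "norm (snd p) \<le> r" "snd p \<bullet> snd p \<le> r\<^sup>2" if "p \<in> Q" for p
    proof -
      have "A * fst p powr \<alpha> \<le> r"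
        using that Qx[OF that] A \<alpha> unfolding r_def Q_def by (intro mult_left_mono powr_mono2) auto
      then show "norm (snd p) \<le> r" using that by (simp add: Q_def)
      then show "snd p \<bullet> snd p \<le> r\<^sup>2" by (simp add: power_mono flip: power2_norm_eq_inner)
    qed
    have h2_0: "0 \<le> h2 p" if "p \<in> Q" for p
      unfolding h2_def using Qr(2)[OF that] K by (intro mult_nonneg_nonneg add_nonneg_nonneg) auto
    have h2_far: "K \<le> h2 p" if "p \<in> Q" "a \<le> \<bar>fst p - t1\<bar>" for p
    proof -
      have "a\<^sup>2 \<le> (fst p - t1)\<^sup>2" using that a by (simp add: abs_le_square_iff[symmetric])
      also have "\<dots> \<le> (fst p - t1)\<^sup>2 + 2 * (r\<^sup>2 - snd p \<bullet> snd p)" using Qr(2)[OF that(1)] by simp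
      finally have "K / a\<^sup>2 * a\<^sup>2 \<le> h2 p" unfolding h2_def using K by (intro mult_left_mono) auto
      then show ?thesis using a by simp
    qed
    have h12: "h2 p < h1 p" if "p \<in> Q" "fst p = t1" for p
    proof -
      have "(2 * r)\<^sup>2 \<le> a\<^sup>2" using r by (intro power_mono) auto
      then have r2: "4 * r\<^sup>2 \<le> a\<^sup>2" by (simp add: power_mult_distrib)
      have r3: "0\<^sup>2 + 2 * (r\<^sup>2 - snd p \<bullet> snd p) \<le> a\<^sup>2 / 2"
      proof -
        have "4 * r\<^sup>2 - 4 * (snd p \<bullet> snd p) \<le> a\<^sup>2" using r2 inner_ge_zero[of "snd p"] by linarith
        then show ?thesis by simp
      qed
      have "h2 p \<le> K / a\<^sup>2 * (a\<^sup>2 / 2)"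
        unfolding h2_def that(2) diff_self using r3 K by (intro mult_left_mono) auto
      also have "\<dots> < K - exp (G t1)" using a by (simp add: K_def)
      also have "\<dots> \<le> h1 p" using Qw(2)[OF that(1)] that(2) by (simp add: h1_def)
      finally show ?thesis .
    qed
    have h1_0: "0 \<le> h1 p" if "p \<in> Q" "fst p \<le> t1" for p
    proof -
      have "w p \<le> exp (G t1)" using Qw(2)[OF that(1)] G_mono[OF Qx[OF that(1)] that(2)] by (meson exp_le_cancel_iff order_trans)
      moreover have "0 \<le> exp (G t1)" by simp
      ultimately show ?thesis unfolding h1_def K_def by linarith
    qed
    have cont1: "continuous_on Q h1"
      unfolding h1_def w_def G_def \<sigma>_def using Qx
      by (intro continuous_intros continuous_on_radial_profile[OF d]) force+
    have cont2: "continuous_on Q h2" unfolding h2_def by (intro continuous_intros)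
    have cont: "continuous_on Q h"
      unfolding h_def
    proof (intro continuous_on_cases_le)
      show "continuous_on {p \<in> Q. fst p \<le> t} h1" by (rule continuous_on_subset[OF cont1]) auto
      show "continuous_on {p \<in> {p \<in> Q. t \<le> fst p}. fst p \<le> t1} (\<lambda>p. min (h1 p) (h2 p))"
        by (intro continuous_intros continuous_on_subset[OF cont1] continuous_on_subset[OF cont2]) auto
      show "continuous_on {p \<in> {p \<in> Q. t \<le> fst p}. t1 \<le> fst p} h2" by (rule continuous_on_subset[OF cont2]) auto
      show "min (h1 p) (h2 p) = h2 p" if "p \<in> {p \<in> Q. t \<le> fst p}" "fst p = t1" for p
        using h12[of p] that by auto
      show "h1 p = (if fst p \<le> t1 then min (h1 p) (h2 p) else h2 p)" if "p \<in> Q" "fst p = t" for p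
        using h2_far[of p] Qw(1)[of p] that tt a by (simp add: h1_def t1_def)
    qed (intro continuous_intros)+
    have near1: "superharmonic_near h1 p" if "p \<in> V" for p
      using N(2) that unfolding h1_def[abs_def] w_def G_def \<sigma>_def V_def by blast
    have near2: "superharmonic_near h2 p" for p
      unfolding h2_def[abs_def] using K a by (intro slab_barrier_superharmonic_near) simp
    have near: "superharmonic_near h p" if p: "p \<in> V" for p
    proof -
      have isc: "isCont h1 p" "isCont h2 p"
        using cont1 cont2 VQ V p by (meson continuous_on_eq_continuous_at continuous_on_subset)+
      have ev_fst: "\<forall>\<^sub>F q in nhds p. fst q < s" if "fst p < s" for s
        by (intro eventually_nhds_in_open[of "{q. fst q < s}", simplified] open_Collect_less continuous_intros that)
      have ev_fst': "\<forall>\<^sub>F q in nhds p. s < fst q" if "s < fst p" for s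
        by (intro eventually_nhds_in_open[of "{q. s < fst q}", simplified] open_Collect_less continuous_intros that)
      have tend: "(h1 \<longlongrightarrow> h1 p) (nhds p)" "(h2 \<longlongrightarrow> h2 p) (nhds p)" using isc
        by (simp_all add: isCont_def tendsto_at_iff_tendsto_nhds)
      have ev_lt: "\<forall>\<^sub>F q in nhds p. f q < g q"
        if fg: "(f \<longlongrightarrow> f p) (nhds p)" "(g \<longlongrightarrow> g p) (nhds p)" "f p < g p" for f g :: "real \<times> 'a \<Rightarrow> real"
      proof -
        obtain s where s: "f p < s" "s < g p" using dense[OF fg(3)] by blast
        show ?thesis using order_tendstoD(2)[OF fg(1) s(1)] order_tendstoD(1)[OF fg(2) s(2)]
          by eventually_elim simp
      qed
      consider "fst p < t" | "fst p = t" | "t < fst p" "fst p < t1" | "fst p = t1" | "t1 < fst p" by linarith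
      then show ?thesis
      proof cases
        case 1
        have "\<forall>\<^sub>F q in nhds p. h1 q = h q" using ev_fst[OF 1] by eventually_elim (simp add: h_def)
        then show ?thesis by (rule superharmonic_near_cong[OF near1[OF p]])
      next
        case 2
        \<comment> \<open>Strict because \<open>w\<close> is positive inside the region; the
          inequality persists nearby, where \<open>h\<close> is therefore \<open>h1\<close>.\<close>
        have "h1 p < h2 p" using h2_far[of p] w_pos[of p] p VQ 2 a by (auto simp: h1_def t1_def V_def)
        then have "\<forall>\<^sub>F q in nhds p. h1 q < h2 q" by (rule ev_lt[OF tend])
        moreover have "\<forall>\<^sub>F q in nhds p. fst q < t1" using 2 tt by (intro ev_fst) simp
        ultimately have "\<forall>\<^sub>F q in nhds p. h1 q = h q" by eventually_elim (simp add: h_def)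
        then show ?thesis by (rule superharmonic_near_cong[OF near1[OF p]])
      next
        case 3
        have "\<forall>\<^sub>F q in nhds p. min (h1 q) (h2 q) = h q"
          using ev_fst[OF 3(2)] ev_fst'[OF 3(1)] by eventually_elim (simp add: h_def)
        then show ?thesis by (rule superharmonic_near_cong[OF superharmonic_near_min[OF near1[OF p] near2]])
      next
        case 4
        have "\<forall>\<^sub>F q in nhds p. h2 q < h1 q" using h12[of p] p VQ 4 by (intro ev_lt tend) auto
        moreover have "\<forall>\<^sub>F q in nhds p. t < fst q" using 4 tt by (intro ev_fst') simp
        ultimately have "\<forall>\<^sub>F q in nhds p. h2 q = h q" by eventually_elim (simp add: h_def)
        then show ?thesis by (rule superharmonic_near_cong[OF near2])
      next
        case 5
        have "\<forall>\<^sub>F q in nhds p. h2 q = h q" using ev_fst'[OF 5] by eventually_elim (use tt in \<open>simp add: h_def\<close>)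
        then show ?thesis by (rule superharmonic_near_cong[OF near2])
      qed
    qed
    have h0: "0 \<le> h p" if "p \<in> V" for p
      using h1_0[of p] h2_0[of p] that VQ tt unfolding h_def by auto
    \<comment> \<open>The value guaranteed on the left cap, where \<open>w\<close> is at most
      \<open>exp (G xb)\<close>; at the other bad exits the barrier is at least
      \<open>K\<close>.\<close>
    define q where "q = K - exp (G xb)"
    have "exp (G xb) \<le> exp (G t1)" using xb tz tt by (simp add: G_mono)
    moreover have "0 < exp (G t1)" by simp
    ultimately have q: "0 < q" "q \<le> K" unfolding q_def K_def using exp_ge_zero[of "G xb"] by linarith+
    have bad: "q \<le> h p" if p: "p \<in> closure V - V" and notgood: "\<not> (p \<notin> ?D \<and> t < fst p)" for p
    proof -
      have pQ: "p \<in> Q" using p cVQ by auto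
      show ?thesis
      proof (cases "p \<in> ?D")
        case True
        then have "fst p = xb \<or> fst p = t2" using p pQ by (auto simp: V_def Q_def)
        then show ?thesis
        proof
          assume x: "fst p = xb"
          then have "h p = h1 p" using xb tz by (simp add: h_def)
          then show ?thesis using Qw(2)[OF pQ] x by (simp add: h1_def q_def)
        next
          assume x: "fst p = t2"
          then have "h p = h2 p" using tt by (simp add: h_def)
          moreover have "K \<le> h2 p" using x a by (intro h2_far[OF pQ]) (simp add: t1_def t2_def)
          ultimately show ?thesis using q by simp
        qed
      next
        case False
        then have x: "fst p \<le> t" using notgood by auto
        \<comment> \<open>A boundary point of \<open>V\<close> outside the region is on the lateral
          surface, where \<open>\<sigma>\<close> equals \<open>l\<close> and \<open>w\<close>
          vanishes.\<close>
        have "norm (snd p) = A * fst p powr \<alpha>"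
          using False pQ Qx[OF pQ] by (cases p) (auto simp: Q_def parabola_region_def)
        then have "\<sigma> p = l" using \<sigma>[OF Qx[OF pQ]] A Qx[OF pQ] by simp
        then have "h p = K" using x l(3) by (simp add: h_def h1_def w_def)
        then show ?thesis using q by simp
      qed
    qed
    have Vb: "bounded V"
    proof -
      have "norm p \<le> t2 + r" if "p \<in> V" for p
      proof -
        have "norm p \<le> norm (fst p) + norm (snd p)" using norm_Pair_le[of "fst p" "snd p"] by simp
        also have "norm (fst p) \<le> t2" using that xb by (auto simp: V_def)
        also have "norm (snd p) \<le> r" using that VQ by (intro Qr) auto
        finally show ?thesis by simp
      qed
      then show ?thesis unfolding bounded_iff by blast
    qed
    obtain F where F[measurable]: "F \<in> borel_measurable M" and Fi: "(\<integral>\<^sup>+\<omega>. F \<omega> \<partial>M) \<le> ennreal (h z)"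
      and Fae: "AE \<omega> in M. exit_time B V \<omega> < \<infinity> \<longrightarrow> ennreal (h (exit_position B V \<omega>)) \<le> F \<omega>"
      using superharmonic_exit_expectation[OF V zV continuous_on_subset[OF cont cVQ] h0 near] by blast
    have [measurable]: "exit_position B ?D \<in> borel_measurable M"
      by (rule borel_measurable_exit_position[OF open_parabola_region])
    let ?bad = "{\<omega> \<in> space M. \<not> t < norm (exit_position B ?D \<omega>)}"
    have "AE \<omega> in M. ennreal q * indicator ?bad \<omega> \<le> F \<omega>"
      using Fae AE_exit_time_finite[OF Vb] start AE_space
    proof eventually_elim
      case (elim \<omega>)
      have "ennreal q \<le> F \<omega>" if "\<omega> \<in> ?bad"
      proof -
        have e: "exit_position B V \<omega> \<in> closure V - V"
          using exit_position_mem_boundary[OF elim(4,3) V zV] elim by auto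
        have "\<not> (exit_position B V \<omega> \<notin> ?D \<and> t < fst (exit_position B V \<omega>))"
        proof
          assume *: "exit_position B V \<omega> \<notin> ?D \<and> t < fst (exit_position B V \<omega>)"
          have "exit_position B ?D \<omega> = exit_position B V \<omega>"
            using * elim by (intro exit_position_superset[OF _ _ V zV]) (auto simp: V_def)
          moreover have "fst (exit_position B V \<omega>) \<le> norm (exit_position B V \<omega>)"
            using norm_fst_le[of "fst (exit_position B V \<omega>)" "snd (exit_position B V \<omega>)"] by simp
          ultimately show False using that * by simp
        qed
        from bad[OF e this] have "ennreal q \<le> ennreal (h (exit_position B V \<omega>))" by (rule ennreal_leI)
        then show ?thesis using elim by (auto intro: order_trans)
      qed
      then show ?case by (auto simp: indicator_def)
    qed
    then have "(\<integral>\<^sup>+\<omega>. ennreal q * indicator ?bad \<omega> \<partial>M) \<le> (\<integral>\<^sup>+\<omega>. F \<omega> \<partial>M)" by (rule nn_integral_mono_AE)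
    also have "(\<integral>\<^sup>+\<omega>. ennreal q * indicator ?bad \<omega> \<partial>M) = ennreal q * emeasure M ?bad"
      by (intro nn_integral_cmult_indicator) measurable
    finally have "ennreal q * emeasure M ?bad \<le> ennreal (h z)" using Fi by (rule order_trans)
    then have "ennreal (q * prob ?bad) \<le> ennreal (h z)"
      using q by (simp add: emeasure_eq_measure ennreal_mult')
    then have qb: "q * prob ?bad \<le> K - w z"
      using h0[OF zV] tz by (simp add: ennreal_le_iff h_def h1_def)
    have "prob ?bad = 1 - prob {\<omega> \<in> space M. t < norm (exit_position B ?D \<omega>)}"
      by (rule prob_neg) measurable
    with qb have "w z - exp (G xb) \<le> q * prob {\<omega> \<in> space M. t < norm (exit_position B ?D \<omega>)}"
      by (simp add: q_def algebra_simps)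
    also have "\<dots> \<le> K * prob {\<omega> \<in> space M. t < norm (exit_position B ?D \<omega>)}"
      using q by (intro mult_right_mono) auto
    finally have "k * exp (- G t1) \<le> prob {\<omega> \<in> space M. t < norm (exit_position B ?D \<omega>)}"
      by (simp add: k_def K_def exp_minus field_simps)
    moreover have "t1 = (1 + \<epsilon>) * t" by (simp add: t1_def a_def algebra_simps)
    ultimately show ?thesis by simp
  qed
  then show ?thesis using k unfolding G_def c_def by blast
qed

section \<open>Tail and exponential moments of the exit position\<close>

text \<open>Markov's inequality for \<open>exp (b * X powr p)\<close>; adding 1 to the moment makes
  the constant positive.\<close>

lemma (in prob_space) exponential_tail:
  assumes X[measurable]: "X \<in> borel_measurable M" and b: "0 \<le> b" and p: "0 \<le> p"
    and fin: "(\<integral>\<^sup>+\<omega>. ennreal (exp (b * X \<omega> powr p)) \<partial>M) < \<infinity>"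
  shows "\<exists>K>0. \<forall>t\<ge>0. prob {\<omega> \<in> space M. t < X \<omega>} \<le> K * exp (- b * t powr p)"
proof -
  obtain I where I: "0 \<le> I" "(\<integral>\<^sup>+\<omega>. ennreal (exp (b * X \<omega> powr p)) \<partial>M) = ennreal I"
    using fin by (cases "\<integral>\<^sup>+\<omega>. ennreal (exp (b * X \<omega> powr p)) \<partial>M") auto
  have "prob {\<omega> \<in> space M. t < X \<omega>} \<le> (I + 1) * exp (- b * t powr p)" if t: "0 \<le> t" for t
  proof -
    let ?E = "{\<omega> \<in> space M. t < X \<omega>}"
    have "ennreal (exp (b * t powr p)) * emeasure M ?E = (\<integral>\<^sup>+\<omega>. ennreal (exp (b * t powr p)) * indicator ?E \<omega> \<partial>M)"
      by (intro nn_integral_cmult_indicator[symmetric]) measurable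
    also have "\<dots> \<le> (\<integral>\<^sup>+\<omega>. ennreal (exp (b * X \<omega> powr p)) \<partial>M)"
      using b p t by (intro nn_integral_mono) (auto simp: indicator_def intro!: mult_left_mono powr_mono2)
    finally have "ennreal (exp (b * t powr p) * prob ?E) \<le> ennreal I"
      unfolding I(2) by (simp add: emeasure_eq_measure ennreal_mult')
    then have "exp (b * t powr p) * prob ?E \<le> I + 1" using I(1) by (simp add: ennreal_le_iff)
    then show ?thesis by (simp add: exp_minus field_simps)
  qed
  then show ?thesis using I(1) by (intro exI[of _ "I + 1"]) auto
qed

lemma tendsto_powr_ln_0:
  fixes a :: real
  assumes "a < 0"
  shows "((\<lambda>t. t powr a * ln t) \<longlongrightarrow> 0) at_top"
proof (rule tendsto_sandwich)
  show "\<forall>\<^sub>F t in at_top. 0 \<le> t powr a * ln t"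
    using eventually_ge_at_top[of 1] by eventually_elim simp
  show "\<forall>\<^sub>F t in at_top. t powr a * ln t \<le> t powr (a / 2) * (2 / - a)"
    using eventually_ge_at_top[of 1]
  proof eventually_elim
    case (elim t)
    have "ln t \<le> t powr (- a / 2) / (- a / 2)" using elim assms by (intro ln_powr_bound) auto
    then have "t powr a * ln t \<le> t powr a * (t powr (- a / 2) / (- a / 2))" by (intro mult_left_mono) auto
    also have "\<dots> = (t powr a * t powr (- a / 2)) * (2 / - a)" by simp
    also have "t powr a * t powr (- a / 2) = t powr (a / 2)" by (simp flip: powr_add)
    finally show ?case .
  qed
  show "((\<lambda>t. t powr (a / 2) * (2 / - a)) \<longlongrightarrow> 0) at_top"
    using assms by (intro tendsto_mult_left_zero tendsto_neg_powr filterlim_ident) auto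
qed auto

text \<open>The weight \<open>t powr (\<alpha> - 1)\<close> removes the constant \<open>K\<close>.
  Eventual positivity of the tail is required because \<open>ln 0\<close> is 0, where monotonicity
  of the logarithm fails.\<close>

lemma log_tail_upper:
  fixes P :: "real \<Rightarrow> real"
  assumes K: "0 < K" "\<And>t. 0 \<le> t \<Longrightarrow> P t \<le> K * exp (- b * t powr (1 - \<alpha>))"
    and pos: "\<forall>\<^sub>F t in at_top. 0 < P t" and \<alpha>: "\<alpha> < 1" and \<delta>: "0 < \<delta>"
  shows "\<forall>\<^sub>F t in at_top. t powr (\<alpha> - 1) * ln (P t) < - b + \<delta>"
proof -
  have "((\<lambda>t. t powr (\<alpha> - 1) * ln K) \<longlongrightarrow> 0) at_top"
    using \<alpha> by (intro tendsto_mult_left_zero tendsto_neg_powr filterlim_ident) auto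
  then have "\<forall>\<^sub>F t in at_top. t powr (\<alpha> - 1) * ln K < \<delta>" by (rule order_tendstoD) (rule \<delta>)
  with pos eventually_gt_at_top[of 0] show ?thesis
  proof eventually_elim
    case (elim t)
    have "ln (P t) \<le> ln (K * exp (- b * t powr (1 - \<alpha>)))" using elim K by simp
    also have "\<dots> = ln K - b * t powr (1 - \<alpha>)" using K by (simp add: ln_mult)
    finally have "t powr (\<alpha> - 1) * ln (P t) \<le> t powr (\<alpha> - 1) * (ln K - b * t powr (1 - \<alpha>))"
      by (intro mult_left_mono) auto
    also have "\<dots> = t powr (\<alpha> - 1) * ln K - b * (t powr (\<alpha> - 1) * t powr (1 - \<alpha>))" by (simp add: algebra_simps)
    also have "t powr (\<alpha> - 1) * t powr (1 - \<alpha>) = 1" using elim by (simp flip: powr_add)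
    finally show ?case using elim by simp
  qed
qed

text \<open>Stretching \<open>t\<close> by \<open>1 + \<epsilon>\<close> costs at most
  \<open>c * \<epsilon>\<close> in the rate, since
  \<open>(1 + \<epsilon>) powr (1 - \<alpha>)\<close> is at most \<open>1 + \<epsilon>\<close>; the
  polynomial factor contributes only \<open>ln t\<close>, which the weight sends to 0.\<close>

lemma log_tail_lower:
  fixes P :: "real \<Rightarrow> real"
  assumes k: "0 < k" "\<And>t. t0 \<le> t \<Longrightarrow> k * exp (- (c * ((1 + \<epsilon>) * t) powr (1 - \<alpha>) + N * ln ((1 + \<epsilon>) * t))) \<le> P t"
    and \<alpha>: "0 < \<alpha>" "\<alpha> < 1" and \<epsilon>: "0 < \<epsilon>" "c * \<epsilon> < \<delta>" and c: "0 < c"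
  shows "\<forall>\<^sub>F t in at_top. 0 < P t" "\<forall>\<^sub>F t in at_top. - c - \<delta> < t powr (\<alpha> - 1) * ln (P t)"
proof -
  have pos: "0 < P t" if "t0 \<le> t" for t
    using k(1) by (intro less_le_trans[OF _ k(2)[OF that]]) simp
  then show "\<forall>\<^sub>F t in at_top. 0 < P t" by (auto simp: eventually_at_top_linorder)
  let ?g = "\<lambda>t. t powr (\<alpha> - 1) * (ln k - N * ln (1 + \<epsilon>)) - c * (1 + \<epsilon>) powr (1 - \<alpha>) - N * (t powr (\<alpha> - 1) * ln t)"
  have "(?g \<longlongrightarrow> 0 - c * (1 + \<epsilon>) powr (1 - \<alpha>) - N * 0) at_top"
    using \<alpha> by (intro tendsto_intros tendsto_powr_ln_0 tendsto_mult_left_zero tendsto_neg_powr filterlim_ident) auto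
  moreover have "- c - \<delta> < 0 - c * (1 + \<epsilon>) powr (1 - \<alpha>) - N * 0"
  proof -
    have "(1 + \<epsilon>) powr (1 - \<alpha>) \<le> 1 + \<epsilon>" using powr_mono[of "1 - \<alpha>" 1 "1 + \<epsilon>"] \<alpha> \<epsilon> by auto
    then have "c * (1 + \<epsilon>) powr (1 - \<alpha>) \<le> c * (1 + \<epsilon>)" using c by (intro mult_left_mono) auto
    then show ?thesis using \<epsilon> by (simp add: algebra_simps)
  qed
  ultimately have "\<forall>\<^sub>F t in at_top. - c - \<delta> < ?g t" by (rule order_tendstoD)
  with eventually_gt_at_top[of 0] eventually_ge_at_top[of t0]
  show "\<forall>\<^sub>F t in at_top. - c - \<delta> < t powr (\<alpha> - 1) * ln (P t)"
  proof eventually_elim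
    case (elim t)
    let ?x = "c * ((1 + \<epsilon>) * t) powr (1 - \<alpha>) + N * ln ((1 + \<epsilon>) * t)"
    have "ln k - ?x = ln (k * exp (- ?x))" using k(1) by (simp add: ln_mult)
    also have "\<dots> \<le> ln (P t)" using k elim by (intro ln_mono) auto
    finally have "t powr (\<alpha> - 1) * (ln k - ?x) \<le> t powr (\<alpha> - 1) * ln (P t)" by (intro mult_left_mono) auto
    moreover have "t powr (\<alpha> - 1) * (ln k - ?x) = ?g t"
    proof -
      have 1: "((1 + \<epsilon>) * t) powr (1 - \<alpha>) = (1 + \<epsilon>) powr (1 - \<alpha>) * t powr (1 - \<alpha>)" by (rule powr_mult)
      have 2: "ln ((1 + \<epsilon>) * t) = ln (1 + \<epsilon>) + ln t" using elim \<epsilon> by (simp add: ln_mult)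
      have 3: "t powr (\<alpha> - 1) * t powr (1 - \<alpha>) = 1" using elim by (simp flip: powr_add)
      have "t powr (\<alpha> - 1) * (ln k - ?x) = t powr (\<alpha> - 1) * (ln k - N * ln (1 + \<epsilon>))
          - c * (1 + \<epsilon>) powr (1 - \<alpha>) * (t powr (\<alpha> - 1) * t powr (1 - \<alpha>)) - N * (t powr (\<alpha> - 1) * ln t)"
        unfolding 1 2 by (simp add: algebra_simps)
      then show ?thesis unfolding 3 by simp
    qed
    ultimately show ?case using elim by linarith
  qed
qed

theorem parabola_exit_tail:
  fixes B :: "real \<Rightarrow> 'w \<Rightarrow> real \<times> 'a::euclidean_space" and \<alpha> A :: real
  assumes \<alpha>: "0 < \<alpha>" "\<alpha> < 1" and A: "0 < A"
    and z: "z \<in> parabola_region \<alpha> A" and B: "brownian_motion M B z"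
  defines "c \<equiv> sqrt (dirichlet_lambda1 (ball 0 1 :: 'a set)) / (A * (1 - \<alpha>))"
    and "E \<equiv> \<lambda>b. \<integral>\<^sup>+ \<omega>. ennreal (exp (b * norm (exit_position B (parabola_region \<alpha> A) \<omega>) powr (1 - \<alpha>))) \<partial>M"
  shows "((\<lambda>t. t powr (\<alpha> - 1) * ln (\<P>(\<omega> in M. norm (exit_position B (parabola_region \<alpha> A) \<omega>) > t))) \<longlongrightarrow> - c) at_top"
    and "\<And>b. b < c \<Longrightarrow> E b < \<infinity>" and "\<And>b. c < b \<Longrightarrow> E b = \<infinity>"
proof -
  interpret brownian_motion M B z by fact
  define X where "X \<omega> = norm (exit_position B (parabola_region \<alpha> A) \<omega>)" for \<omega>
  define P where "P t = prob {\<omega> \<in> space M. t < X \<omega>}" for t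
  have Xm: "X \<in> borel_measurable M"
    unfolding X_def using borel_measurable_exit_position[OF open_parabola_region] by measurable
  obtain l where l: "0 < l" "radial_profile DIM('a) l = 0" "\<And>s. 0 \<le> s \<Longrightarrow> s < l \<Longrightarrow> 0 < radial_profile DIM('a) s"
    using radial_profile_first_zero[where 'a='a] by blast
  have "dirichlet_lambda1 (ball 0 1 :: 'a set) = l"
    by (rule dirichlet_lambda1_ball) (use l in auto)
  then have cl: "c = sqrt l / (A * (1 - \<alpha>))" by (simp add: c_def)
  have c: "0 < c" unfolding cl using l A \<alpha> by simp
  show fin: "E b < \<infinity>" if "b < c" for b
    using parabola_exp_moment_finite[OF \<alpha> A l(1,3) z B] that unfolding E_def cl by blast
  have low: "(\<forall>\<^sub>F t in at_top. 0 < P t) \<and> (\<forall>\<^sub>F t in at_top. - c - \<delta> < t powr (\<alpha> - 1) * ln (P t))" if \<delta>: "0 < \<delta>" for \<delta>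
  proof -
    define \<epsilon> where "\<epsilon> = \<delta> / (2 * c)"
    have \<epsilon>: "0 < \<epsilon>" "c * \<epsilon> < \<delta>" using \<delta> c by (auto simp: \<epsilon>_def)
    obtain k N t0 where "0 < k" "\<forall>t\<ge>t0. k * exp (- (c * ((1 + \<epsilon>) * t) powr (1 - \<alpha>) + N * ln ((1 + \<epsilon>) * t))) \<le> P t"
      using parabola_exit_tail_lower[OF \<alpha> A l(1,3,2) z B \<epsilon>(1)] unfolding cl P_def X_def by blast
    then show ?thesis using log_tail_lower[of k t0 c \<epsilon> \<alpha> N P \<delta>] \<alpha> \<epsilon> c by blast
  qed
  have up: "\<forall>\<^sub>F t in at_top. t powr (\<alpha> - 1) * ln (P t) < - b + \<delta>" if "0 < b" "E b < \<infinity>" "0 < \<delta>" for b \<delta>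
  proof -
    have "\<exists>K>0. \<forall>t\<ge>0. prob {\<omega> \<in> space M. t < X \<omega>} \<le> K * exp (- b * t powr (1 - \<alpha>))"
      using that \<alpha> by (intro exponential_tail Xm) (auto simp: E_def X_def)
    then obtain K where "0 < K" "\<And>t. 0 \<le> t \<Longrightarrow> P t \<le> K * exp (- b * t powr (1 - \<alpha>))"
      unfolding P_def by blast
    then show ?thesis using low[OF that(3)] \<alpha> that by (intro log_tail_upper) auto
  qed
  have "((\<lambda>t. t powr (\<alpha> - 1) * ln (P t)) \<longlongrightarrow> - c) at_top"
  proof (rule order_tendstoI)
    fix a assume "a < - c"
    then show "\<forall>\<^sub>F t in at_top. a < t powr (\<alpha> - 1) * ln (P t)" using low[of "- c - a"] by simp
  next
    fix a assume "- c < a"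
    \<comment> \<open>Any positive subcritical \<open>b\<close> above \<open>- a\<close> yields the
      upper bound; the maximum with 0 keeps \<open>b\<close> positive when \<open>a\<close>
      is.\<close>
    then obtain m where m: "0 \<le> m" "- a \<le> m" "m < c" using c that[of "max (- a) 0"] by auto
    define b where "b = (m + c) / 2"
    have b: "0 < b" "b < c" "m < b" using m by (simp_all add: b_def)
    then have "- b < a" using m(2) by linarith
    show "\<forall>\<^sub>F t in at_top. t powr (\<alpha> - 1) * ln (P t) < a"
      using up[OF b(1) fin[OF b(2)], of "a + b"] \<open>- b < a\<close> by simp
  qed
  then show "((\<lambda>t. t powr (\<alpha> - 1) * ln (\<P>(\<omega> in M. norm (exit_position B (parabola_region \<alpha> A) \<omega>) > t))) \<longlongrightarrow> - c) at_top"
    unfolding P_def X_def .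
  \<comment> \<open>A finite moment would force the rate \<open>b\<close> on the tail, faster than
    the lower bound allows. The margin \<open>(b - c) / 2\<close> makes both estimates meet at
    \<open>- (b + c) / 2\<close>.\<close>
  show "E b = \<infinity>" if b: "c < b" for b
  proof (rule ccontr)
    assume "E b \<noteq> \<infinity>"
    then have "E b < \<infinity>" by (simp add: less_top)
    then have "\<forall>\<^sub>F t in at_top. t powr (\<alpha> - 1) * ln (P t) < - b + (b - c) / 2"
      using b c by (intro up) auto
    moreover have "\<forall>\<^sub>F t in at_top. - c - (b - c) / 2 < t powr (\<alpha> - 1) * ln (P t)"
      using low[of "(b - c) / 2"] b by simp
    ultimately have "\<forall>\<^sub>F t::real in at_top. False"
    proof eventually_elim
      case (elim t)
      then have "- c - (b - c) / 2 < - b + (b - c) / 2" by (rule less_trans[rotated])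
      then show False by (simp add: field_simps)
    qed
    then show False by (simp add: eventually_False)
  qed
qed

text \<open>The cross section space is \<open>real ^ 'd\<close>, so \<open>n - 1\<close> is the
  number of elements of \<open>'d\<close>, which is at least 1.\<close>

theorem theorem3:
  fixes M :: "'w measure"
    and B :: "real \<Rightarrow> 'w \<Rightarrow> real \<times> (real ^ 'd)"
    and z :: "real \<times> (real ^ 'd)"
    and \<alpha> A lambda1 :: real
  assumes "lambda1 = dirichlet_lambda1 (ball 0 1 :: (real ^ 'd) set)"
    and "0 < \<alpha>" and "\<alpha> < 1" and "0 < A"
    and "z \<in> parabola_region \<alpha> A"
    and "brownian_motion M B z"
  shows "((\<lambda>t. t powr (\<alpha> - 1) *
              ln (\<P>(\<omega> in M. norm (exit_position B (parabola_region \<alpha> A) \<omega>) > t)))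
            \<longlongrightarrow> - (sqrt lambda1 / (A * (1 - \<alpha>)))) at_top
    \<and> (\<forall>b < sqrt lambda1 / (A * (1 - \<alpha>)).
          (\<integral>\<^sup>+ \<omega>. ennreal (exp (b * norm (exit_position B (parabola_region \<alpha> A) \<omega>) powr (1 - \<alpha>))) \<partial>M) < \<infinity>)
    \<and> (\<forall>b > sqrt lambda1 / (A * (1 - \<alpha>)).
          (\<integral>\<^sup>+ \<omega>. ennreal (exp (b * norm (exit_position B (parabola_region \<alpha> A) \<omega>) powr (1 - \<alpha>))) \<partial>M) = \<infinity>)"
  using parabola_exit_tail[OF assms(2-6)] unfolding assms(1) by blast

end
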